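(* There exists a universal abstract regular polytope $\{\{3,3,4,3\}_{\mathbf{s}},\{3,4,3,3\}_{\mathbf{t}}\}$ for $\mathbf{s}=(3,0,0,0)$ and $\mathbf{t}=(6,6,0,0)$; that is, the class of abstract regular polytopes of rank $6$ with facets isomorphic to $\{3,3,4,3\}_{(3,0,0,0)}$ and vertex figures isomorphic to $\{3,4,3,3\}_{(6,6,0,0)}$ is nonempty.
   Context: Conjugation is $x^y=y^{-1}xy$. The Coxeter group $[p_1,\dots,p_{r-1}]$ has generating involutions $g_1,\dots,g_r$, with $(g_ig_{i+1})^{p_i}=1$ and $(g_ig_j)^2=1$ for $|i-j|\ge 2$. A quotient $G=\langle g_1,\dots,g_r\rangle$ of such a Coxeter group satisfies the intersection property if $G_I\cap G_J=G_{I\cap J}$ for all $I,J\subseteq\{1,\dots,r\}$, where $G_I=\langle g_i\mid i\in I\rangle$. Abstract regular polytopes of rank $r$ and Schläfli type $\{p_1,\dots,p_{r-1}\}$ correspond to such quotients $G$ satisfying the intersection property, in which the relations above give the exact orders of the $g_i$ and of the products $g_ig_j$; $G$ (with its ordered generators) is the group of the polytope. The facets are the polytopes with group $\langle g_1,\dots,g_{r-1}\rangle$ and the vertex figures are those with group $\langle g_2,\dots,g_r\rangle$. $\{3,3,4,3\}_{(s,0,0,0)}$, respectively $\{3,3,4,3\}_{(s,s,0,0)}$ ($s\ge 2$), is the finite abstract regular polytope whose group is the Coxeter group $[3,3,4,3]=\langle a,b,c,d,e\rangle$ (generators in diagram order) subject to the single extra relation $(a\sigma\tau\sigma)^s=1$,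 respectively $(a\sigma\tau)^{2s}=1$, where $\sigma=d^{cb}$, $\tau=c^{de}$. The polytopes $\{3,4,3,3\}_{\mathbf t}$ are the duals, obtained by reversing the order of the generators. $\{\mathcal P_f,\mathcal P_v\}$ denotes the universal polytope in the class of all abstract regular polytopes with facets isomorphic to $\mathcal P_f$ and vertex figures isomorphic to $\mathcal P_v$, i.e. the unique member covering all other members of the class (covering: surjection of groups sending ordered generators to ordered generators); it is known to exist whenever the class is nonempty. *)

theory Defs
  imports "HOL-Algebra.Generated_Groups" "HOL-Algebra.Multiplicative_Group"
begin

text \<open>
  An abstract regular polytope is represented by its group together with the ordered list of its
  distinguished generators. Lists are indexed from 0, so the generator written \<open>g\<^sub>i\<close> in the
  literature is \<open>gs ! (i - 1)\<close>.
\<close>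

type_synonym 'a polytope = "'a monoid \<times> 'a list"

definition intersection_property :: "'a monoid \<Rightarrow> 'a list \<Rightarrow> bool" where
  "intersection_property G gs \<longleftrightarrow>
     (\<forall>I J. I \<subseteq> {..<length gs} \<longrightarrow> J \<subseteq> {..<length gs} \<longrightarrow>
        generate G ((!) gs ` I) \<inter> generate G ((!) gs ` J) = generate G ((!) gs ` (I \<inter> J)))"

text \<open>
  The Schlaefli type is \<open>ps\<close>, hence the rank is \<open>length ps + 1\<close>. Since \<^term>\<open>group.ord G x\<close> is 0
  for elements of infinite order, an entry 0 of \<open>ps\<close> encodes infinity.
\<close>

fun regular_polytope_of_type :: "nat list \<Rightarrow> 'a polytope \<Rightarrow> bool" where
  "regular_polytope_of_type ps (G, gs) \<longleftrightarrow>
     group G \<and> length gs = length ps + 1 \<and>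
     set gs \<subseteq> carrier G \<and> generate G (set gs) = carrier G \<and>
     (\<forall>i<length gs. group.ord G (gs ! i) = 2) \<and>
     (\<forall>i<length ps. group.ord G (gs ! i \<otimes>\<^bsub>G\<^esub> gs ! Suc i) = ps ! i) \<and>
     (\<forall>i j. i + 2 \<le> j \<longrightarrow> j < length gs \<longrightarrow> group.ord G (gs ! i \<otimes>\<^bsub>G\<^esub> gs ! j) = 2) \<and>
     intersection_property G gs"

definition regular_polytope :: "nat \<Rightarrow> 'a polytope \<Rightarrow> bool" where
  "regular_polytope r P \<longleftrightarrow> (\<exists>ps. length ps + 1 = r \<and> regular_polytope_of_type ps P)"

fun facet :: "'a polytope \<Rightarrow> 'a polytope" where
  "facet (G, gs) = (subgroup_generated G (set (butlast gs)), butlast gs)"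

fun vertex_figure :: "'a polytope \<Rightarrow> 'a polytope" where
  "vertex_figure (G, gs) = (subgroup_generated G (set (tl gs)), tl gs)"

fun dual :: "'a polytope \<Rightarrow> 'a polytope" where
  "dual (G, gs) = (G, rev gs)"

fun polytope_iso :: "'a polytope \<Rightarrow> 'b polytope \<Rightarrow> bool" where
  "polytope_iso (G, gs) (H, hs) \<longleftrightarrow> (\<exists>f \<in> iso G H. map f gs = hs)"

fun covers :: "'a polytope \<Rightarrow> 'b polytope \<Rightarrow> bool" where
  "covers (G, gs) (H, hs) \<longleftrightarrow> (\<exists>f \<in> epi G H. map f gs = hs)"

definition polytope_class :: "nat \<Rightarrow> 'f polytope \<Rightarrow> 'v polytope \<Rightarrow> 'a polytope set" where
  "polytope_class r F V =
     {P. regular_polytope r P \<and> polytope_iso (facet P) F \<and> polytope_iso (vertex_figure P) V}"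

text \<open>
  Groups presented by involutory generators \<open>0, \<dots>, n - 1\<close> and a set \<open>R\<close> of relators. As every
  generator is its own inverse, positive words suffice, the inverse of a word being its reversal;
  the relators \<open>[i, i]\<close> are supplied by the rule \<open>involution\<close>.
\<close>

inductive pres_eq :: "nat \<Rightarrow> nat list set \<Rightarrow> nat list \<Rightarrow> nat list \<Rightarrow> bool" for n R where
  refl: "u \<in> lists {..<n} \<Longrightarrow> pres_eq n R u u"
| sym: "pres_eq n R u v \<Longrightarrow> pres_eq n R v u"
| trans: "pres_eq n R u v \<Longrightarrow> pres_eq n R v w \<Longrightarrow> pres_eq n R u w"
| involution: "u \<in> lists {..<n} \<Longrightarrow> v \<in> lists {..<n} \<Longrightarrow> i < n \<Longrightarrow>
    pres_eq n R (u @ [i, i] @ v) (u @ v)"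
| relator: "u \<in> lists {..<n} \<Longrightarrow> v \<in> lists {..<n} \<Longrightarrow> w \<in> R \<Longrightarrow> w \<in> lists {..<n} \<Longrightarrow>
    pres_eq n R (u @ w @ v) (u @ v)"

definition word_class :: "nat \<Rightarrow> nat list set \<Rightarrow> nat list \<Rightarrow> nat list set" where
  "word_class n R u = {v. pres_eq n R u v}"

definition presented_group :: "nat \<Rightarrow> nat list set \<Rightarrow> nat list set monoid" where
  "presented_group n R =
     \<lparr>carrier = word_class n R ` lists {..<n},
      mult = (\<lambda>A B. \<Union>a\<in>A. \<Union>b\<in>B. word_class n R (a @ b)),
      one = word_class n R []\<rparr>"

definition word_pow :: "nat list \<Rightarrow> nat \<Rightarrow> nat list" where
  "word_pow w k = concat (replicate k w)"

text \<open>\<open>x\<^sup>y = y\<^sup>-\<^sup>1 x y\<close>\<close>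

definition word_conj :: "nat list \<Rightarrow> nat list \<Rightarrow> nat list" where
  "word_conj x y = rev y @ x @ y"

definition coxeter_relators :: "nat list \<Rightarrow> nat list set" where
  "coxeter_relators ps =
     {word_pow [i, Suc i] (ps ! i) |i. i < length ps} \<union>
     {word_pow [i, j] 2 |i j. i + 2 \<le> j \<and> j \<le> length ps}"

text \<open>The Coxeter group \<open>[p\<^sub>1, \<dots>, p\<^sub>r\<^sub>-\<^sub>1]\<close> subject to the extra relators \<open>R\<close>.\<close>

definition coxeter_quotient :: "nat list \<Rightarrow> nat list set \<Rightarrow> nat list set polytope" where
  "coxeter_quotient ps R =
     (let n = length ps + 1; S = coxeter_relators ps \<union> R
      in (presented_group n S, map (\<lambda>i. word_class n S [i]) [0..<n]))"

text \<open>The generators \<open>a, b, c, d, e\<close> of \<open>[3,3,4,3]\<close> are the letters \<open>0, 1, 2, 3, 4\<close>.\<close>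

definition sigma_word :: "nat list" where
  "sigma_word = word_conj [3] [2, 1]"

definition tau_word :: "nat list" where
  "tau_word = word_conj [2] [3, 4]"

text \<open>\<open>{3,3,4,3}\<close> with index vector \<open>(s,0,0,0)\<close>, respectively \<open>(s,s,0,0)\<close>\<close>

definition polytope_3343_s000 :: "nat \<Rightarrow> nat list set polytope" where
  "polytope_3343_s000 s =
     coxeter_quotient [3,3,4,3] {word_pow ([0] @ sigma_word @ tau_word @ sigma_word) s}"

definition polytope_3343_ss00 :: "nat \<Rightarrow> nat list set polytope" where
  "polytope_3343_ss00 s =
     coxeter_quotient [3,3,4,3] {word_pow ([0] @ sigma_word @ tau_word) (2 * s)}"

definition polytope_3433_ss00 :: "nat \<Rightarrow> nat list set polytope" where
  "polytope_3433_ss00 s = dual (polytope_3343_ss00 s)"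

text \<open>
  A universal member covers the members of the class over every carrier type; HOL cannot quantify
  over types inside a definition, so the carrier type \<open>'b\<close> of the covered polytopes is a parameter.
  Polytope groups are finitely generated, hence countable, so each has an isomorphic copy over any
  type with infinitely many elements.
\<close>

definition universal_polytope ::
    "'b itself \<Rightarrow> nat \<Rightarrow> 'f polytope \<Rightarrow> 'v polytope \<Rightarrow> 'a polytope \<Rightarrow> bool" where
  "universal_polytope _ r F V U \<longleftrightarrow>
     U \<in> polytope_class r F V \<and> (\<forall>P \<in> (polytope_class r F V :: 'b polytope set). covers U P)"

end

theory Submission
  imports Defs "HOL-Number_Theory.Cong" "HOL-Library.Z2"
begin

text \<open>
  The universal polytope is the group \<open>U\<close> generated by six involutions \<open>a, \<dots>, f\<close>
  with the relations of the Coxeter group \<open>[3,3,4,3,3]\<close> and the two toroidal relations, one on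
  \<open>a, \<dots>, e\<close> and one on \<open>f, \<dots>, b\<close>. Every member of the class satisfies these
  relations, so \<open>U\<close> covers it. What has to be shown is that \<open>U\<close> is itself a member:
  nothing collapses, that is, the facet group and the vertex-figure group embed in \<open>U\<close>, and the
  intersection property holds. Collapse is excluded by two representations of \<open>U\<close>.

  The first is the geometric representation of \<open>[3,3,4,3,3]\<close> on its root lattice, reduced modulo 3,
  taken together with the same representation read through the reversal of the diagram. The group
  \<open>[3,3,4,3]\<close> is the affine Weyl group of type \<open>F\<^sub>4\<close>, a lattice \<open>T\<close>
  of translations extended by the finite group \<open>[3,4,3]\<close>. A word that acts trivially modulo 3 acts as
  a translation in \<open>3T\<close>, because the invariant form leaves no room for any other motion congruent to
  the identity (\<open>act_mod_3_translates\<close>). The facet relation kills exactly \<open>3T\<close>, so the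
  facet group embeds (\<open>facet_subgroup_iff\<close>).

  In the vertex-figure group, again an extension of a lattice \<open>T\<close>, the relation kills the smaller
  lattice \<open>6T'\<close>, where \<open>T'\<close> is a sublattice of index 4 in \<open>T\<close>, spanned by
  the translations along sums of two orthogonal minimal vectors. Reduction modulo 3 sees only \<open>T/3T\<close>;
  the remaining quotient \<open>T/2T'\<close> of order 64 must be detected by a representation in which the facet
  relation holds nevertheless. Such a representation is provided by triality over the field with two elements:
  \<open>a\<close>, \<open>b\<close>, \<open>c\<close> act on triples of octonions by triality maps that exchange
  two of the three entries, and \<open>d\<close>, \<open>e\<close>, \<open>f\<close> act by automorphisms of the
  octonion algebra. There the third power of the facet translation is trivial, whereas the translations of the
  vertex-figure group act faithfully modulo \<open>2T'\<close> (\<open>triality_translation_orders\<close>). The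
  two representations together give \<open>vertex_figure_subgroup_iff\<close>.

  For the intersection property it suffices, the diagram being a string, to compare the subgroups of two
  overlapping intervals \<open>{i, \<dots>, j-1}\<close> and \<open>{i+1, \<dots>, j}\<close> of generators
  (\<open>words_meet_of_intervals\<close>). An element of both fixes the \<open>i\<close>-th coordinate modulo 3.
  If the first interval avoids \<open>e\<close> and \<open>f\<close>, which can be achieved by reversal of the
  diagram unless the intervals are those of the facet and the vertex-figure group, then the roots of its subgroup
  have \<open>i\<close>-th coordinate \<open>-1\<close>, \<open>0\<close> or \<open>1\<close>. So the element
  fixes that coordinate over the integers, and the stabilizer of a coordinate in a Coxeter group is the expected
  parabolic subgroup (\<open>act_stabilizer\<close>). In the remaining case the facet group is affine, and its
  translations in \<open>3T\<close> are trivial (\<open>facet_stabilizer\<close>).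

  The two facts about Coxeter groups, faithfulness of the geometric representation and the shape of coordinate
  stabilizers, both follow from the theorem that a reduced word without descent at \<open>s\<close> maps the
  simple root \<open>\<alpha>\<^sub>s\<close> to a positive root (\<open>act_reduced_root_nonneg\<close>).
  Faithfulness makes all computations with translations effective: two words that act as the same translation are
  equal in \<open>[3,3,4,3]\<close>, so that relations between translations are identities of integer vectors.
\<close>

section \<open>Words modulo relators\<close>

lemma rev_in_lists [simp]: "rev u \<in> lists A \<longleftrightarrow> u \<in> lists A"
  by (simp add: in_lists_conv_set)

lemma pres_eq_lists:
  assumes "pres_eq n R u v"
  shows "u \<in> lists {..<n}" "v \<in> lists {..<n}"
  using assms by (induction rule: pres_eq.induct) auto

lemma pres_eq_letters_refl: "(\<And>i. i \<in> set u \<Longrightarrow> i < n) \<Longrightarrow> pres_eq n R u u"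
  by (rule pres_eq.refl) (simp add: in_lists_conv_set)

lemma pres_eq_context:
  assumes "pres_eq n R u v" "x \<in> lists {..<n}" "y \<in> lists {..<n}"
  shows "pres_eq n R (x @ u @ y) (x @ v @ y)"
  using assms
proof (induction rule: pres_eq.induct)
  case (involution u v i)
  then show ?case using pres_eq.involution[of "x @ u" n "v @ y" i R] by simp
next
  case (relator u v w)
  then show ?case using pres_eq.relator[of "x @ u" n "v @ y" w R] by simp
next
  case (trans u v w)
  then show ?case by (blast intro: pres_eq.trans)
next
  case (refl u)
  then show ?case by (simp add: pres_eq.refl)
qed (blast intro: pres_eq.sym)

lemma pres_eq_append:
  assumes "pres_eq n R u u'" "pres_eq n R v v'"
  shows "pres_eq n R (u @ v) (u' @ v')"
proof -
  have "pres_eq n R (u @ v) (u' @ v)"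
    using pres_eq_context[OF assms(1), of "[]" v] pres_eq_lists[OF assms(2)] by simp
  moreover have "pres_eq n R (u' @ v) (u' @ v')"
    using pres_eq_context[OF assms(2), of u' "[]"] pres_eq_lists[OF assms(1)] by simp
  ultimately show ?thesis by (rule pres_eq.trans)
qed

lemma pres_eq_append_rev:
  assumes "u \<in> lists {..<n}"
  shows "pres_eq n R (u @ rev u) []"
  using assms
proof (induction u rule: rev_induct)
  case (snoc i u)
  have "pres_eq n R (u @ [i, i] @ rev u) (u @ rev u)"
    using snoc.prems by (intro pres_eq.involution) auto
  moreover have "pres_eq n R (u @ rev u) []"
    using snoc by simp
  ultimately show ?case by (simp add: pres_eq.trans)
qed (auto intro: pres_eq_letters_refl)

lemma pres_eq_rev_append:
  "u \<in> lists {..<n} \<Longrightarrow> pres_eq n R (rev u @ u) []"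
  using pres_eq_append_rev[of "rev u" n R] by simp

lemma pres_eq_Nil_left: "pres_eq n R u [] \<Longrightarrow> pres_eq n R v w \<Longrightarrow> pres_eq n R (u @ v) w"
  using pres_eq_append[of n R u "[]" v w] by simp

text \<open>
  Reduces the word problem to recognizing trivial words; a reversed word is an inverse because the generators are
  involutions.
\<close>

lemma pres_eq_cancel_iff:
  assumes "u \<in> lists {..<n}" "v \<in> lists {..<n}"
  shows "pres_eq n R (u @ rev v) [] \<longleftrightarrow> pres_eq n R u v"
proof
  assume *: "pres_eq n R (u @ rev v) []"
  have "pres_eq n R (u @ rev v @ v) (u @ [])"
    using assms pres_eq_append[OF pres_eq.refl[of u] pres_eq_rev_append[of v]] by simp
  moreover have "pres_eq n R ((u @ rev v) @ v) v"
    by (intro pres_eq_Nil_left * pres_eq.refl assms)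
  ultimately show "pres_eq n R u v"
    by (metis append.assoc append_Nil2 pres_eq.sym pres_eq.trans)
next
  assume "pres_eq n R u v"
  then have "pres_eq n R (u @ rev v) (v @ rev v)"
    using assms by (intro pres_eq_append pres_eq.refl) auto
  then show "pres_eq n R (u @ rev v) []"
    using pres_eq_append_rev[OF assms(2)] by (rule pres_eq.trans)
qed

lemma pres_eq_rev:
  assumes "pres_eq n R u v"
  shows "pres_eq n R (rev u) (rev v)"
proof -
  have "pres_eq n R (rev u @ v) (rev u @ u)"
    using pres_eq_lists[OF assms] pres_eq.sym[OF assms]
    by (intro pres_eq_append pres_eq.refl) auto
  moreover have "pres_eq n R (rev u @ u) []"
    using pres_eq_lists[OF assms] by (intro pres_eq_rev_append)
  ultimately have "pres_eq n R (rev u @ rev (rev v)) []"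
    unfolding rev_rev_ident by (rule pres_eq.trans)
  then show ?thesis
    using pres_eq_cancel_iff[of "rev u" n "rev v" R] pres_eq_lists[OF assms] by simp
qed

lemma pres_eq_conj:
  assumes "pres_eq n R u []" "g \<in> lists {..<n}"
  shows "pres_eq n R (g @ u @ rev g) []"
proof -
  have "pres_eq n R (g @ u @ rev g) (g @ [] @ rev g)"
    using assms by (intro pres_eq_append pres_eq.refl) auto
  moreover have "pres_eq n R (g @ [] @ rev g) []"
    using pres_eq_append_rev[OF assms(2)] by simp
  ultimately show ?thesis by (rule pres_eq.trans)
qed

lemma word_pow_simps [simp]:
  "word_pow w 0 = []" "word_pow w (Suc k) = w @ word_pow w k"
  by (simp_all add: word_pow_def)

lemma word_pow_one [simp]: "word_pow w 1 = w" by (simp add: word_pow_def)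

lemma word_pow_add: "word_pow w (j + k) = word_pow w j @ word_pow w k"
  by (induction j) auto

lemma word_pow_mult: "word_pow w (j * k) = word_pow (word_pow w j) k"
  by (induction k) (auto simp: word_pow_add)

lemma word_pow_Suc_right: "word_pow w (Suc k) = word_pow w k @ w"
  by (metis add.commute plus_1_eq_Suc word_pow_add word_pow_one)

lemma rev_word_pow: "rev (word_pow w k) = word_pow (rev w) k"
proof (induction k)
  case (Suc k)
  have "rev (word_pow w (Suc k)) = word_pow (rev w) k @ rev w" using Suc by simp
  then show ?case by (simp only: word_pow_Suc_right)
qed simp

lemma map_word_pow: "map f (word_pow w k) = word_pow (map f w) k"
  by (induction k) auto

lemma word_pow_lists [simp]: "w \<in> lists A \<Longrightarrow> word_pow w k \<in> lists A"
  by (induction k) auto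

lemma pres_eq_word_pow: "pres_eq n R u v \<Longrightarrow> pres_eq n R (word_pow u k) (word_pow v k)"
proof (induction k)
  case 0
  then show ?case by (simp add: pres_eq.refl)
next
  case (Suc k)
  then show ?case by (simp add: pres_eq_append)
qed

lemma pres_eq_map:
  assumes "pres_eq n R u v" "\<And>i. i < n \<Longrightarrow> g i < m"
    and rel: "\<And>w. w \<in> R \<Longrightarrow> w \<in> lists {..<n} \<Longrightarrow> pres_eq m S (map g w) []"
  shows "pres_eq m S (map g u) (map g v)"
  using assms(1)
proof (induction rule: pres_eq.induct)
  case (involution u v i)
  then have "pres_eq m S (map g u @ [g i, g i] @ map g v) (map g u @ map g v)"
    using assms(2) by (intro pres_eq.involution) (auto simp: in_lists_conv_set)
  then show ?case by simp
next
  case (relator u v w)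
  have "pres_eq m S (map g u @ map g w @ map g v) (map g u @ [] @ map g v)"
    using relator assms(2) by (intro pres_eq_context rel) auto
  then show ?case by simp
next
  case (trans u v w)
  then show ?case by (blast intro: pres_eq.trans)
next
  case (refl u)
  then show ?case using assms(2) by (intro pres_eq.refl) (auto simp: in_lists_conv_set)
qed (blast intro: pres_eq.sym)

lemma pres_eq_mono:
  assumes "pres_eq n R u v" "n \<le> m"
    and "\<And>w. w \<in> R \<Longrightarrow> w \<in> lists {..<n} \<Longrightarrow> pres_eq m S w []"
  shows "pres_eq m S u v"
  using pres_eq_map[of n R u v "\<lambda>i. i" m S] assms by simp

lemma pres_eq_relator: "w \<in> R \<Longrightarrow> w \<in> lists {..<n} \<Longrightarrow> pres_eq n R w []"
  using pres_eq.relator[of "[]" n "[]" w R] by simp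

text \<open>
  A presented group acts wherever its generators act by involutions that satisfy the relators. The equivalence
  relation \<open>E\<close> allows the relators to hold only up to congruence, and words act by
  \<open>foldr\<close>, so that the last letter acts first and concatenation becomes composition.
\<close>

lemma pres_eq_act:
  assumes "pres_eq n R u v" "x \<in> D"
    and equiv: "equiv D E"
    and resp: "\<And>i x y. i < n \<Longrightarrow> (x, y) \<in> E \<Longrightarrow> (f i x, f i y) \<in> E"
    and inv: "\<And>i x. i < n \<Longrightarrow> x \<in> D \<Longrightarrow> (f i (f i x), x) \<in> E"
    and rel: "\<And>w x. w \<in> R \<Longrightarrow> w \<in> lists {..<n} \<Longrightarrow> x \<in> D \<Longrightarrow> (foldr f w x, x) \<in> E"
  shows "(foldr f u x, foldr f v x) \<in> E"
proof -
  have E_D: "(x, y) \<in> E \<Longrightarrow> x \<in> D \<and> y \<in> D" for x y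
    using equiv by (auto simp: equiv_def refl_on_def)
  have E_refl: "x \<in> D \<Longrightarrow> (x, x) \<in> E" for x
    using equiv by (auto simp: equiv_def refl_on_def)
  have E_trans: "(x, y) \<in> E \<Longrightarrow> (y, z) \<in> E \<Longrightarrow> (x, z) \<in> E" for x y z
    using equiv by (auto simp: equiv_def dest: transD)
  have resp': "w \<in> lists {..<n} \<Longrightarrow> (x, y) \<in> E \<Longrightarrow> (foldr f w x, foldr f w y) \<in> E" for w x y
    by (induction w) (auto intro: resp)
  have closed: "w \<in> lists {..<n} \<Longrightarrow> x \<in> D \<Longrightarrow> foldr f w x \<in> D" for w x
    using resp'[of w x x] E_D E_refl by blast
  show ?thesis
    using assms(1) \<open>x \<in> D\<close>
  proof (induction arbitrary: x rule: pres_eq.induct)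
    case (refl u)
    then show ?case using closed E_refl by blast
  next
    case (sym u v)
    then show ?case using equiv by (auto simp: equiv_def dest: symD)
  next
    case (trans u v w)
    then show ?case using E_trans by blast
  next
    case (involution u v i)
    then show ?case using resp' inv closed by simp
  next
    case (relator u v w)
    then show ?case using resp' rel closed by simp
  qed
qed

lemma word_class_eq_iff:
  assumes "u \<in> lists {..<n}"
  shows "word_class n R u = word_class n R v \<longleftrightarrow> pres_eq n R u v"
proof
  assume "word_class n R u = word_class n R v"
  moreover have "u \<in> word_class n R u"
    using assms by (simp add: word_class_def pres_eq.refl)
  ultimately show "pres_eq n R u v" by (auto simp: word_class_def intro: pres_eq.sym)
next
  assume "pres_eq n R u v"
  then show "word_class n R u = word_class n R v"
    unfolding word_class_def by (blast intro: pres_eq.sym pres_eq.trans)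
qed

lemma word_class_carrier [simp]:
  "u \<in> lists {..<n} \<Longrightarrow> word_class n R u \<in> carrier (presented_group n R)"
  by (simp add: presented_group_def)

lemma carrier_presented_group: "carrier (presented_group n R) = word_class n R ` lists {..<n}"
  by (simp add: presented_group_def)

lemma one_presented_group: "\<one>\<^bsub>presented_group n R\<^esub> = word_class n R []"
  by (simp add: presented_group_def)

lemma word_class_mult:
  assumes "u \<in> lists {..<n}" "v \<in> lists {..<n}"
  shows "word_class n R u \<otimes>\<^bsub>presented_group n R\<^esub> word_class n R v = word_class n R (u @ v)"
proof -
  have "word_class n R (a @ b) = word_class n R (u @ v)"
    if "a \<in> word_class n R u" "b \<in> word_class n R v" for a b
  proof -
    have "pres_eq n R u a" "pres_eq n R v b"
      using that by (simp_all add: word_class_def)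
    then have "pres_eq n R (u @ v) (a @ b)"
      by (rule pres_eq_append)
    then show ?thesis
      using word_class_eq_iff[of "u @ v" n R "a @ b"] assms by simp
  qed
  then have "(\<Union>a\<in>word_class n R u. \<Union>b\<in>word_class n R v. word_class n R (a @ b)) =
      (\<Union>a\<in>word_class n R u. \<Union>b\<in>word_class n R v. word_class n R (u @ v))"
    by (intro SUP_cong HOL.refl)
  also have "\<dots> = word_class n R (u @ v)"
  proof -
    have "u \<in> word_class n R u" "v \<in> word_class n R v"
      using assms by (simp_all add: word_class_def pres_eq.refl)
    then have "word_class n R u \<noteq> {}" "word_class n R v \<noteq> {}" by blast+
    then show ?thesis by simp
  qed
  finally show ?thesis by (simp add: presented_group_def)
qed

lemma group_presented_group: "group (presented_group n R)"
proof (rule groupI)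
  fix x assume "x \<in> carrier (presented_group n R)"
  then obtain u where u: "u \<in> lists {..<n}" "x = word_class n R u"
    by (auto simp: carrier_presented_group)
  have "rev u \<in> lists {..<n}" using u by simp
  moreover have "word_class n R (rev u @ u) = word_class n R []"
    using u pres_eq_rev_append[of u n R] by (subst word_class_eq_iff) auto
  ultimately show "\<exists>y\<in>carrier (presented_group n R).
      y \<otimes>\<^bsub>presented_group n R\<^esub> x = \<one>\<^bsub>presented_group n R\<^esub>"
    using u by (intro bexI[of _ "word_class n R (rev u)"])
      (simp_all add: word_class_mult one_presented_group)
next
  fix x y z
  assume "x \<in> carrier (presented_group n R)" "y \<in> carrier (presented_group n R)"
    "z \<in> carrier (presented_group n R)"
  then obtain u v w where "u \<in> lists {..<n}" "v \<in> lists {..<n}" "w \<in> lists {..<n}"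
    "x = word_class n R u" "y = word_class n R v" "z = word_class n R w"
    unfolding carrier_presented_group by blast
  then show "x \<otimes>\<^bsub>presented_group n R\<^esub> y \<in> carrier (presented_group n R)"
    and "x \<otimes>\<^bsub>presented_group n R\<^esub> y \<otimes>\<^bsub>presented_group n R\<^esub> z =
      x \<otimes>\<^bsub>presented_group n R\<^esub> (y \<otimes>\<^bsub>presented_group n R\<^esub> z)"
    and "\<one>\<^bsub>presented_group n R\<^esub> \<otimes>\<^bsub>presented_group n R\<^esub> x = x"
    by (simp_all add: word_class_mult one_presented_group)
next
  show "\<one>\<^bsub>presented_group n R\<^esub> \<in> carrier (presented_group n R)"
    by (simp add: one_presented_group)
qed

lemma word_class_pow:
  assumes "u \<in> lists {..<n}"
  shows "word_class n R u [^]\<^bsub>presented_group n R\<^esub> (k::nat) = word_class n R (word_pow u k)"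
proof -
  interpret group "presented_group n R" by (rule group_presented_group)
  show ?thesis
  proof (induction k)
    case (Suc k)
    have "word_class n R u [^]\<^bsub>presented_group n R\<^esub> Suc k = word_class n R (word_pow u k @ u)"
      using Suc assms by (simp add: word_class_mult)
    then show ?case by (simp only: word_pow_Suc_right)
  qed (simp add: one_presented_group)
qed

lemma word_class_inv:
  assumes "u \<in> lists {..<n}"
  shows "inv\<^bsub>presented_group n R\<^esub> word_class n R u = word_class n R (rev u)"
proof -
  interpret group "presented_group n R" by (rule group_presented_group)
  show ?thesis
    using assms pres_eq_rev_append[OF assms, of R]
    by (intro inv_equality) (auto simp: word_class_mult one_presented_group word_class_eq_iff)
qed

lemma generate_word_class:
  assumes "I \<subseteq> {..<n}"
  shows "generate (presented_group n R) ((\<lambda>i. word_class n R [i]) ` I) = word_class n R ` lists I"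
    (is "generate ?G ?S = _")
proof
  interpret group ?G by (rule group_presented_group)
  have I: "w \<in> lists {..<n}" if "w \<in> lists I" for w
    using that assms by (auto simp: in_lists_conv_set)
  show "generate ?G ?S \<subseteq> word_class n R ` lists I"
  proof
    fix x assume "x \<in> generate ?G ?S"
    then show "x \<in> word_class n R ` lists I"
    proof (induction rule: generate.induct)
      case one
      show ?case unfolding one_presented_group by (rule imageI) simp
    next
      case (incl h)
      then obtain i where i: "i \<in> I" "h = word_class n R [i]" by blast
      show ?case unfolding i(2) by (rule imageI) (simp add: i(1))
    next
      case (inv h)
      then obtain i where i: "i \<in> I" "h = word_class n R [i]" by blast
      then have "inv\<^bsub>?G\<^esub> h = word_class n R [i]"
        using word_class_inv[OF I, of "[i]"] by simp
      then show ?case using i(1) by (intro image_eqI[of _ _ "[i]"]) simp_all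
    next
      case (eng x y)
      then obtain u v where uv: "u \<in> lists I" "v \<in> lists I"
          "x = word_class n R u" "y = word_class n R v"
        by blast
      then have "x \<otimes>\<^bsub>?G\<^esub> y = word_class n R (u @ v)"
        using word_class_mult[OF I I] by simp
      then show ?case using uv(1,2) by (intro image_eqI[of _ _ "u @ v"]) simp_all
    qed
  qed
  have "word_class n R w \<in> generate ?G ?S" if "w \<in> lists I" for w
    using that
  proof (induction w)
    case Nil
    then show ?case using generate.one[of ?G ?S] by (simp only: one_presented_group)
  next
    case (Cons i w)
    then have "word_class n R [i] \<in> generate ?G ?S" "word_class n R w \<in> generate ?G ?S"
      by (auto intro: generate.incl)
    then have "word_class n R [i] \<otimes>\<^bsub>?G\<^esub> word_class n R w \<in> generate ?G ?S"
      by (rule generate.eng)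
    then show ?case using word_class_mult[OF I I, of "[i]" w] Cons.hyps by simp
  qed
  then show "word_class n R ` lists I \<subseteq> generate ?G ?S" by blast
qed

section \<open>Homomorphisms from presented groups\<close>

definition eval_word :: "('a, 'c) monoid_scheme \<Rightarrow> (nat \<Rightarrow> 'a) \<Rightarrow> nat list \<Rightarrow> 'a" where
  "eval_word G g w = foldr (\<lambda>i x. g i \<otimes>\<^bsub>G\<^esub> x) w \<one>\<^bsub>G\<^esub>"

lemma eval_word_simps [simp]:
  "eval_word G g [] = \<one>\<^bsub>G\<^esub>"
  "eval_word G g (i # w) = g i \<otimes>\<^bsub>G\<^esub> eval_word G g w"
  by (simp_all add: eval_word_def)

lemma (in group) eval_word_closed:
  "(\<And>i. i \<in> set w \<Longrightarrow> g i \<in> carrier G) \<Longrightarrow> eval_word G g w \<in> carrier G"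
  by (induction w) auto

lemma (in group) eval_word_append:
  assumes "\<And>i. i \<in> set u \<union> set v \<Longrightarrow> g i \<in> carrier G"
  shows "eval_word G g (u @ v) = eval_word G g u \<otimes> eval_word G g v"
  using assms by (induction u) (auto simp: eval_word_closed m_assoc)

lemma (in group) pres_eq_eval_word:
  assumes "pres_eq n R u v"
    and g: "\<And>i. i < n \<Longrightarrow> g i \<in> carrier G" "\<And>i. i < n \<Longrightarrow> g i \<otimes> g i = \<one>"
    and rel: "\<And>w. w \<in> R \<Longrightarrow> w \<in> lists {..<n} \<Longrightarrow> eval_word G g w = \<one>"
  shows "eval_word G g u = eval_word G g v"
proof -
  have foldr: "foldr (\<lambda>i y. g i \<otimes> y) w x = eval_word G g w \<otimes> x"
    if "w \<in> lists {..<n}" "x \<in> carrier G" for w x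
    using that by (induction w) (auto simp: g m_assoc eval_word_closed in_lists_conv_set)
  have "(foldr (\<lambda>i y. g i \<otimes> y) u \<one>, foldr (\<lambda>i y. g i \<otimes> y) v \<one>) \<in> Id_on (carrier G)"
  proof (rule pres_eq_act[OF assms(1), where D = "carrier G"])
    show "equiv (carrier G) (Id_on (carrier G))"
      by (auto intro!: equivI refl_onI symI transI)
  qed (use g in \<open>auto simp: foldr rel m_assoc[symmetric]\<close>)
  then show ?thesis by (auto simp: eval_word_def)
qed

lemma (in group) presented_group_hom:
  assumes g: "\<And>i. i < n \<Longrightarrow> g i \<in> carrier G" "\<And>i. i < n \<Longrightarrow> g i \<otimes> g i = \<one>"
    and rel: "\<And>w. w \<in> R \<Longrightarrow> w \<in> lists {..<n} \<Longrightarrow> eval_word G g w = \<one>"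
  obtains h where "h \<in> hom (presented_group n R) G"
    "\<And>w. w \<in> lists {..<n} \<Longrightarrow> h (word_class n R w) = eval_word G g w"
proof -
  define h where "h A = eval_word G g (SOME w. w \<in> A)" for A
  have h: "h (word_class n R w) = eval_word G g w" if "w \<in> lists {..<n}" for w
  proof -
    have "w \<in> word_class n R w" using that by (simp add: word_class_def pres_eq.refl)
    then have "(SOME v. v \<in> word_class n R w) \<in> word_class n R w" by (rule someI)
    then have "pres_eq n R w (SOME v. v \<in> word_class n R w)" by (simp add: word_class_def)
    from pres_eq_eval_word[OF this g rel] show ?thesis by (simp add: h_def)
  qed
  have closed: "i \<in> set w \<Longrightarrow> w \<in> lists {..<n} \<Longrightarrow> g i \<in> carrier G" for i w
    using g by (auto simp: in_lists_conv_set)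
  have "h \<in> hom (presented_group n R) G"
  proof (rule homI)
    fix x y assume "x \<in> carrier (presented_group n R)" "y \<in> carrier (presented_group n R)"
    then obtain u v where "u \<in> lists {..<n}" "v \<in> lists {..<n}"
        "x = word_class n R u" "y = word_class n R v"
      unfolding carrier_presented_group by blast
    then show "h x \<in> carrier G"
      and "h (x \<otimes>\<^bsub>presented_group n R\<^esub> y) = h x \<otimes> h y"
      using closed by (auto simp: h word_class_mult intro!: eval_word_closed eval_word_append)
  qed
  then show ?thesis using h that by blast
qed

text \<open>
  The isomorphism is the inverse of the map induced by \<open>g\<close> on words: the equivalence makes that map
  well defined in one direction and injective in the other.
\<close>

lemma polytope_iso_presented_subgroup:
  assumes g: "\<And>i. i < m \<Longrightarrow> g i < n"
    and iff: "\<And>u v. u \<in> lists {..<m} \<Longrightarrow> v \<in> lists {..<m} \<Longrightarrow>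
      pres_eq n S (map g u) (map g v) \<longleftrightarrow> pres_eq m R u v"
  defines "gs \<equiv> map (\<lambda>i. word_class n S [g i]) [0..<m]"
  shows "polytope_iso (subgroup_generated (presented_group n S) (set gs), gs)
    (presented_group m R, map (\<lambda>i. word_class m R [i]) [0..<m])"
proof -
  let ?U = "presented_group n S" and ?P = "presented_group m R"
  let ?K = "subgroup_generated ?U (set gs)"
  interpret U: group ?U by (rule group_presented_group)
  interpret P: group ?P by (rule group_presented_group)
  have map_g: "w \<in> lists {..<m} \<Longrightarrow> map g w \<in> lists {..<n}" for w
    using g by (auto simp: in_lists_conv_set)
  have "set gs = (\<lambda>j. word_class n S [j]) ` (g ` {..<m})"
    by (auto simp: gs_def)
  moreover have "set gs \<subseteq> carrier ?U"
    using g by (auto simp: gs_def)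
  moreover have "g ` {..<m} \<subseteq> {..<n}" using g by auto
  ultimately have carrier: "carrier ?K = word_class n S ` map g ` lists {..<m}"
    using generate_word_class[of "g ` {..<m}" n S]
    by (simp add: carrier_subgroup_generated Int_absorb1 lists_image)
  define h where "h A = word_class n S (map g (SOME w. w \<in> A))" for A
  have h: "h (word_class m R w) = word_class n S (map g w)" if "w \<in> lists {..<m}" for w
  proof -
    have "w \<in> word_class m R w" using that by (simp add: word_class_def pres_eq.refl)
    then have "(SOME v. v \<in> word_class m R w) \<in> word_class m R w" by (rule someI)
    then have *: "pres_eq m R w (SOME v. v \<in> word_class m R w)" by (simp add: word_class_def)
    then have "pres_eq n S (map g w) (map g (SOME v. v \<in> word_class m R w))"
      using iff pres_eq_lists(2)[OF *] that by blast
    then have "word_class n S (map g w) = word_class n S (map g (SOME v. v \<in> word_class m R w))"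
      using word_class_eq_iff[OF map_g[OF that]] by blast
    then show ?thesis by (simp add: h_def)
  qed
  have "h \<in> hom ?P ?K"
  proof (rule homI)
    fix x y assume "x \<in> carrier ?P" "y \<in> carrier ?P"
    then obtain u v where "u \<in> lists {..<m}" "v \<in> lists {..<m}"
        "x = word_class m R u" "y = word_class m R v"
      unfolding carrier_presented_group by blast
    then show "h x \<in> carrier ?K" and "h (x \<otimes>\<^bsub>?P\<^esub> y) = h x \<otimes>\<^bsub>?K\<^esub> h y"
      using map_g[of u] map_g[of v]
      by (simp_all add: h word_class_mult carrier mult_subgroup_generated)
  qed
  moreover have "bij_betw h (carrier ?P) (carrier ?K)"
  proof (rule bij_betw_imageI)
    show "inj_on h (carrier ?P)"
    proof (rule inj_onI)
      fix x y assume "x \<in> carrier ?P" "y \<in> carrier ?P" and eq: "h x = h y"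
      then obtain u v where uv: "u \<in> lists {..<m}" "v \<in> lists {..<m}"
          "x = word_class m R u" "y = word_class m R v"
        unfolding carrier_presented_group by blast
      then have "pres_eq n S (map g u) (map g v)"
        using eq h word_class_eq_iff[OF map_g[OF uv(1)]] by simp
      then show "x = y" using uv iff word_class_eq_iff by simp
    qed
    show "h ` carrier ?P = carrier ?K"
      unfolding carrier carrier_presented_group image_image
      by (intro image_cong HOL.refl h)
  qed
  ultimately have h_iso: "h \<in> iso ?P ?K" by (simp add: iso_def)
  then have "inv_into (carrier ?P) h \<in> iso ?K ?P"
    by (rule P.iso_set_sym)
  moreover have "map (inv_into (carrier ?P) h) gs = map (\<lambda>i. word_class m R [i]) [0..<m]"
  proof -
    have "inv_into (carrier ?P) h (word_class n S [g i]) = word_class m R [i]" if "i < m" for i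
    proof -
      have "h (word_class m R [i]) = word_class n S [g i]"
        using h[of "[i]"] that by simp
      then show ?thesis
        using h_iso that inv_into_f_f[of h "carrier ?P" "word_class m R [i]"]
        by (simp add: iso_def bij_betw_def)
    qed
    then show ?thesis by (simp add: gs_def)
  qed
  ultimately show ?thesis unfolding polytope_iso.simps by blast
qed

lemma polytope_iso_rev:
  "polytope_iso (G, gs) (H, hs) \<Longrightarrow> polytope_iso (G, rev gs) (H, rev hs)"
  unfolding polytope_iso.simps by (metis rev_map)

text \<open>
  Relations known in a presented group are transported to the generators of any polytope whose facet or vertex
  figure is isomorphic to it. This is how members of the class are seen to satisfy the defining relations of the
  universal one.
\<close>

lemma polytope_iso_eval_word:
  assumes "group H" "set hs \<subseteq> carrier H"
    and iso: "polytope_iso (subgroup_generated H (set hs), hs)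
      (presented_group m R, map (\<lambda>i. word_class m R [i]) [0..<m])"
    and w: "pres_eq m R w []"
  shows "eval_word H ((!) hs) w = \<one>\<^bsub>H\<^esub>"
proof -
  interpret H: group H by fact
  let ?K = "subgroup_generated H (set hs)" and ?P = "presented_group m R"
  interpret K: group ?K by (rule H.group_subgroup_generated)
  interpret P: group ?P by (rule group_presented_group)
  obtain f where f: "f \<in> iso ?K ?P" "map f hs = map (\<lambda>i. word_class m R [i]) [0..<m]"
    using iso by auto
  have len: "length hs = m" using arg_cong[OF f(2), of length] by simp
  have gen: "hs ! i \<in> carrier ?K" if "i < m" for i
    using that len assms(2) by (auto simp: carrier_subgroup_generated intro!: generate.incl)
  have f_gen: "f (hs ! i) = word_class m R [i]" if "i < m" for i
    using arg_cong[OF f(2), of "\<lambda>xs. xs ! i"] that len by simp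
  have eval: "eval_word H ((!) hs) v \<in> carrier ?K \<and> f (eval_word H ((!) hs) v) = word_class m R v"
    if "v \<in> lists {..<m}" for v
    using that
  proof (induction v)
    case Nil
    then show ?case
      using f(1) K.one_closed hom_one[of f ?K ?P] K.is_group P.is_group
      by (simp add: iso_def one_presented_group)
  next
    case (Cons i v)
    then have IH: "eval_word H ((!) hs) v \<in> carrier ?K" "f (eval_word H ((!) hs) v) = word_class m R v"
        "i < m"
      by auto
    then have "f (hs ! i \<otimes>\<^bsub>?K\<^esub> eval_word H ((!) hs) v) = word_class m R (i # v)"
      using f(1) gen[OF IH(3)] f_gen[OF IH(3)] word_class_mult[of "[i]" m v R] Cons.hyps
        hom_mult[of f ?K ?P "hs ! i" "eval_word H ((!) hs) v"]
      by (simp add: iso_def del: mult_subgroup_generated)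
    moreover have "hs ! i \<otimes>\<^bsub>?K\<^esub> eval_word H ((!) hs) v \<in> carrier ?K"
      using gen IH by (intro K.m_closed)
    ultimately show ?case by simp
  qed
  have "f (eval_word H ((!) hs) w) = f \<one>\<^bsub>?K\<^esub>"
    using eval[OF pres_eq_lists(1)[OF w]] w word_class_eq_iff[OF pres_eq_lists(1)[OF w]]
      hom_one[of f ?K ?P] K.is_group P.is_group f(1)
    by (simp add: one_presented_group iso_def)
  moreover have "inj_on f (carrier ?K)" using f(1) by (simp add: iso_def bij_betw_def)
  ultimately show ?thesis
    using eval[OF pres_eq_lists(1)[OF w]] K.one_closed by (auto dest: inj_onD)
qed

section \<open>The geometric representation of a Coxeter group\<close>

definition reflection :: "(nat \<Rightarrow> nat \<Rightarrow> int) \<Rightarrow> nat \<Rightarrow> nat \<Rightarrow> (nat \<Rightarrow> int) \<Rightarrow> nat \<Rightarrow> int" where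
  "reflection A N i x = x(i := x i - (\<Sum>j<N. A i j * x j))"

definition simple_root :: "nat \<Rightarrow> nat \<Rightarrow> int" where
  "simple_root i = (\<lambda>j. of_bool (j = i))"

text \<open>
  Involutions acting by reflections on a root lattice of rank \<open>N\<close> with generalized Cartan matrix
  \<open>A\<close>. The relators may be any set that acts trivially and implies the braid relations of lengths 2,
  3 and 4, the braid length being determined by the product of the two off-diagonal Cartan entries. The first
  \<open>n\<close> reflections are used, inside a lattice whose rank may be larger.
\<close>

locale cartan_presentation =
  fixes A :: "nat \<Rightarrow> nat \<Rightarrow> int" and N n :: nat and R :: "nat list set"
  assumes n_le_N: "n \<le> N"
    and A_diag: "i < N \<Longrightarrow> A i i = 2"
    and A_offdiag: "i \<noteq> j \<Longrightarrow> A i j \<le> 0"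
    and dihedral: "i < n \<Longrightarrow> j < n \<Longrightarrow> i \<noteq> j \<Longrightarrow>
      A i j = 0 \<and> A j i = 0 \<and> pres_eq n R [i, j] [j, i] \<or>
      A i j * A j i = 1 \<and> pres_eq n R [i, j, i] [j, i, j] \<or>
      A i j * A j i = 2 \<and> pres_eq n R [i, j, i, j] [j, i, j, i]"
    and relator_acts: "w \<in> R \<Longrightarrow> w \<in> lists {..<n} \<Longrightarrow> foldr (reflection A N) w x = x"
begin

abbreviation act :: "nat list \<Rightarrow> (nat \<Rightarrow> int) \<Rightarrow> nat \<Rightarrow> int" where
  "act \<equiv> foldr (reflection A N)"

lemma reflection_linear:
  "reflection A N i (\<lambda>k. a * x k + b * y k) =
    (\<lambda>k. a * reflection A N i x k + b * reflection A N i y k)"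
proof -
  have "(\<Sum>j<N. A i j * (a * x j + b * y j)) = a * (\<Sum>j<N. A i j * x j) + b * (\<Sum>j<N. A i j * y j)"
    by (simp add: sum_distrib_left sum.distrib[symmetric] algebra_simps)
  then show ?thesis by (auto simp: reflection_def algebra_simps)
qed

lemma act_linear: "act w (\<lambda>k. a * x k + b * y k) = (\<lambda>k. a * act w x k + b * act w y k)"
  by (induction w) (simp_all add: reflection_linear)

lemma act_sum:
  assumes "finite J"
  shows "act w (\<lambda>k. \<Sum>j\<in>J. c j * f j k) = (\<lambda>k. \<Sum>j\<in>J. c j * act w (f j) k)"
  using assms
proof (induction J)
  case empty
  show ?case using act_linear[of w 0 "\<lambda>_. 0" 0 "\<lambda>_. 0"] by simp
next
  case (insert j J)
  then show ?case using act_linear[of w "c j" "f j" 1 "\<lambda>k. \<Sum>j\<in>J. c j * f j k"] by simp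
qed

lemma reflection_involution:
  assumes "i < N"
  shows "reflection A N i (reflection A N i x) = x"
proof -
  let ?c = "\<lambda>x. \<Sum>j<N. A i j * x j"
  have "?c (x(i := x i - ?c x)) = ?c x - A i i * ?c x"
  proof -
    have "?c (x(i := x i - ?c x)) = (\<Sum>j<N. A i j * x j - (if j = i then A i i * ?c x else 0))"
      by (intro sum.cong) (auto simp: algebra_simps)
    then show ?thesis using assms by (simp add: sum_subtractf)
  qed
  then show ?thesis using A_diag[OF assms] by (auto simp: reflection_def)
qed

lemma act_pres_eq:
  assumes "pres_eq n R u v"
  shows "act u x = act v x"
proof -
  have "(act u x, act v x) \<in> Id"
    by (rule pres_eq_act[OF assms, where D = UNIV])
      (use n_le_N in \<open>auto intro: equivI refl_onI symI transI simp: reflection_involution relator_acts\<close>)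
  then show ?thesis by simp
qed

lemma act_rev_cancel: "w \<in> lists {..<n} \<Longrightarrow> act w (act (rev w) x) = x"
  using act_pres_eq[OF pres_eq_append_rev[of w n R], of x] by simp

lemma reflection_plane:
  assumes "i < N" "j < N" "i \<noteq> j"
  shows "reflection A N i (\<lambda>k. c * simple_root i k + d * simple_root j k) =
    (\<lambda>k. (- c - A i j * d) * simple_root i k + d * simple_root j k)"
proof -
  have "(\<Sum>l<N. A i l * (c * simple_root i l + d * simple_root j l)) =
      (\<Sum>l<N. (if l = i then A i i * c else 0) + (if l = j then A i j * d else 0))"
    by (intro sum.cong) (use assms in \<open>auto simp: simple_root_def\<close>)
  also have "\<dots> = 2 * c + A i j * d"
    using assms by (simp add: sum.distrib A_diag)
  finally show ?thesis
    using assms by (auto simp: reflection_def simple_root_def)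
qed

lemma act_simple_root_last: "i < n \<Longrightarrow> act (w @ [i]) (simple_root i) = (\<lambda>k. - act w (simple_root i) k)"
proof -
  assume "i < n"
  then have i: "i < N" using n_le_N by simp
  have "(\<Sum>j<N. A i j * simple_root i j) = (\<Sum>j<N. if j = i then 2 else 0)"
    using i by (intro sum.cong) (auto simp: simple_root_def A_diag)
  then have "reflection A N i (simple_root i) = (\<lambda>k. (- 1) * simple_root i k + 0 * simple_root i k)"
    using i by (auto simp: reflection_def simple_root_def)
  then show ?thesis using act_linear[of w "- 1" "simple_root i" 0 "simple_root i"] by simp
qed

text \<open>
  Reducedness and descents are relative to words over a set \<open>I\<close> of letters. For a Coxeter group this
  agrees with the absolute notions, but the relative version makes the results below apply to all parabolic
  subgroups at once without proving that.
\<close>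

definition reduced_in :: "nat set \<Rightarrow> nat list \<Rightarrow> bool" where
  "reduced_in I w \<longleftrightarrow> w \<in> lists I \<and> (\<forall>v\<in>lists I. pres_eq n R w v \<longrightarrow> length w \<le> length v)"

definition no_descent :: "nat set \<Rightarrow> nat list \<Rightarrow> nat \<Rightarrow> bool" where
  "no_descent I w s \<longleftrightarrow> (\<forall>v\<in>lists I. pres_eq n R w (v @ [s]) \<longrightarrow> length w \<le> length v)"

lemma lists_subset_n: "I \<subseteq> {..<n} \<Longrightarrow> w \<in> lists I \<Longrightarrow> w \<in> lists {..<n}"
  by (auto simp: in_lists_conv_set)

text \<open>
  Positivity of roots, the source of everything that is used about Coxeter groups. The word \<open>w\<close> ends
  in some letter \<open>t \<noteq> s\<close>. Split off from \<open>w\<close> the longest possible suffix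
  \<open>x\<close> in the letters \<open>s\<close> and \<open>t\<close>, so that \<open>w = vx\<close>. Maximality
  of \<open>x\<close> leaves \<open>v\<close> without descents at \<open>s\<close> and \<open>t\<close>, and by
  induction \<open>v\<close> maps both simple roots to nonnegative vectors. The suffix \<open>x\<close> is
  alternating, ends in \<open>t\<close>, and is shorter than the braid relation of \<open>s\<close> and
  \<open>t\<close>, for otherwise \<open>w\<close> would have a descent at \<open>s\<close>. In rank two these few
  words map \<open>\<alpha>\<^sub>s\<close> to a nonnegative combination of \<open>\<alpha>\<^sub>s\<close> and
  \<open>\<alpha>\<^sub>t\<close>.
\<close>

lemma act_reduced_root_nonneg:
  assumes I: "I \<subseteq> {..<n}" and "reduced_in I w" "s \<in> I" "no_descent I w s"
  shows "act w (simple_root s) k \<ge> 0"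
  using assms(2-)
proof (induction "length w" arbitrary: w s k rule: less_induct)
  case less
  note lists_n = lists_subset_n[OF I]
  have w: "w \<in> lists I" and w_min: "\<And>v. v \<in> lists I \<Longrightarrow> pres_eq n R w v \<Longrightarrow> length w \<le> length v"
    and w_desc: "\<And>v. v \<in> lists I \<Longrightarrow> pres_eq n R w (v @ [s]) \<Longrightarrow> length w \<le> length v"
    using less.prems by (auto simp: reduced_in_def no_descent_def)
  show ?case
  proof (cases w rule: rev_cases)
    case Nil
    then show ?thesis by (simp add: simple_root_def)
  next
    case (snoc w1 t)
    have t: "t \<in> I" and w1: "w1 \<in> lists I" using w snoc by auto
    have "s \<noteq> t"
      using w_desc[OF w1] snoc lists_n[OF w] pres_eq.refl[of w n R] by auto
    define splits where "splits = {(v, x). v \<in> lists I \<and> x \<in> lists {s, t} \<and>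
      length v + length x = length w \<and> pres_eq n R w (v @ x)}"
    have w1_split: "(w1, [t]) \<in> splits"
      using w1 snoc pres_eq.refl[OF lists_n[OF w]] by (simp add: splits_def)
    then obtain p where p: "p \<in> splits" "\<And>q. q \<in> splits \<Longrightarrow> length (fst p) \<le> length (fst q)"
      by (rule ex_has_least_nat[of "\<lambda>q. q \<in> splits" _ "\<lambda>q. length (fst q)", THEN exE]) blast
    obtain v x where vx: "p = (v, x)" by fastforce
    have v: "v \<in> lists I" and x: "x \<in> lists {s, t}" and len: "length v + length x = length w"
      and eq: "pres_eq n R w (v @ x)"
      using p(1) by (auto simp: splits_def vx)
    have v_min: "length v \<le> length v'" if "(v', x') \<in> splits" for v' x'
      using p(2)[OF that] by (simp add: vx)
    have xI: "x \<in> lists I" using x t \<open>s \<in> I\<close> by (auto simp: in_lists_conv_set)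
    have short: "length v < length w"
      using v_min[OF w1_split] snoc by simp
    have "reduced_in I v"
      unfolding reduced_in_def
    proof (intro conjI ballI impI v)
      fix v' assume "v' \<in> lists I" "pres_eq n R v v'"
      then have "pres_eq n R w (v' @ x)"
        using eq pres_eq_append[of n R v v' x x] pres_eq.refl[OF lists_n[OF xI], of R] pres_eq.trans by blast
      then show "length v \<le> length v'"
        using w_min[of "v' @ x"] \<open>v' \<in> lists I\<close> xI len by simp
    qed
    moreover have "no_descent I v r" if r: "r \<in> {s, t}" for r
      unfolding no_descent_def
    proof (intro ballI impI)
      fix v' assume v': "v' \<in> lists I" and "pres_eq n R v (v' @ [r])"
      then have *: "pres_eq n R w (v' @ (r # x))"
        using eq pres_eq_append[of n R v "v' @ [r]" x x] pres_eq.refl[OF lists_n[OF xI], of R] pres_eq.trans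
        by fastforce
      have "r \<in> I" using r t \<open>s \<in> I\<close> by auto
      then have "length w \<le> length (v' @ (r # x))"
        using w_min[OF _ *] v' xI by simp
      show "length v \<le> length v'"
      proof (rule ccontr)
        assume "\<not> length v \<le> length v'"
        then have "(v', r # x) \<in> splits"
          using v' x r * len \<open>length w \<le> _\<close> by (auto simp: splits_def)
        then show False using v_min \<open>\<not> length v \<le> length v'\<close> by blast
      qed
    qed
    ultimately have IH: "act v (simple_root s) k \<ge> 0" "act v (simple_root t) k \<ge> 0" for k
      using less.hyps[OF short] \<open>s \<in> I\<close> t by auto
    \<comment> \<open>The suffix has no repeated letters, and no end segment of it can be rewritten to end in \<open>s\<close>.\<close>
    have no_square: False if "x = y @ [r, r] @ z" for y r z
    proof -
      have "pres_eq n R (v @ x) ((v @ y) @ z)"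
        using pres_eq.involution[of "v @ y" n z r R] lists_n[OF v] lists_n[OF xI] that by simp
      then have "length w \<le> length ((v @ y) @ z)"
        using eq v xI that pres_eq.trans by (intro w_min) (auto simp: in_lists_conv_set)
      then show False using len that by simp
    qed
    have no_end: False if "pres_eq n R y (z @ [s])" "x = x' @ y" "length y = Suc (length z)" "z \<in> lists {s, t}"
      for x' y z
    proof -
      have "pres_eq n R (v @ x) ((v @ x') @ z @ [s])"
        using pres_eq_append[OF pres_eq.refl[of "v @ x'" n R] that(1)] that(2) lists_n[OF v] lists_n[OF xI]
        by simp
      then have "pres_eq n R w ((v @ x' @ z) @ [s])"
        using eq pres_eq.trans by fastforce
      moreover have "v @ x' @ z \<in> lists I"
        using v xI that(2,4) t \<open>s \<in> I\<close> by (auto simp: in_lists_conv_set)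
      ultimately show False using w_desc[of "v @ x' @ z"] len that(2,3) by simp
    qed
    have st: "s < n" "t < n" "s < N" "t < N" using t \<open>s \<in> I\<close> I n_le_N by auto
    obtain c d where cd: "c \<ge> 0" "d \<ge> 0"
      "act x (simple_root s) = (\<lambda>k. c * simple_root s k + d * simple_root t k)"
    proof -
      have "x \<noteq> []" using short len by auto
      then obtain x1 where x1: "x = x1 @ [t]"
        using x no_end[of "[s]" "[]"] pres_eq.refl[of "[s]" n R] st
        by (cases x rule: rev_cases) auto
      have act_t: "act [t] (simple_root s) = (\<lambda>k. 1 * simple_root s k + (- A t s) * simple_root t k)"
        using reflection_plane[of t s 0 1] st \<open>s \<noteq> t\<close> by (simp add: add.commute)
      have act_st: "act [s, t] (simple_root s) =
          (\<lambda>k. (A s t * A t s - 1) * simple_root s k + (- A t s) * simple_root t k)"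
        using reflection_plane[of s t 1 "- A t s"] act_t st \<open>s \<noteq> t\<close> by simp
      have act_tst: "act [t, s, t] (simple_root s) =
          (\<lambda>k. (A s t * A t s - 1) * simple_root s k + (A t s - A t s * (A s t * A t s - 1)) * simple_root t k)"
        using reflection_plane[of t s "- A t s" "A s t * A t s - 1"] act_st st \<open>s \<noteq> t\<close>
        by (simp add: add.commute)
      have A_ts: "A t s \<le> 0" using A_offdiag \<open>s \<noteq> t\<close> by auto
      consider (1) "x1 = []" | (2) x2 where "x1 = x2 @ [s]"
        using x1 x no_square[of _ t "[]"] by (cases x1 rule: rev_cases) auto
      then show ?thesis
      proof cases
        case 1
        then show ?thesis using that[of 1 "- A t s"] act_t A_ts x1 by simp
      next
        case 2
        from dihedral[OF st(1,2) \<open>s \<noteq> t\<close>] consider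
          (m2) "pres_eq n R [s, t] [t, s]"
          | (m3) "A s t * A t s = 1" "pres_eq n R [s, t, s] [t, s, t]"
          | (m4) "A s t * A t s = 2" "pres_eq n R [s, t, s, t] [t, s, t, s]"
          by blast
        then show ?thesis
        proof cases
          case m2
          then show ?thesis using no_end[of "[s, t]" "[t]" x2] x1 2 by auto
        next
          case m3
          consider (a) "x2 = []" | (b) x3 where "x2 = x3 @ [t]"
            using x1 2 x no_square[of _ s "[t]"] by (cases x2 rule: rev_cases) auto
          then show ?thesis
          proof cases
            case a
            then show ?thesis using that[of 0 "- A t s"] act_st A_ts m3 x1 2 by simp
          next
            case b
            then show ?thesis using no_end[of "[t, s, t]" "[s, t]" x3] m3(2) x1 2 pres_eq.sym by auto
          qed
        next
          case m4
          consider (a) "x2 = []" | (b) x3 where "x2 = x3 @ [t]"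
            using x1 2 x no_square[of _ s "[t]"] by (cases x2 rule: rev_cases) auto
          then show ?thesis
          proof cases
            case a
            then show ?thesis using that[of 1 "- A t s"] act_st A_ts m4 x1 2 by simp
          next
            case b
            consider (c) "x3 = []" | (d) x4 where "x3 = x4 @ [s]"
              using x1 2 b x no_square[of _ t "[s, t]"] by (cases x3 rule: rev_cases) auto
            then show ?thesis
            proof cases
              case c
              then show ?thesis using that[of 1 0] act_tst m4 x1 2 b by simp
            next
              case d
              then show ?thesis using no_end[of "[s, t, s, t]" "[t, s, t]" x4] m4(2) x1 2 b by auto
            qed
          qed
        qed
      qed
    qed
    have "act w (simple_root s) k = act v (act x (simple_root s)) k"
      using act_pres_eq[OF eq] by simp
    also have "\<dots> = c * act v (simple_root s) k + d * act v (simple_root t) k"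
      by (simp add: cd(3) act_linear)
    finally show ?thesis using cd(1,2) IH by simp
  qed
qed

lemma act_reduced_last_nonpos:
  assumes I: "I \<subseteq> {..<n}" and "reduced_in I (w @ [s])"
  shows "act (w @ [s]) (simple_root s) k \<le> 0"
proof -
  have ws: "w \<in> lists I" "s \<in> I" and
    min: "\<And>v. v \<in> lists I \<Longrightarrow> pres_eq n R (w @ [s]) v \<Longrightarrow> length (w @ [s]) \<le> length v"
    using assms(2) by (auto simp: reduced_in_def)
  have s: "s < n" using ws I by auto
  have "reduced_in I w"
    unfolding reduced_in_def
  proof (intro conjI ballI impI ws)
    fix v assume v: "v \<in> lists I" "pres_eq n R w v"
    then have "pres_eq n R (w @ [s]) (v @ [s])"
      using s by (intro pres_eq_append pres_eq.refl) auto
    then show "length w \<le> length v" using min[of "v @ [s]"] v(1) ws(2) by simp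
  qed
  moreover have "no_descent I w s"
    unfolding no_descent_def
  proof (intro ballI impI)
    fix v assume v: "v \<in> lists I" "pres_eq n R w (v @ [s])"
    then have "pres_eq n R (w @ [s]) ((v @ [s]) @ [s])"
      using s by (intro pres_eq_append pres_eq.refl) auto
    moreover have "pres_eq n R (v @ [s, s] @ []) (v @ [])"
      using lists_subset_n[OF I v(1)] s by (intro pres_eq.involution) auto
    ultimately have "pres_eq n R (w @ [s]) v"
      using pres_eq.trans by simp
    then show "length w \<le> length v" using min[OF v(1)] by simp
  qed
  ultimately have "act w (simple_root s) k \<ge> 0"
    using act_reduced_root_nonneg[OF I] ws(2) by blast
  then show ?thesis using act_simple_root_last[OF s] by simp
qed

text \<open>
  A nontrivial reduced word maps the simple root of its last letter to a negative root, so it cannot fix all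
  simple roots.
\<close>

theorem act_faithful:
  assumes I: "I \<subseteq> {..<n}" and u: "u \<in> lists I"
    and fixed: "\<And>s. s \<in> I \<Longrightarrow> act u (simple_root s) = simple_root s"
  shows "pres_eq n R u []"
proof -
  have "u \<in> lists I \<and> pres_eq n R u u"
    using u pres_eq.refl[OF lists_subset_n[OF I u]] by blast
  then obtain w where w: "w \<in> lists I" "pres_eq n R u w"
    and min: "\<And>v. v \<in> lists I \<Longrightarrow> pres_eq n R u v \<Longrightarrow> length w \<le> length v"
    using ex_has_least_nat[of "\<lambda>w. w \<in> lists I \<and> pres_eq n R u w" u length] by blast
  have red: "reduced_in I w"
    using w min pres_eq.trans by (auto simp: reduced_in_def)
  show ?thesis
  proof (cases w rule: rev_cases)
    case Nil
    then show ?thesis using w(2) by simp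
  next
    case (snoc w1 s)
    then have "s \<in> I" using w(1) by auto
    then have "act w (simple_root s) s = 1"
      using fixed act_pres_eq[OF w(2)] by (metis simple_root_def of_bool_eq(2))
    then show ?thesis using act_reduced_last_nonpos[OF I, of w1 s s] red snoc by simp
  qed
qed

lemma act_support:
  assumes "w \<in> lists I" "\<And>k. k \<notin> I \<Longrightarrow> x k = 0" "k \<notin> I"
  shows "act w x k = 0"
  using assms by (induction w) (auto simp: reflection_def)

lemma act_coordinate:
  assumes "w \<in> lists I" "i \<notin> I"
  shows "act w x i = x i"
  using assms by (induction w) (auto simp: reflection_def)

lemma expand_simple_roots:
  assumes "finite I" "\<And>k. k \<notin> I \<Longrightarrow> x k = 0"
  shows "x = (\<lambda>k. \<Sum>j\<in>I. x j * simple_root j k)"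
proof
  fix k
  have "(\<Sum>j\<in>I. x j * simple_root j k) = (\<Sum>j\<in>I. if j = k then x k else 0)"
    by (intro sum.cong) (auto simp: simple_root_def)
  also have "\<dots> = x k" using assms by (cases "k \<in> I") auto
  finally show "x k = (\<Sum>j\<in>I. x j * simple_root j k)" by simp
qed

text \<open>
  The \<open>i\<close>-th coordinate is the functional fixed by all generators except the \<open>i\<close>-th. In
  the coset of \<open>u\<close> modulo those generators take a shortest representative \<open>w\<close>. If
  \<open>w\<close> is not empty, it ends in the letter \<open>i\<close> and maps \<open>\<alpha>\<^sub>i\<close>
  to a negative root; but as \<open>u\<close> preserves the \<open>i\<close>-th coordinate, so does
  \<open>w\<close> on \<open>\<alpha>\<^sub>i\<close>, and that coordinate is 1.
\<close>

theorem act_stabilizer: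
  assumes I: "I \<subseteq> {..<n}" and u: "u \<in> lists I" and "i \<in> I"
    and fixed: "\<And>s. s \<in> I \<Longrightarrow> act u (simple_root s) i = simple_root s i"
  shows "\<exists>v\<in>lists (I - {i}). pres_eq n R u v"
proof -
  have "finite I" using I finite_subset by blast
  have fixed': "act u x i = x i" if "\<And>k. k \<notin> I \<Longrightarrow> x k = 0" for x
  proof -
    have x: "x = (\<lambda>k. \<Sum>j\<in>I. x j * simple_root j k)"
      using that by (rule expand_simple_roots[OF \<open>finite I\<close>])
    have "act u x i = act u (\<lambda>k. \<Sum>j\<in>I. x j * simple_root j k) i"
      by (subst x) (rule HOL.refl)
    also have "\<dots> = (\<Sum>j\<in>I. x j * simple_root j i)"
      unfolding act_sum[OF \<open>finite I\<close>] using fixed by (intro sum.cong) auto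
    also have "\<dots> = x i"
      by (rule fun_cong[OF x, symmetric])
    finally show ?thesis .
  qed
  define Q where "Q w \<longleftrightarrow> w \<in> lists I \<and> (\<exists>h\<in>lists (I - {i}). pres_eq n R u (w @ h))" for w
  have "Q u"
    using u pres_eq.refl[OF lists_subset_n[OF I u], of R] unfolding Q_def by (auto intro!: bexI[of _ "[]"])
  then obtain w where "Q w" and min: "\<And>v. Q v \<Longrightarrow> length w \<le> length v"
    using ex_has_least_nat[of Q u length] by blast
  then obtain h where w: "w \<in> lists I" and h: "h \<in> lists (I - {i})" and eq: "pres_eq n R u (w @ h)"
    by (auto simp: Q_def)
  have h_n: "h \<in> lists {..<n}" and hI: "h \<in> lists I"
    using h I by (auto simp: in_lists_conv_set)
  show ?thesis
  proof (cases w rule: rev_cases)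
    case Nil
    then show ?thesis using eq h by auto
  next
    case (snoc w1 s)
    have w1: "w1 \<in> lists I" "s \<in> I" using w snoc by auto
    have "s = i"
    proof (rule ccontr)
      assume "s \<noteq> i"
      then have "Q w1" using w1 h eq snoc unfolding Q_def by (auto intro!: bexI[of _ "s # h"])
      then show False using min[of w1] snoc by simp
    qed
    have "reduced_in I w"
      unfolding reduced_in_def
    proof (intro conjI ballI impI w)
      fix v assume "v \<in> lists I" "pres_eq n R w v"
      then have "pres_eq n R u (v @ h)"
        using eq pres_eq_append[OF _ pres_eq.refl[OF h_n, of R]] pres_eq.trans by blast
      then have "Q v" using \<open>v \<in> lists I\<close> h by (auto simp: Q_def)
      then show "length w \<le> length v" by (rule min)
    qed
    then have le: "act w (simple_root i) i \<le> 0"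
      using act_reduced_last_nonpos[OF I, of w1 i i] snoc \<open>s = i\<close> by simp
    have "act w (simple_root i) = act w (act h (act (rev h) (simple_root i)))"
      using act_rev_cancel[OF h_n] by simp
    also have "\<dots> = act u (act (rev h) (simple_root i))"
      using act_pres_eq[OF eq] by simp
    finally have "act w (simple_root i) i = act (rev h) (simple_root i) i"
      using fixed'[of "act (rev h) (simple_root i)"] act_support[of "rev h" I "simple_root i"] hI \<open>i \<in> I\<close>
      by (auto simp: simple_root_def)
    also have "\<dots> = 1"
      using act_coordinate[of "rev h" "I - {i}" i "simple_root i"] h by (simp add: simple_root_def)
    finally show ?thesis using le by simp
  qed
qed

end

section \<open>The reflections of the diagram [3,3,4,3,3]\<close>

text \<open>
  The roots of \<open>a\<close>, \<open>b\<close>, \<open>c\<close> are long, those of \<open>d\<close>,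
  \<open>e\<close>, \<open>f\<close> short. The first five nodes then form the untwisted affine diagram of
  \<open>F\<^sub>4\<close>, whose finite Cartan matrix has determinant 1, so that every functional on the finite
  root lattice comes from a translation.
\<close>

definition f4_cartan :: "nat \<Rightarrow> nat \<Rightarrow> int" where
  "f4_cartan i j = (if i = j then 2 else if i = 3 \<and> j = 2 then - 2
    else if i = Suc j \<or> j = Suc i then - 1 else 0)"

abbreviation reflect :: "nat \<Rightarrow> (nat \<Rightarrow> int) \<Rightarrow> nat \<Rightarrow> int" where
  "reflect \<equiv> reflection f4_cartan 6"

lemma sum_lessThan_5: "(\<Sum>j<5. f j) = f 0 + f 1 + f 2 + f 3 + f (4::nat)" for f :: "nat \<Rightarrow> int"
  by (simp add: eval_nat_numeral)

text \<open>
  The second equation is stated for \<open>Suc 0\<close>, the form to which the simplifier normalizes the letter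
  1.
\<close>

lemma reflect_simps:
  "reflect 0 x = x(0 := x 1 - x 0)"
  "reflect (Suc 0) x = x(1 := x 0 + x 2 - x 1)"
  "reflect 2 x = x(2 := x 1 + x 3 - x 2)"
  "reflect 3 x = x(3 := 2 * x 2 + x 4 - x 3)"
  "reflect 4 x = x(4 := x 3 + x 5 - x 4)"
  "reflect 5 x = x(5 := x 4 - x 5)"
  by (rule ext, simp add: reflection_def f4_cartan_def eval_nat_numeral)+

lemma less_5_cases: "i < 5 \<Longrightarrow> i = 0 \<or> i = 1 \<or> i = 2 \<or> i = 3 \<or> i = (4::nat)"
  by arith

lemma less_6_cases: "i < 6 \<Longrightarrow> i = 0 \<or> i = 1 \<or> i = 2 \<or> i = 3 \<or> i = 4 \<or> i = (5::nat)"
  by arith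

lemma pres_eq_commute: "i < n \<Longrightarrow> j < n \<Longrightarrow> pres_eq n R (word_pow [i, j] 2) [] \<Longrightarrow> pres_eq n R [i, j] [j, i]"
  by (subst pres_eq_cancel_iff[symmetric]) (auto simp: numeral_eq_Suc)

lemma pres_eq_braid3: "i < n \<Longrightarrow> j < n \<Longrightarrow> pres_eq n R (word_pow [i, j] 3) [] \<Longrightarrow> pres_eq n R [i, j, i] [j, i, j]"
  by (subst pres_eq_cancel_iff[symmetric]) (auto simp: numeral_eq_Suc)

lemma pres_eq_braid4: "i < n \<Longrightarrow> j < n \<Longrightarrow> pres_eq n R (word_pow [i, j] 4) [] \<Longrightarrow> pres_eq n R [i, j, i, j] [j, i, j, i]"
  by (subst pres_eq_cancel_iff[symmetric]) (auto simp: numeral_eq_Suc)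

lemma coxeter_relator_adjacent:
  assumes "i < length ps" "length ps < n" "coxeter_relators ps \<subseteq> R"
  shows "pres_eq n R (word_pow [i, Suc i] (ps ! i)) []"
proof (rule pres_eq_relator)
  show "word_pow [i, Suc i] (ps ! i) \<in> R" using assms by (auto simp: coxeter_relators_def)
qed (use assms in simp)

lemma coxeter_relator_far:
  assumes "i + 2 \<le> j" "j \<le> length ps" "length ps < n" "coxeter_relators ps \<subseteq> R"
  shows "pres_eq n R (word_pow [i, j] 2) []"
proof (rule pres_eq_relator)
  have "word_pow [i, j] 2 \<in> coxeter_relators ps"
    using assms(1,2) unfolding coxeter_relators_def by blast
  then show "word_pow [i, j] 2 \<in> R" using assms(4) by blast
qed (use assms in simp)

lemma coxeter_relators_cases:
  assumes "w \<in> coxeter_relators ps"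
  obtains i where "i < length ps" "w = word_pow [i, Suc i] (ps ! i)"
  | i j where "i + 2 \<le> j" "j \<le> length ps" "w = word_pow [i, j] 2"
  using assms by (auto simp: coxeter_relators_def)

lemma word_pow_numeral [simp]: "word_pow w (numeral k) = w @ word_pow w (pred_numeral k)"
  by (simp add: numeral_eq_Suc)

lemma adjacent_relator_acts:
  "i < 5 \<Longrightarrow> foldr reflect (word_pow [i, Suc i] ([3, 3, 4, 3, 3] ! i)) x = x"
  by (drule less_5_cases, elim disjE; hypsubst;
    simp add: reflect_simps algebra_simps numeral_2_eq_2[symmetric])

lemma far_relator_acts:
  "i < 6 \<Longrightarrow> i + 2 \<le> j \<Longrightarrow> j < 6 \<Longrightarrow> foldr reflect (word_pow [i, j] 2) x = x"
  by (drule less_6_cases, drule less_6_cases, elim disjE; hypsubst;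
    simp add: reflect_simps algebra_simps numeral_2_eq_2[symmetric])

lemma coxeter_relator_acts:
  assumes "w \<in> coxeter_relators [3, 3, 4, 3, 3]"
  shows "foldr reflect w x = x"
  using assms
proof (cases rule: coxeter_relators_cases)
  case (1 i)
  from adjacent_relator_acts[of i x] 1(1) show ?thesis unfolding 1(2) by simp
next
  case (2 i j)
  from far_relator_acts[of i j x] 2(1,2) show ?thesis unfolding 2(3) by simp
qed

lemma coxeter_relators_butlast: "coxeter_relators ps \<subseteq> coxeter_relators (ps @ [p])"
proof
  fix w assume "w \<in> coxeter_relators ps"
  then show "w \<in> coxeter_relators (ps @ [p])"
  proof (cases rule: coxeter_relators_cases)
    case (1 i)
    then have "i < length (ps @ [p])" "w = word_pow [i, Suc i] ((ps @ [p]) ! i)"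
      by (simp_all add: nth_append)
    then show ?thesis unfolding coxeter_relators_def by blast
  next
    case (2 i j)
    then have "j \<le> length (ps @ [p])" by simp
    with 2 show ?thesis unfolding coxeter_relators_def by blast
  qed
qed

text \<open>
  The lattice has rank six, so that the same action later serves the rank six group as well.
\<close>

interpretation affine: cartan_presentation f4_cartan 6 5 "coxeter_relators [3, 3, 4, 3]"
proof
  let ?R = "coxeter_relators [3, 3, 4, 3]"
  have dihedral_less: "f4_cartan i j = 0 \<and> f4_cartan j i = 0 \<and> pres_eq 5 ?R [i, j] [j, i] \<or>
      f4_cartan i j * f4_cartan j i = 1 \<and> pres_eq 5 ?R [i, j, i] [j, i, j] \<or>
      f4_cartan i j * f4_cartan j i = 2 \<and> pres_eq 5 ?R [i, j, i, j] [j, i, j, i]"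
    if "i < j" "j < 5" for i j
  proof (cases "j = Suc i")
    case True
    have "pres_eq 5 ?R (word_pow [i, j] ([3, 3, 4, 3] ! i)) []"
      using coxeter_relator_adjacent[of i "[3, 3, 4, 3]" 5 ?R] that True by simp
    then have rel: "pres_eq 5 ?R (word_pow [i, j] (if i = 2 then 4 else 3)) []"
      using that True by (auto simp: less_Suc_eq numeral_eq_Suc simp del: word_pow_simps)
    show ?thesis
    proof (cases "i = 2")
      case i: True
      then have "pres_eq 5 ?R [i, j, i, j] [j, i, j, i]"
        using rel that by (intro pres_eq_braid4) auto
      moreover have "f4_cartan i j * f4_cartan j i = 2" using i True by (simp add: f4_cartan_def)
      ultimately show ?thesis by blast
    next
      case i: False
      then have "pres_eq 5 ?R [i, j, i] [j, i, j]"
        using rel that by (intro pres_eq_braid3) auto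
      moreover have "f4_cartan i j * f4_cartan j i = 1" using i True by (simp add: f4_cartan_def)
      ultimately show ?thesis by blast
    qed
  next
    case False
    then have "pres_eq 5 ?R (word_pow [i, j] 2) []"
      using that by (intro coxeter_relator_far[of i j "[3, 3, 4, 3]"]) auto
    then have "pres_eq 5 ?R [i, j] [j, i]" using that by (intro pres_eq_commute) auto
    moreover have "f4_cartan i j = 0" "f4_cartan j i = 0"
      using False that by (simp_all add: f4_cartan_def)
    ultimately show ?thesis by blast
  qed
  show "f4_cartan i j = 0 \<and> f4_cartan j i = 0 \<and> pres_eq 5 ?R [i, j] [j, i] \<or>
      f4_cartan i j * f4_cartan j i = 1 \<and> pres_eq 5 ?R [i, j, i] [j, i, j] \<or>
      f4_cartan i j * f4_cartan j i = 2 \<and> pres_eq 5 ?R [i, j, i, j] [j, i, j, i]"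
    if "i < 5" "j < 5" "i \<noteq> j" for i j
  proof (cases "i < j")
    case True
    then show ?thesis using dihedral_less that by blast
  next
    case False
    then have "j < i" using that by simp
    from dihedral_less[OF this that(1)] show ?thesis
      using pres_eq.sym[of 5 ?R "[j, i]" "[i, j]"] pres_eq.sym[of 5 ?R "[j, i, j]" "[i, j, i]"]
        pres_eq.sym[of 5 ?R "[j, i, j, i]" "[i, j, i, j]"]
      by (auto simp: mult.commute)
  qed
  show "foldr reflect w x = x" if "w \<in> ?R" for w x
    using coxeter_relator_acts coxeter_relators_butlast[of "[3, 3, 4, 3]" 3] that by auto
qed (auto simp: f4_cartan_def)

section \<open>Translations of the affine group [3,3,4,3]\<close>

text \<open>
  The null root of the affine diagram, spanning the radical of the invariant form.
\<close>

definition delta :: "nat \<Rightarrow> int" where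
  "delta i = (if i < 5 then [1, 2, 3, 4, 2] ! i else 0)"

text \<open>
  The word \<open>u\<close> acts on the affine root lattice as the translation with functional \<open>k\<close>,
  that is, as \<open>x \<mapsto> x + k(x)\<delta>\<close>. The condition \<open>k(\<delta>) = 0\<close> makes such
  maps compose by adding functionals.
\<close>

definition translates :: "nat list \<Rightarrow> (nat \<Rightarrow> int) \<Rightarrow> bool" where
  "translates u k \<longleftrightarrow> u \<in> lists {..<5} \<and> (\<Sum>j<5. k j * delta j) = 0 \<and>
    (\<forall>x. (\<forall>i\<ge>5. x i = 0) \<longrightarrow>
      foldr reflect u x = (\<lambda>i. x i + (\<Sum>j<5. k j * x j) * delta i))"

lemma delta_simps [simp]:
  "delta 0 = 1" "delta (Suc 0) = 2" "delta 2 = 3" "delta 3 = 4" "delta 4 = 2" "i \<ge> 5 \<Longrightarrow> delta i = 0"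
  by (simp_all add: delta_def)

lemma translatesD:
  assumes "translates u k" "\<And>i. i \<ge> 5 \<Longrightarrow> x i = 0"
  shows "foldr reflect u x = (\<lambda>i. x i + (\<Sum>j<5. k j * x j) * delta i)"
  using assms by (simp add: translates_def)

lemma translatesI:
  assumes "u \<in> lists {..<5}" "(\<Sum>j<5. k j * delta j) = 0"
    and act: "\<And>x i. x 5 = 0 \<Longrightarrow> i < 5 \<Longrightarrow>
      foldr reflect u x i = x i + (\<Sum>j<5. k j * x j) * delta i"
  shows "translates u k"
  unfolding translates_def
proof (intro conjI allI impI ext assms(1,2))
  fix x :: "nat \<Rightarrow> int" and i
  assume x: "\<forall>i\<ge>5. x i = 0"
  show "foldr reflect u x i = x i + (\<Sum>j<5. k j * x j) * delta i"
  proof (cases "i < 5")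
    case True
    then show ?thesis using act x by simp
  next
    case False
    then show ?thesis using affine.act_coordinate[OF assms(1), of i x] by simp
  qed
qed

lemma translates_append:
  assumes "translates u k" "translates v l"
  shows "translates (u @ v) (\<lambda>j. k j + l j)"
  unfolding translates_def
proof (intro conjI allI impI ext)
  show "u @ v \<in> lists {..<5}" using assms by (simp add: translates_def)
  show "(\<Sum>j<5. (k j + l j) * delta j) = 0"
    using assms by (simp add: translates_def algebra_simps sum.distrib)
  fix x :: "nat \<Rightarrow> int" and i assume x: "\<forall>i\<ge>5. x i = 0"
  have "foldr reflect v x = (\<lambda>i. x i + (\<Sum>j<5. l j * x j) * delta i)"
    using assms(2) x by (intro translatesD) auto
  moreover have "foldr reflect u (\<lambda>i. x i + (\<Sum>j<5. l j * x j) * delta i) =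
      (\<lambda>i. x i + (\<Sum>j<5. l j * x j) * delta i +
        (\<Sum>j<5. k j * (x j + (\<Sum>j<5. l j * x j) * delta j)) * delta i)"
    using assms(1) x by (intro translatesD) auto
  moreover have "(\<Sum>j<5. k j * (x j + c * delta j)) = (\<Sum>j<5. k j * x j) + c * (\<Sum>j<5. k j * delta j)" for c
    by (simp add: sum_distrib_left sum.distrib algebra_simps)
  moreover have "(\<Sum>j<5. k j * delta j) = 0" using assms(1) by (simp add: translates_def)
  moreover have "(\<Sum>j<5. (k j + l j) * x j) = (\<Sum>j<5. k j * x j) + (\<Sum>j<5. l j * x j)"
    by (simp add: sum.distrib distrib_right)
  ultimately show "foldr reflect (u @ v) x i = x i + (\<Sum>j<5. (k j + l j) * x j) * delta i"
    by (simp add: distrib_right)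
qed

lemma translates_Nil: "translates [] (\<lambda>_. 0)"
  by (simp add: translates_def)

lemma translates_cong: "translates u k \<Longrightarrow> (\<And>j. j < 5 \<Longrightarrow> k j = l j) \<Longrightarrow> translates u l"
  by (simp add: translates_def)

lemma translates_rev:
  assumes "translates u k"
  shows "translates (rev u) (\<lambda>j. - k j)"
  unfolding translates_def
proof (intro conjI allI impI ext)
  show u: "rev u \<in> lists {..<5}" using assms by (simp add: translates_def)
  show k: "(\<Sum>j<5. - k j * delta j) = 0"
    using assms by (simp add: translates_def sum_negf)
  fix x :: "nat \<Rightarrow> int" and i assume x: "\<forall>i\<ge>5. x i = 0"
  let ?c = "\<Sum>j<5. k j * x j"
  have "foldr reflect u (\<lambda>i. x i - ?c * delta i) =
      (\<lambda>i. x i - ?c * delta i + (\<Sum>j<5. k j * (x j - ?c * delta j)) * delta i)"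
    using assms x by (intro translatesD) auto
  moreover have "(\<Sum>j<5. k j * (x j - c * delta j)) = (\<Sum>j<5. k j * x j) + c * (\<Sum>j<5. - k j * delta j)" for c
    by (simp add: sum_distrib_left sum_subtractf sum_negf algebra_simps)
  ultimately have "foldr reflect u (\<lambda>i. x i - ?c * delta i) = x"
    using k by simp
  then have "foldr reflect (rev u) x = (\<lambda>i. x i - ?c * delta i)"
    using affine.act_rev_cancel[OF u] by (metis rev_rev_ident)
  then show "foldr reflect (rev u) x i = x i + (\<Sum>j<5. - k j * x j) * delta i"
    by (simp add: sum_negf)
qed

lemma translates_word_pow:
  assumes "translates u k"
  shows "translates (word_pow u m) (\<lambda>j. int m * k j)"
proof (induction m)
  case 0
  then show ?case using translates_Nil by simp
next
  case (Suc m)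
  then show ?case using translates_append[OF assms Suc] by (simp add: algebra_simps)
qed

text \<open>
  The entry \<open>k\<^sub>0\<close> is determined by the others through \<open>k(\<delta>) = 0\<close>, so
  translations are compared on \<open>k\<^sub>1, \<dots>, k\<^sub>4\<close> only. Through faithfulness, this lemma
  replaces all rewriting of words by arithmetic of integer vectors.
\<close>

lemma translates_unique:
  assumes "translates u k" "translates v l" "\<And>j. j \<in> {1..4} \<Longrightarrow> k j = l j"
  shows "pres_eq 5 (coxeter_relators [3, 3, 4, 3]) u v"
proof -
  have lists: "u \<in> lists {..<5}" "v \<in> lists {..<5}" using assms by (auto simp: translates_def)
  have "(\<Sum>j<5. k j * delta j) = (\<Sum>j<5. l j * delta j)"
    using assms(1,2) by (simp add: translates_def)
  then have "k 0 = l 0" using assms(3) by (simp add: sum_lessThan_5)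
  have eq: "k j = l j" if "j < 5" for j
    using less_5_cases[OF that] \<open>k 0 = l 0\<close> assms(3) by auto
  have "translates (u @ rev v) (\<lambda>_. 0)"
    using translates_append[OF assms(1) translates_rev[OF assms(2)]]
    by (rule translates_cong) (simp add: eq)
  then have "foldr reflect (u @ rev v) (simple_root s) = simple_root s" if "s < 5" for s
    using translatesD[of "u @ rev v" "\<lambda>_. 0" "simple_root s"] that by (simp add: simple_root_def)
  then have "pres_eq 5 (coxeter_relators [3, 3, 4, 3]) (u @ rev v) []"
    using lists by (intro affine.act_faithful[of "{..<5}"]) auto
  then show ?thesis using lists by (simp add: pres_eq_cancel_iff)
qed

lemma reflect_delta: "i < 5 \<Longrightarrow> reflect i delta = delta"
  by (drule less_5_cases, elim disjE; hypsubst; simp add: reflect_simps fun_upd_idem)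

lemma act_delta: "u \<in> lists {..<5} \<Longrightarrow> foldr reflect u delta = delta"
  by (induction u) (auto simp: reflect_delta)

lemma translatesI_roots:
  assumes u: "u \<in> lists {..<5}"
    and roots: "\<And>s. s < 5 \<Longrightarrow> foldr reflect u (simple_root s) = (\<lambda>i. simple_root s i + k s * delta i)"
  shows "translates u k"
proof -
  have act: "foldr reflect u x = (\<lambda>i. x i + (\<Sum>j<5. k j * x j) * delta i)" if "\<forall>i\<ge>5. x i = 0" for x
  proof -
    have x: "x = (\<lambda>i. \<Sum>j<5. x j * simple_root j i)"
      by (rule affine.expand_simple_roots) (use that in auto)
    have "foldr reflect u x = foldr reflect u (\<lambda>i. \<Sum>j<5. x j * simple_root j i)"
      by (subst x) (rule HOL.refl)
    also have "\<dots> = (\<lambda>i. \<Sum>j<5. x j * foldr reflect u (simple_root j) i)"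
      by (rule affine.act_sum) simp
    also have "\<dots> = (\<lambda>i. \<Sum>j<5. x j * simple_root j i + x j * k j * delta i)"
      by (intro ext sum.cong) (simp_all add: roots algebra_simps)
    also have "\<dots> = (\<lambda>i. (\<Sum>j<5. x j * simple_root j i) + (\<Sum>j<5. k j * x j) * delta i)"
      by (simp add: sum.distrib sum_distrib_left mult_ac)
    also have "\<dots> = (\<lambda>i. x i + (\<Sum>j<5. k j * x j) * delta i)"
      using x by metis
    finally show ?thesis .
  qed
  have "(\<Sum>j<5. k j * delta j) = 0"
    using fun_cong[OF act[of delta], of 0] act_delta[OF u] by simp
  then show ?thesis using u act by (simp add: translates_def)
qed

section \<open>The invariant quadratic form and reduction modulo 3\<close>

text \<open>
  The invariant form, normalized so that long roots have norm 2 and short roots norm 1. It is integral, and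
  positive semidefinite with radical spanned by \<open>\<delta>\<close>.
\<close>

definition quad :: "(nat \<Rightarrow> int) \<Rightarrow> int" where
  "quad x = 2 * (x 0)\<^sup>2 + 2 * (x 1)\<^sup>2 + 2 * (x 2)\<^sup>2 + (x 3)\<^sup>2 + (x 4)\<^sup>2
    - 2 * x 0 * x 1 - 2 * x 1 * x 2 - 2 * x 2 * x 3 - x 3 * x 4"

text \<open>
  The four squares are twice the coordinates of \<open>x\<close> in the Euclidean space of
  \<open>F\<^sub>4\<close>, with \<open>b\<close>, \<open>c\<close>, \<open>d\<close> and \<open>e\<close>
  realized as \<open>e\<^sub>2 - e\<^sub>3\<close>, \<open>e\<^sub>3 - e\<^sub>4\<close>, \<open>e\<^sub>4\<close>
  and \<open>(e\<^sub>1 - e\<^sub>2 - e\<^sub>3 - e\<^sub>4)/2\<close>.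
\<close>

lemma quad_sum_of_squares:
  "4 * quad x = (x 4 - 2 * x 0)\<^sup>2 + (2 * x 1 - 2 * x 0 - x 4)\<^sup>2 + (2 * x 2 - 2 * x 1 - x 4)\<^sup>2
    + (2 * x 3 - 2 * x 2 - x 4)\<^sup>2"
  by (simp add: quad_def power2_eq_square algebra_simps)

lemma quad_nonneg: "quad x \<ge> 0"
proof -
  have "0 \<le> 4 * quad x"
    unfolding quad_sum_of_squares by (intro add_nonneg_nonneg zero_le_power2)
  then show ?thesis by simp
qed

lemma quad_zero:
  assumes "quad x = 0" "\<And>i. i \<ge> 5 \<Longrightarrow> x i = 0"
  shows "x = (\<lambda>i. x 0 * delta i)"
proof
  fix i
  have "(x 4 - 2 * x 0)\<^sup>2 = 0 \<and> (2 * x 1 - 2 * x 0 - x 4)\<^sup>2 = 0 \<and> (2 * x 2 - 2 * x 1 - x 4)\<^sup>2 = 0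
      \<and> (2 * x 3 - 2 * x 2 - x 4)\<^sup>2 = 0"
    using quad_sum_of_squares[of x] assms(1) by (simp add: add_nonneg_eq_0_iff)
  then have "x 4 = 2 * x 0" "x 1 = 2 * x 0" "x 2 = 3 * x 0" "x 3 = 4 * x 0"
    by auto
  then show "x i = x 0 * delta i"
    using assms(2)[of i] less_5_cases[of i] by (cases "i < 5") auto
qed

lemma quad_reflect: "i < 5 \<Longrightarrow> x 5 = 0 \<Longrightarrow> quad (reflect i x) = quad x"
  by (drule less_5_cases, elim disjE; hypsubst;
    simp add: reflect_simps quad_def power2_eq_square algebra_simps)

lemma quad_act:
  assumes "u \<in> lists {..<5}" "x 5 = 0"
  shows "quad (foldr reflect u x) = quad x"
  using assms
proof (induction u)
  case (Cons i u)
  then have "foldr reflect u x 5 = 0"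
    using affine.act_coordinate[of u "{..<5}" 5 x] by simp
  then show ?case using Cons by (simp add: quad_reflect)
qed simp

lemma quad_simple_root: "s < 5 \<Longrightarrow> quad (simple_root s) \<le> 2"
  by (drule less_5_cases, elim disjE; hypsubst; simp add: quad_def simple_root_def)

text \<open>
  Let \<open>\<beta>\<close> be the image of a simple root \<open>\<alpha>\<close> and
  \<open>\<beta> = \<alpha> + 3\<gamma>\<close>. By the parallelogram law
  \<open>9 q(\<gamma>) = q(\<beta> - \<alpha>) \<le> 2q(\<alpha>) + 2q(\<beta>) = 4q(\<alpha>) \<le> 8\<close> for
  the invariant form \<open>q\<close>. As \<open>q(\<gamma>)\<close> is an integer it vanishes, so
  \<open>\<gamma>\<close> is a multiple of \<open>\<delta>\<close>.
\<close>

lemma act_mod_3_translates: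
  assumes u: "u \<in> lists {..<5}"
    and cong: "\<And>s i. s < 5 \<Longrightarrow> i < 5 \<Longrightarrow> [foldr reflect u (simple_root s) i = simple_root s i] (mod 3)"
  obtains k where "translates u (\<lambda>j. 3 * k j)"
proof -
  have "\<exists>c. foldr reflect u (simple_root s) = (\<lambda>i. simple_root s i + 3 * c * delta i)" if s: "s < 5" for s
  proof -
    let ?a = "simple_root s" and ?b = "foldr reflect u (simple_root s)"
    define g where "g i = (?b i - ?a i) div 3" for i
    have a: "?a i = 0" and b: "?b i = 0" if "i \<ge> 5" for i
      using that s affine.act_coordinate[OF u, of i ?a] by (simp_all add: simple_root_def)
    have g: "?b i = ?a i + 3 * g i" for i
    proof (cases "i < 5")
      case True
      then have "3 dvd ?b i - ?a i" using cong s by (simp add: cong_iff_dvd_diff)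
      then show ?thesis by (simp add: g_def)
    qed (use a b in \<open>simp add: g_def\<close>)
    have "quad ?b = quad ?a"
      using a by (intro quad_act u) simp
    \<comment> \<open>The parallelogram law.\<close>
    moreover have "quad (\<lambda>i. ?b i + ?a i) + 9 * quad g = 2 * quad ?b + 2 * quad ?a"
      unfolding quad_def g by (simp add: power2_eq_square algebra_simps)
    moreover have "quad (\<lambda>i. ?b i + ?a i) \<ge> 0" "quad ?a \<le> 2" "quad g \<ge> 0"
      using quad_nonneg quad_simple_root s by auto
    ultimately have "quad g = 0" by linarith
    moreover have "g i = 0" if "i \<ge> 5" for i using a b that by (simp add: g_def)
    ultimately have "g = (\<lambda>i. g 0 * delta i)" by (rule quad_zero)
    then have "?b i = ?a i + 3 * g 0 * delta i" for i
      using g[of i] by (metis mult.assoc)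
    then show ?thesis by blast
  qed
  then obtain k where "\<And>s. s < 5 \<Longrightarrow> foldr reflect u (simple_root s) = (\<lambda>i. simple_root s i + 3 * k s * delta i)"
    by metis
  then have "translates u (\<lambda>j. 3 * k j)" by (intro translatesI_roots u)
  then show thesis by (rule that)
qed

text \<open>
  In the subgroup generated by the letters \<open>i, \<dots>, j-1\<close> with \<open>j \<le> 4\<close>, of type
  \<open>A\<close> or \<open>B\<close>, the \<open>i\<close>-th coordinate of a root is \<open>-1\<close>,
  \<open>0\<close> or \<open>1\<close>, as the sum of squares contains the square of twice that coordinate. So
  preserving the coordinate modulo 3 is the same as preserving it.
\<close>

lemma end_coordinate_stabilizer:
  assumes ij: "i < j" "j \<le> 4" and u: "u \<in> lists {i..<j}"
    and cong: "\<And>s. s < 5 \<Longrightarrow> [foldr reflect u (simple_root s) i = simple_root s i] (mod 3)"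
  shows "\<exists>v\<in>lists {Suc i..<j}. pres_eq 5 (coxeter_relators [3, 3, 4, 3]) u v"
proof -
  have u5: "u \<in> lists {..<5}" using u ij by (auto simp: in_lists_conv_set)
  have "foldr reflect u (simple_root s) i = simple_root s i" if s: "s \<in> {i..<j}" for s
  proof -
    let ?b = "foldr reflect u (simple_root s)"
    have supp: "?b k = 0" if "k \<notin> {i..<j}" for k
      using s that by (intro affine.act_support[OF u]) (auto simp: simple_root_def)
    have "quad ?b = quad (simple_root s)"
      using s ij by (intro quad_act u5) (auto simp: simple_root_def)
    then have "4 * quad ?b \<le> 8"
      using quad_simple_root[of s] s ij by simp
    moreover have "(2 * ?b i)\<^sup>2 \<le> 4 * quad ?b"
    proof -
      have b4: "?b 4 = 0" using ij by (intro supp) auto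
      have "i = 0 \<or> i = 1 \<or> i = 2 \<or> i = 3" using ij by arith
      then show ?thesis
        unfolding quad_sum_of_squares
        using supp[of 0] supp[of 1] supp[of 2] ij b4 by (elim disjE) simp_all
    qed
    ultimately have "(?b i)\<^sup>2 \<le> 2" by (simp add: power_mult_distrib)
    have "\<bar>?b i\<bar> < 2"
    proof (rule ccontr)
      assume "\<not> \<bar>?b i\<bar> < 2"
      then have "2\<^sup>2 \<le> \<bar>?b i\<bar>\<^sup>2" by (intro power_mono) auto
      then show False using \<open>(?b i)\<^sup>2 \<le> 2\<close> by simp
    qed
    then have "\<bar>?b i - simple_root s i\<bar> < 3"
      by (auto simp: simple_root_def)
    moreover have "3 dvd ?b i - simple_root s i"
      using cong[of s] s ij by (simp add: cong_iff_dvd_diff)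
    ultimately show ?thesis
      using dvd_imp_le_int[of "?b i - simple_root s i" 3] by fastforce
  qed
  then have "\<exists>v\<in>lists ({i..<j} - {i}). pres_eq 5 (coxeter_relators [3, 3, 4, 3]) u v"
    using ij u by (intro affine.act_stabilizer) auto
  moreover have "{i..<j} - {i} = {Suc i..<j}" by auto
  ultimately show ?thesis by simp
qed

section \<open>The translation lattice in the toroidal quotients\<close>

text \<open>
  The reflection \<open>a\<close> times the reflection in the highest root: a translation along a minimal vector.
\<close>

definition translation_word :: "nat list" where
  "translation_word = [0] @ sigma_word @ tau_word @ sigma_word"

text \<open>
  A translation along the sum of two orthogonal minimal vectors. The relation
  \<open>(a\<sigma>\<tau>)\<^sup>2\<^sup>s = 1\<close> says that its \<open>s\<close>-th power is trivial.
\<close>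

definition diagonal_word :: "nat list" where
  "diagonal_word = word_pow ([0] @ sigma_word @ tau_word) 2"

lemmas word_defs = translation_word_def diagonal_word_def sigma_word_def tau_word_def word_conj_def

lemma translates_translation_word: "translates translation_word ((!) [2, - 1, 0, 0, 0])"
  by (rule translatesI, simp add: word_defs, simp add: sum_lessThan_5, drule less_5_cases, elim disjE;
    hypsubst; simp add: word_defs reflect_simps sum_lessThan_5 algebra_simps)

lemma translates_diagonal_word: "translates diagonal_word ((!) [2, 0, 0, 0, - 1])"
  by (rule translatesI, simp add: word_defs, simp add: sum_lessThan_5, drule less_5_cases, elim disjE;
    hypsubst; simp add: word_defs reflect_simps sum_lessThan_5 algebra_simps)

lemma translates_conj:
  assumes "translates u k" "g \<in> lists {..<5}"
  shows "translates (g @ u @ rev g) (\<lambda>s. \<Sum>j<5. k j * foldr reflect (rev g) (simple_root s) j)"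
proof (rule translatesI_roots)
  show "g @ u @ rev g \<in> lists {..<5}" using assms by (simp add: translates_def)
  fix s :: nat assume "s < 5"
  let ?y = "foldr reflect (rev g) (simple_root s)"
  have "?y i = 0" if "i \<ge> 5" for i
    using that \<open>s < 5\<close> affine.act_coordinate[of "rev g" "{..<5}" i "simple_root s"] assms(2)
    by (simp add: simple_root_def)
  then have "foldr reflect u ?y = (\<lambda>i. 1 * ?y i + (\<Sum>j<5. k j * ?y j) * delta i)"
    using translatesD[OF assms(1), of ?y] by simp
  then have "foldr reflect (g @ u @ rev g) (simple_root s) =
      foldr reflect g (\<lambda>i. 1 * ?y i + (\<Sum>j<5. k j * ?y j) * delta i)"
    by simp
  also have "\<dots> = (\<lambda>i. foldr reflect g ?y i + (\<Sum>j<5. k j * ?y j) * delta i)"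
    unfolding affine.act_linear act_delta[OF assms(2)] by simp
  finally show "foldr reflect (g @ u @ rev g) (simple_root s) =
      (\<lambda>i. simple_root s i + (\<Sum>j<5. k j * ?y j) * delta i)"
    using affine.act_rev_cancel[OF assms(2)] by simp
qed

lemma translates_conj_eval:
  assumes "translates u k" "g \<in> lists {..<5}"
    and "\<And>s. s < 5 \<Longrightarrow> (\<Sum>j<5. k j * foldr reflect (rev g) (simple_root s) j) = l s"
  shows "translates (g @ u @ rev g) l"
  using translates_conj[OF assms(1,2)] by (rule translates_cong) (rule assms(3))

lemma translates_conjugates:
  shows "translates ([1] @ translation_word @ rev [1]) ((!) [1, 1, - 1, 0, 0])"
    and "translates ([1, 2, 3, 2, 1] @ translation_word @ rev [1, 2, 3, 2, 1]) ((!) [0, 1, 0, 0, - 1])"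
    and "translates ([4] @ diagonal_word @ rev [4]) ((!) [2, 0, 0, - 1, 1])"
    and "translates ([4, 3, 2, 3, 4] @ diagonal_word @ rev [4, 3, 2, 3, 4]) ((!) [2, - 2, 0, 0, 1])"
  by (rule translates_conj_eval, rule translates_translation_word translates_diagonal_word, simp,
    drule less_5_cases, elim disjE; hypsubst;
    simp add: reflect_simps sum_lessThan_5 simple_root_def)+

text \<open>
  Translations whose functionals are the negatives of the four unit vectors on
  \<open>k\<^sub>1, \<dots>, k\<^sub>4\<close>, so the exponents of a translation in this basis are read off its
  functional. The last two are \<open>diagonal_word\<close> and its product with a conjugate; together with the
  squares of the first two they span the sublattice generated by all conjugates of that translation.
\<close>

definition basis_translation :: "nat \<Rightarrow> nat list" where
  "basis_translation j =
    (if j = 1 then translation_word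
     else if j = 2 then translation_word @ [1] @ translation_word @ rev [1]
     else if j = 3 then diagonal_word @ [4] @ diagonal_word @ rev [4]
     else diagonal_word)"

lemma basis_translation_simps [simp]:
  "basis_translation (Suc 0) = translation_word"
  "basis_translation 2 = translation_word @ [1] @ translation_word @ rev [1]"
  "basis_translation 3 = diagonal_word @ [4] @ diagonal_word @ rev [4]"
  "basis_translation 4 = diagonal_word"
  by (simp_all add: basis_translation_def)

lemma one_to_four_cases: "j \<in> {1..4} \<Longrightarrow> j = Suc 0 \<or> j = 2 \<or> j = 3 \<or> j = (4::nat)"
  by (auto simp: eval_nat_numeral le_Suc_eq)

lemma translates_basis_translation:
  assumes "j \<in> {1..4}"
  shows "\<exists>k. translates (basis_translation j) k \<and> (\<forall>i\<in>{1..4}. k i = - of_bool (i = j))"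
  using one_to_four_cases[OF assms]
proof (elim disjE)
  assume "j = Suc 0"
  then show ?thesis
    using translates_translation_word
    by (intro exI[of _ "(!) [2, - 1, 0, 0, 0]"] conjI ballI) (simp, drule one_to_four_cases, auto)
next
  assume "j = 2"
  then show ?thesis
    using translates_append[OF translates_translation_word translates_conjugates(1)]
    by (intro exI[of _ "\<lambda>i. [2, - 1, 0, 0, 0] ! i + [1, 1, - 1, 0, 0] ! i"] conjI ballI) (simp, drule one_to_four_cases, auto)
next
  assume "j = 3"
  then show ?thesis
    using translates_append[OF translates_diagonal_word translates_conjugates(3)]
    by (intro exI[of _ "\<lambda>i. [2, 0, 0, 0, - 1] ! i + [2, 0, 0, - 1, 1] ! i"] conjI ballI) (simp, drule one_to_four_cases, auto)
next
  assume "j = 4"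
  then show ?thesis
    using translates_diagonal_word
    by (intro exI[of _ "(!) [2, 0, 0, 0, - 1]"] conjI ballI) (simp, drule one_to_four_cases, auto)
qed

definition translation_product :: "(nat \<Rightarrow> nat list) \<Rightarrow> nat list" where
  "translation_product z = z 1 @ z 2 @ z 3 @ z 4"

lemma translates_translation_product:
  assumes "\<And>j. j \<in> {1..4} \<Longrightarrow> \<exists>k. translates (z j) k \<and> (\<forall>i\<in>{1..4}. k i = c j * of_bool (i = j))"
  obtains k where "translates (translation_product z) k" "\<And>i. i \<in> {1..4} \<Longrightarrow> k i = c i"
proof -
  obtain k where k: "\<And>j. j \<in> {1..4} \<Longrightarrow> translates (z j) (k j)"
    "\<And>i j. i \<in> {1..4} \<Longrightarrow> j \<in> {1..4} \<Longrightarrow> k j i = c j * of_bool (i = j)"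
    using assms by metis
  have "translates (translation_product z) (\<lambda>i. k 1 i + (k 2 i + (k 3 i + k 4 i)))"
    unfolding translation_product_def by (intro translates_append k) simp_all
  moreover have "k 1 i + (k 2 i + (k 3 i + k 4 i)) = c i" if "i \<in> {1..4}" for i
    using one_to_four_cases[OF that] k(2)[OF that] by auto
  ultimately show thesis using that by blast
qed

lemma pres_eq_translation_product:
  assumes "\<And>j. j \<in> {1..4} \<Longrightarrow> pres_eq n R (z j) []"
  shows "pres_eq n R (translation_product z) []"
  unfolding translation_product_def using assms[of 1] assms[of 2] assms[of 3] assms[of 4]
  by (intro pres_eq_Nil_left) simp_all

lemma pres_eq_affine_mono:
  assumes "pres_eq 5 (coxeter_relators [3, 3, 4, 3]) u v" "coxeter_relators [3, 3, 4, 3] \<subseteq> R"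
  shows "pres_eq 5 R u v"
  using assms(1) by (rule pres_eq_mono) (use assms(2) in \<open>auto intro: pres_eq_relator\<close>)

text \<open>
  If the \<open>N\<close>-th powers of the basis translations are trivial, then every translation is a product of
  powers with exponents in \<open>{0, \<dots>, N-1}\<close>. The discrepancy between the two is a product of
  \<open>N\<close>-th powers or their inverses, first as a translation and then, by faithfulness, as a word.
\<close>

lemma translation_normal_form:
  assumes R: "coxeter_relators [3, 3, 4, 3] \<subseteq> R"
    and kill: "\<And>j. j \<in> {1..4} \<Longrightarrow> pres_eq 5 R (word_pow (basis_translation j) N) []" and "N > 0"
    and u: "translates u k"
  shows "pres_eq 5 R u (translation_product (\<lambda>j. word_pow (basis_translation j) (nat (- k j mod int N))))"
    (is "pres_eq 5 R u (translation_product ?p)")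
proof -
  \<comment> \<open>The basis element \<open>j\<close> has functional \<open>-1\<close> at \<open>j\<close>, so its exponent is the
    residue of \<open>-k\<^sub>j\<close>.\<close>
  define c where "c j = (k j + (- k j) mod int N) div int N" for j
  have c: "k j + (- k j) mod int N = int N * c j" for j
  proof -
    have "(k j + (- k j) mod int N) mod int N = 0"
      by (simp add: mod_add_right_eq)
    then show ?thesis by (metis add.right_neutral c_def mult_div_mod_eq)
  qed
  define z where "z j = (if c j \<le> 0 then word_pow (word_pow (basis_translation j) N) (nat (- c j))
    else word_pow (rev (word_pow (basis_translation j) N)) (nat (c j)))" for j
  obtain l where l: "translates (translation_product ?p) l"
    "\<And>i. i \<in> {1..4} \<Longrightarrow> l i = - ((- k i) mod int N)"
  proof (rule translates_translation_product[of ?p "\<lambda>i. - ((- k i) mod int N)"])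
    fix j :: nat assume "j \<in> {1..4}"
    then obtain b where "translates (basis_translation j) b" "\<forall>i\<in>{1..4}. b i = - of_bool (i = j)"
      using translates_basis_translation[OF \<open>j \<in> {1..4}\<close>] by blast
    then show "\<exists>k'. translates (?p j) k' \<and> (\<forall>i\<in>{1..4}. k' i = - (- k j mod int N) * of_bool (i = j))"
      using translates_word_pow[of "basis_translation j" b "nat (- k j mod int N)"] \<open>N > 0\<close> by auto
  qed blast
  obtain m where m: "translates (translation_product z) m" "\<And>i. i \<in> {1..4} \<Longrightarrow> m i = int N * c i"
  proof (rule translates_translation_product[of z "\<lambda>i. int N * c i"])
    fix j :: nat assume "j \<in> {1..4}"
    then obtain b where b: "translates (basis_translation j) b" "\<forall>i\<in>{1..4}. b i = - of_bool (i = j)"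
      using translates_basis_translation[OF \<open>j \<in> {1..4}\<close>] by blast
    note bN = translates_word_pow[OF b(1), of N]
    have "\<exists>k'. translates (z j) k' \<and> (\<forall>i. k' i = - int N * c j * b i)"
    proof (cases "c j \<le> 0")
      case True
      then show ?thesis
        using translates_word_pow[OF bN, of "nat (- c j)"] by (auto simp: z_def)
    next
      case False
      then show ?thesis
        using translates_word_pow[OF translates_rev[OF bN], of "nat (c j)"] by (auto simp: z_def)
    qed
    then show "\<exists>k'. translates (z j) k' \<and> (\<forall>i\<in>{1..4}. k' i = int N * c j * of_bool (i = j))"
      using b(2) by fastforce
  qed blast
  have "pres_eq 5 R (translation_product z) []"
  proof (rule pres_eq_translation_product)
    fix j :: nat assume "j \<in> {1..4}"
    note kill = kill[OF this]
    have "word_pow [] i = []" for i by (induction i) auto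
    then show "pres_eq 5 R (z j) []"
      using pres_eq_word_pow[OF kill, of "nat (- c j)"] pres_eq_word_pow[OF pres_eq_rev[OF kill], of "nat (c j)"]
      by (auto simp: z_def)
  qed
  moreover have "pres_eq 5 (coxeter_relators [3, 3, 4, 3]) (u @ rev (translation_product ?p)) (translation_product z)"
    using translates_append[OF u translates_rev[OF l(1)]] m(1)
    by (rule translates_unique) (simp add: l(2) m(2) c)
  ultimately have "pres_eq 5 R (u @ rev (translation_product ?p)) []"
    using pres_eq_affine_mono[OF _ R] pres_eq.trans by blast
  then show ?thesis
    using u l(1) by (simp add: pres_eq_cancel_iff translates_def)
qed

lemma pres_eq_word_pow_conj:
  assumes "pres_eq n R (word_pow u m) []" "g \<in> lists {..<n}" "u \<in> lists {..<n}"
  shows "pres_eq n R (word_pow (g @ u @ rev g) m) []"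
proof -
  have "pres_eq n R (word_pow (g @ u @ rev g) i) (g @ word_pow u i @ rev g)" for i
  proof (induction i)
    case 0
    then show ?case using pres_eq_append_rev[OF assms(2)] by (auto intro: pres_eq.sym)
  next
    case (Suc i)
    have "pres_eq n R ((g @ u @ rev g) @ word_pow (g @ u @ rev g) i) ((g @ u @ rev g) @ (g @ word_pow u i @ rev g))"
      using assms by (intro pres_eq_append Suc pres_eq.refl) simp
    moreover have "pres_eq n R ((g @ u) @ (rev g @ g) @ (word_pow u i @ rev g)) ((g @ u) @ [] @ (word_pow u i @ rev g))"
      using assms by (intro pres_eq_context pres_eq_rev_append) simp_all
    ultimately show ?case using pres_eq.trans by simp
  qed
  then show ?thesis using pres_eq_conj[OF assms(1,2)] pres_eq.trans by blast
qed

text \<open>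
  If a translation is the sum of two others, its \<open>m\<close>-th power is the product of theirs.
\<close>

lemma pres_eq_word_pow_translation_sum:
  assumes R: "coxeter_relators [3, 3, 4, 3] \<subseteq> R"
    and u: "translates u k" "pres_eq 5 R (word_pow u m) []"
    and v: "translates v l" "pres_eq 5 R (word_pow v m) []"
    and w: "translates w p" "\<And>j. j \<in> {1..4} \<Longrightarrow> p j = k j + l j"
  shows "pres_eq 5 R (word_pow w m) []"
proof -
  have "pres_eq 5 (coxeter_relators [3, 3, 4, 3]) (word_pow w m) (word_pow u m @ word_pow v m)"
    using translates_word_pow[OF w(1)] translates_append[OF translates_word_pow[OF u(1)] translates_word_pow[OF v(1)]]
    by (rule translates_unique) (simp add: w(2) distrib_left)
  then show ?thesis
    using pres_eq_affine_mono[OF _ R] pres_eq_Nil_left[OF u(2) v(2)] pres_eq.trans by blast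
qed

definition facet_relators :: "nat list set" where
  "facet_relators = coxeter_relators [3, 3, 4, 3] \<union> {word_pow translation_word 3}"

definition vertex_figure_relators :: "nat list set" where
  "vertex_figure_relators = coxeter_relators [3, 3, 4, 3] \<union> {word_pow diagonal_word 6}"

lemma translation_words_lists [simp]: "translation_word \<in> lists {..<5}" "diagonal_word \<in> lists {..<5}"
  by (simp_all add: word_defs)

text \<open>
  Each basis translation is a sum of two translations already known to be killed by 3; the starting point is the
  relator, and \<open>diagonal_word\<close> is a sum of two conjugates of the minimal translation.
\<close>

lemma facet_translation_order:
  assumes "j \<in> {1..4}"
  shows "pres_eq 5 facet_relators (word_pow (basis_translation j) 3) []"
proof -
  have R: "coxeter_relators [3, 3, 4, 3] \<subseteq> facet_relators" unfolding facet_relators_def by blast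
  note sum = pres_eq_word_pow_translation_sum[OF R]
  have t: "pres_eq 5 facet_relators (word_pow translation_word 3) []"
    by (rule pres_eq_relator) (simp_all add: facet_relators_def del: word_pow_numeral)
  note conj = pres_eq_word_pow_conj[OF t _ translation_words_lists(1)]
  have q: "pres_eq 5 facet_relators (word_pow diagonal_word 3) []"
    by (rule sum[OF translates_translation_word t translates_conjugates(2) conj translates_diagonal_word])
      (simp, drule one_to_four_cases, auto)
  note qconj = pres_eq_word_pow_conj[OF q _ translation_words_lists(2)]
  have "pres_eq 5 facet_relators (word_pow (basis_translation 2) 3) []"
    unfolding basis_translation_simps
    by (rule sum[OF translates_translation_word t translates_conjugates(1) conj
      translates_append[OF translates_translation_word translates_conjugates(1)]]) simp_all
  moreover have "pres_eq 5 facet_relators (word_pow (basis_translation 3) 3) []"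
    unfolding basis_translation_simps
    by (rule sum[OF translates_diagonal_word q translates_conjugates(3) qconj
      translates_append[OF translates_diagonal_word translates_conjugates(3)]]) simp_all
  ultimately show ?thesis using one_to_four_cases[OF assms] t q by (auto simp del: word_pow_numeral)
qed

text \<open>
  Here the starting point is the diagonal translation. Twice the minimal translation is the sum of two orthogonal
  diagonal ones, which accounts for the larger order of the first two basis elements.
\<close>

lemma vertex_figure_translation_order:
  assumes "j \<in> {1..4}"
  shows "pres_eq 5 vertex_figure_relators (word_pow (basis_translation j) (if j \<le> 2 then 12 else 6)) []"
proof -
  have R: "coxeter_relators [3, 3, 4, 3] \<subseteq> vertex_figure_relators" unfolding vertex_figure_relators_def by blast
  note sum = pres_eq_word_pow_translation_sum[OF R]
  have q: "pres_eq 5 vertex_figure_relators (word_pow diagonal_word 6) []"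
    by (rule pres_eq_relator) (simp_all add: vertex_figure_relators_def del: word_pow_numeral)
  note conj = pres_eq_word_pow_conj[OF q _ translation_words_lists(2)]
  have "pres_eq 5 vertex_figure_relators (word_pow (word_pow translation_word 2) 6) []"
    by (rule sum[OF translates_diagonal_word q translates_conjugates(4) conj
      translates_word_pow[OF translates_translation_word]]) (simp, drule one_to_four_cases, auto)
  then have t: "pres_eq 5 vertex_figure_relators (word_pow translation_word 12) []"
    by (simp add: word_pow_mult[symmetric] del: word_pow_numeral)
  have "pres_eq 5 vertex_figure_relators (word_pow (basis_translation 2) 12) []"
    unfolding basis_translation_simps
    by (rule sum[OF translates_translation_word t translates_conjugates(1)
      pres_eq_word_pow_conj[OF t _ translation_words_lists(1)]
      translates_append[OF translates_translation_word translates_conjugates(1)]]) simp_all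
  moreover have "pres_eq 5 vertex_figure_relators (word_pow (basis_translation 3) 6) []"
    unfolding basis_translation_simps
    by (rule sum[OF translates_diagonal_word q translates_conjugates(3) conj
      translates_append[OF translates_diagonal_word translates_conjugates(3)]]) simp_all
  ultimately show ?thesis using one_to_four_cases[OF assms] t q by (auto simp del: word_pow_numeral)
qed

lemma vertex_figure_translation_order_12:
  assumes "j \<in> {1..4}"
  shows "pres_eq 5 vertex_figure_relators (word_pow (basis_translation j) 12) []"
proof (cases "j \<le> 2")
  case True
  then show ?thesis using vertex_figure_translation_order[OF assms] by simp
next
  case False
  then have "pres_eq 5 vertex_figure_relators (word_pow (word_pow (basis_translation j) 6) 2) (word_pow [] 2)"
    using vertex_figure_translation_order[OF assms] by (intro pres_eq_word_pow) simp
  then show ?thesis by (simp add: word_pow_mult[symmetric] del: word_pow_numeral)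
      (simp add: numeral_2_eq_2 del: word_pow_numeral)
qed

lemma facet_trivial:
  assumes "translates u (\<lambda>j. 3 * k j)"
  shows "pres_eq 5 facet_relators u []"
proof -
  have "pres_eq 5 facet_relators u (translation_product (\<lambda>j. word_pow (basis_translation j) (nat (- (3 * k j) mod int 3))))"
    using assms by (intro translation_normal_form facet_translation_order) (auto simp: facet_relators_def)
  moreover have "- (3 * k j) mod int 3 = 0" for j by simp
  ultimately show ?thesis by (simp add: translation_product_def)
qed

section \<open>Octonion triality over the field with two elements\<close>

declare add_bit_eq_xor [simp del]

text \<open>
  The split octonions over the field with two elements, as pairs of 2-by-2 matrices with the Cayley-Dickson
  product \<open>(A, B)(C, D) = (AC + D*B, DA + BC*)\<close>, where the star denotes the adjugate matrix. The
  first four coordinates are the entries of \<open>A\<close>, the last four those of \<open>B\<close>, row by row.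
  Only the linear maps required below are defined, each with its matrix.
\<close>

datatype octonion = Oct bit bit bit bit bit bit bit bit

fun oct_conj :: "octonion \<Rightarrow> octonion" where
  "oct_conj (Oct p q r s t u v w) = Oct s q r p t u v w"

text \<open>
  This and the two following functions map \<open>x\<close> to \<open>ux*u\<close>, \<open>ux*\<close> and
  \<open>x*u\<close>, where \<open>u\<close> is the octonion of norm 1 and trace 0 whose first matrix exchanges
  the two basis vectors and whose second matrix is zero. Note that \<open>u* = u\<close>.
\<close>

fun oct_bimult :: "octonion \<Rightarrow> octonion" where
  "oct_bimult (Oct p q r s t u v w) = Oct p r q s t u v w"

fun oct_lmult :: "octonion \<Rightarrow> octonion" where
  "oct_lmult (Oct p q r s t u v w) = Oct r p s q u t w v"

fun oct_rmult :: "octonion \<Rightarrow> octonion" where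
  "oct_rmult (Oct p q r s t u v w) = Oct q s p r u t w v"

text \<open>
  Three algebra automorphisms. Apart from \<open>u\<^sub>1 = u\<close>, consider \<open>u\<^sub>2\<close>,
  \<open>u\<^sub>3\<close>, \<open>u\<^sub>4\<close>, whose second matrices have the first column
  \<open>(1, 0)\<close>, \<open>(0, 1)\<close>, \<open>(1, 1)\<close> and second column zero, the first matrix
  being that of \<open>u\<close>. The automorphisms with indices 3, 4 and 5 exchange \<open>u\<^sub>1\<close> with
  \<open>u\<^sub>2\<close>, \<open>u\<^sub>2\<close> with \<open>u\<^sub>3\<close>, and \<open>u\<^sub>3\<close>
  with \<open>u\<^sub>4\<close>, fixing the other two, so they generate a symmetric group of degree 4.
\<close>

fun oct_aut :: "nat \<Rightarrow> octonion \<Rightarrow> octonion" where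
  "oct_aut i (Oct p q r s t u v w) =
    (if i = 3 then Oct p q (r + w) s (q + t + v) (u + w) v w
     else if i = 4 then Oct p q r s v w t u
     else Oct p q r s (t + v) (u + w) v w)"

text \<open>
  For an octonion \<open>w\<close> of norm 1, Moufang's identities show that
  \<open>(x, y, z) \<mapsto> (wx*w, w*z*, y*w*)\<close> and its cyclic shifts preserve the trilinear form
  \<open>tr (xyz)\<close>. The generators 0 and 2 are of this kind with \<open>w = 1\<close> and
  \<open>w = u\<close>; the generator 1 is the shift with \<open>w = 1\<close> that reverses the order of the
  triple. The reflection \<open>c\<close> and its conjugates under the automorphisms belong to the four mutually
  orthogonal octonions \<open>u\<^sub>1, \<dots>, u\<^sub>4\<close>.
\<close>

definition triality :: "nat \<Rightarrow> octonion \<times> octonion \<times> octonion \<Rightarrow> octonion \<times> octonion \<times> octonion" where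
  "triality i = (\<lambda>(x, y, z).
    if i = 0 then (oct_conj x, oct_conj z, oct_conj y)
    else if i = 1 then (oct_conj z, oct_conj y, oct_conj x)
    else if i = 2 then (oct_bimult x, oct_lmult z, oct_rmult y)
    else (oct_aut i x, oct_aut i y, oct_aut i z))"

lemma bit_cancel: "x + x = (0 :: bit)" "x + (x + y) = (y :: bit)"
  by (cases x; simp)+

lemmas triality_simps = triality_def bit_cancel add.left_commute add.commute add.assoc

lemma triality_cases: "(\<And>p q r s t u v w p' q' r' s' t' u' v' w' p'' q'' r'' s'' t'' u'' v'' w''.
    X = (Oct p q r s t u v w, Oct p' q' r' s' t' u' v' w', Oct p'' q'' r'' s'' t'' u'' v'' w'') \<Longrightarrow> thesis)
  \<Longrightarrow> thesis"
  by (cases X, rename_tac x y z, case_tac x, case_tac y, case_tac z) simp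

lemma triality_involution: "i < 6 \<Longrightarrow> triality i (triality i X) = X"
  by (drule less_6_cases, elim disjE; hypsubst; cases X rule: triality_cases; simp add: triality_simps)

lemma triality_adjacent:
  "i < 5 \<Longrightarrow> foldr triality (word_pow [i, Suc i] ([3, 3, 4, 3, 3] ! i)) X = X"
  by (drule less_5_cases, elim disjE; hypsubst; cases X rule: triality_cases;
    simp add: triality_simps numeral_2_eq_2[symmetric])

lemma triality_far:
  "i < 6 \<Longrightarrow> i + 2 \<le> j \<Longrightarrow> j < 6 \<Longrightarrow> foldr triality (word_pow [i, j] 2) X = X"
  by (drule less_6_cases, drule less_6_cases, elim disjE; hypsubst; cases X rule: triality_cases;
    simp add: triality_simps numeral_2_eq_2[symmetric])

lemma triality_translation_word: "foldr triality (word_pow translation_word 3) X = X"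
  by (cases X rule: triality_cases) (simp add: triality_simps word_defs)

text \<open>
  The diagonal translation of the vertex-figure group acts with order 2, so this action satisfies the
  vertex-figure relation and even a stronger one.
\<close>

lemma triality_diagonal_word: "foldr triality (map ((-) 5) (word_pow diagonal_word 2)) X = X"
  by (cases X rule: triality_cases) (simp add: triality_simps word_defs)

section \<open>The rank six representation modulo 3\<close>

text \<open>
  In rank six the translation words are only unipotent: they need not fix the last simple root modulo
  \<open>\<delta>\<close>. Their powers are therefore computed in coordinates.
\<close>

lemma coordinates_mod_3:
  assumes "w \<in> lists {..<6}" "\<And>i. i < 6 \<Longrightarrow> 3 dvd foldr reflect w x i - x i"
  shows "3 dvd foldr reflect w x i - x i"
proof (cases "i < 6")
  case False
  have "foldr reflect w x i = x i"
    using assms(1) False by (induction w) (auto simp: reflection_def)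
  then show ?thesis by simp
qed (rule assms(2))

lemma translation_word_mod_3:
  "3 dvd foldr reflect (word_pow translation_word 3) x i - x i"
  by (rule coordinates_mod_3, simp add: word_defs, drule less_6_cases, elim disjE; hypsubst;
    simp add: word_defs reflect_simps algebra_simps; presburger?)

lemma diagonal_word_mod_3:
  "3 dvd foldr reflect (word_pow diagonal_word 3) x i - x i"
  by (rule coordinates_mod_3, simp add: word_defs, drule less_6_cases, elim disjE; hypsubst;
    simp add: word_defs reflect_simps algebra_simps; presburger?)

lemma dual_translation_word_mod_3:
  "3 dvd foldr reflect (map ((-) 5) (word_pow translation_word 3)) x i - x i"
  by (rule coordinates_mod_3, simp add: word_defs, drule less_6_cases, elim disjE; hypsubst;
    simp add: word_defs reflect_simps algebra_simps; presburger?)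

lemma dual_diagonal_word_mod_3:
  "3 dvd foldr reflect (map ((-) 5) (word_pow diagonal_word 3)) x i - x i"
  by (rule coordinates_mod_3, simp add: word_defs, drule less_6_cases, elim disjE; hypsubst;
    simp add: word_defs reflect_simps algebra_simps; presburger?)

section \<open>Facet group and vertex-figure group embed in the amalgam\<close>

text \<open>
  The vertex figure is the dual of a quotient of \<open>[3,3,4,3]\<close>, so its words enter through the reversal
  \<open>i \<mapsto> 5 - i\<close> of the diagram.
\<close>

definition amalgam_relators :: "nat list set" where
  "amalgam_relators = coxeter_relators [3, 3, 4, 3, 3] \<union>
    {word_pow translation_word 3, map ((-) 5) (word_pow diagonal_word 6)}"

lemma coxeter_relators_amalgam: "coxeter_relators [3, 3, 4, 3, 3] \<subseteq> amalgam_relators"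
  "coxeter_relators [3, 3, 4, 3] \<subseteq> amalgam_relators"
  using coxeter_relators_butlast[of "[3, 3, 4, 3]" 3] by (auto simp: amalgam_relators_def)

lemma coxeter_relator_dual:
  assumes w: "w \<in> coxeter_relators [3, 3, 4, 3, 3]" and R: "coxeter_relators [3, 3, 4, 3, 3] \<subseteq> R"
  shows "pres_eq 6 R (map ((-) 5) w) []"
  using w
proof (cases rule: coxeter_relators_cases)
  case (1 i)
  have "pres_eq 6 R (word_pow [4 - i, Suc (4 - i)] ([3, 3, 4, 3, 3] ! (4 - i))) []"
    using coxeter_relator_adjacent[of "4 - i" "[3, 3, 4, 3, 3]" 6 R] R by simp
  from pres_eq_rev[OF this] have "pres_eq 6 R (word_pow [Suc (4 - i), 4 - i] ([3, 3, 4, 3, 3] ! (4 - i))) []"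
    by (simp add: rev_word_pow)
  moreover have "[3, 3, 4, 3, 3] ! (4 - i) = ([3, 3, 4, 3, 3] ! i :: nat)" "5 - i = Suc (4 - i)" "5 - Suc i = 4 - i"
    using 1(1) less_5_cases[of i] by auto
  ultimately show ?thesis by (simp add: 1(2) map_word_pow)
next
  case (2 i j)
  have "pres_eq 6 R (word_pow [5 - j, 5 - i] 2) []"
    using coxeter_relator_far[of "5 - j" "5 - i" "[3, 3, 4, 3, 3]" 6 R] R 2(1,2) by simp
  from pres_eq_rev[OF this] show ?thesis
    unfolding 2(3) map_word_pow rev_word_pow by simp
qed

lemma dual_dual: "u \<in> lists {..<6} \<Longrightarrow> map ((-) 5) (map ((-) 5) u) = (u :: nat list)"
  by (induction u) auto

lemma dual_lists: "map ((-) 5) u \<in> lists {..<6}" for u :: "nat list"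
  by (auto simp: in_lists_conv_set)

lemma reflect_cong_mod_3:
  assumes "\<And>i. [x i = y i] (mod 3)"
  shows "[reflect j x i = reflect j y i] (mod 3)"
  unfolding reflection_def using assms
  by (auto intro!: cong_diff cong_sum cong_mult)

text \<open>
  The set \<open>R\<close> closes the relators under reversal of the diagram. This gives both statements from one
  representation, and hence the same lattice and the same long roots for facets and vertex figures.
\<close>

lemma act_mod_3:
  assumes "pres_eq 6 amalgam_relators u v"
  shows "[foldr reflect u x i = foldr reflect v x i] (mod 3)"
    and "[foldr reflect (map ((-) 5) u) x i = foldr reflect (map ((-) 5) v) x i] (mod 3)"
proof -
  define R where "R = coxeter_relators [3, 3, 4, 3, 3] \<union>
    {word_pow translation_word 3, word_pow diagonal_word 6,
      map ((-) 5) (word_pow translation_word 3), map ((-) 5) (word_pow diagonal_word 6)}"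
  have cox_R: "coxeter_relators [3, 3, 4, 3, 3] \<subseteq> R" unfolding R_def by blast
  have six: "translation_word \<in> lists {..<6}" "diagonal_word \<in> lists {..<6}"
    by (simp_all add: word_defs)
  define E :: "((nat \<Rightarrow> int) \<times> (nat \<Rightarrow> int)) set" where "E = {(x, y). \<forall>i. [x i = y i] (mod 3)}"
  have act: "[foldr reflect u x i = foldr reflect v x i] (mod 3)" if "pres_eq 6 R u v" for u v x i
  proof -
    have "(foldr reflect u x, foldr reflect v x) \<in> E"
    proof (rule pres_eq_act[OF that, where D = UNIV])
      show "equiv UNIV E"
        unfolding E_def by (intro equivI refl_onI symI transI) (auto intro: cong_sym cong_trans)
      show "(reflect i x, reflect i y) \<in> E" if "(x, y) \<in> E" for i x y
        using that unfolding E_def by (auto intro: reflect_cong_mod_3)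
      show "(reflect i (reflect i x), x) \<in> E" if "i < 6" for i x
        using affine.reflection_involution[OF that] by (simp add: E_def)
      show "(foldr reflect w x, x) \<in> E" if w: "w \<in> R" for w x
      proof -
        have six_3: "word_pow w 6 = word_pow (word_pow w 3) 2" for w
          by (simp add: word_pow_mult[symmetric] del: word_pow_numeral)
        have double: "3 dvd foldr reflect (word_pow w 2) x i - x i"
          if "\<And>x i. 3 dvd foldr reflect w x i - x i" for w x i
          using dvd_add[OF that[of "foldr reflect w x" i] that[of x i]] by simp
        from w consider "w \<in> coxeter_relators [3, 3, 4, 3, 3]" | "w = word_pow translation_word 3"
          | "w = word_pow diagonal_word 6" | "w = map ((-) 5) (word_pow translation_word 3)"
          | "w = map ((-) 5) (word_pow diagonal_word 6)"
          unfolding R_def by blast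
        then have "3 dvd foldr reflect w x i - x i" for i
        proof cases
          case 1
          then show ?thesis by (simp add: coxeter_relator_acts)
        next
          case 2
          then show ?thesis using translation_word_mod_3 by blast
        next
          case 3
          then show ?thesis
            using double[OF diagonal_word_mod_3] unfolding six_3 by blast
        next
          case 4
          then show ?thesis using dual_translation_word_mod_3 by blast
        next
          case 5
          then show ?thesis
            using double[OF dual_diagonal_word_mod_3] unfolding six_3 map_word_pow[of _ _ 2] by blast
        qed
        then show ?thesis by (simp add: E_def cong_iff_dvd_diff)
      qed
    qed simp_all
    then show ?thesis by (simp add: E_def)
  qed
  have "pres_eq 6 R u v"
    using assms by (rule pres_eq_mono) (auto simp: amalgam_relators_def R_def intro!: pres_eq_relator)
  then show "[foldr reflect u x i = foldr reflect v x i] (mod 3)" by (rule act)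
  have "pres_eq 6 R (map ((-) 5) u) (map ((-) 5) v)"
    using assms
  proof (rule pres_eq_map)
    fix w assume "w \<in> amalgam_relators"
    then consider "w \<in> coxeter_relators [3, 3, 4, 3, 3]" | "w = word_pow translation_word 3"
      | "w = map ((-) 5) (word_pow diagonal_word 6)"
      unfolding amalgam_relators_def by blast
    then show "pres_eq 6 R (map ((-) 5) w) []"
    proof cases
      case 1
      then show ?thesis using coxeter_relator_dual cox_R by blast
    next
      case 2
      then have "map ((-) 5) w \<in> R" unfolding R_def by blast
      then show ?thesis using dual_lists by (rule pres_eq_relator)
    next
      case 3
      then have "map ((-) 5) w = word_pow diagonal_word 6"
        using six by (simp add: dual_dual del: word_pow_numeral map_map)
      then have "map ((-) 5) w \<in> R" unfolding R_def by simp
      then show ?thesis using dual_lists by (rule pres_eq_relator)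
    qed
  qed simp
  then show "[foldr reflect (map ((-) 5) u) x i = foldr reflect (map ((-) 5) v) x i] (mod 3)"
    by (rule act)
qed

lemma triality_act:
  assumes "pres_eq 6 amalgam_relators u v"
  shows "foldr triality u X = foldr triality v X"
proof -
  have "(foldr triality u X, foldr triality v X) \<in> Id"
  proof (rule pres_eq_act[OF assms, where D = UNIV])
    show "equiv UNIV Id" by (intro equivI refl_onI symI transI) auto
    show "(triality i (triality i X), X) \<in> Id" if "i < 6" for i X
      using triality_involution[OF that] by simp
    show "(foldr triality w X, X) \<in> Id" if "w \<in> amalgam_relators" for w X
    proof -
      from that consider (cox) "w \<in> coxeter_relators [3, 3, 4, 3, 3]" | (tr) "w = word_pow translation_word 3"
        | (di) "w = map ((-) 5) (word_pow diagonal_word 6)"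
        unfolding amalgam_relators_def by blast
      then have "foldr triality w X = X"
      proof cases
        case cox
        then show ?thesis
        proof (cases rule: coxeter_relators_cases)
          case (1 i)
          from triality_adjacent[of i X] 1(1) show ?thesis unfolding 1(2) by simp
        next
          case (2 i j)
          from triality_far[of i j X] 2(1,2) show ?thesis unfolding 2(3) by simp
        qed
      next
        case tr
        then show ?thesis using triality_translation_word by blast
      next
        case di
        have "word_pow diagonal_word 6 = word_pow (word_pow diagonal_word 2) 3"
          by (simp add: word_pow_mult[symmetric] del: word_pow_numeral)
        moreover have "foldr triality (map ((-) 5) (word_pow (word_pow diagonal_word 2) k)) X = X" for k
          using triality_diagonal_word by (induction k) simp_all
        ultimately show ?thesis using di by (simp del: word_pow_numeral)
      qed
      then show ?thesis by simp
    qed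
  qed simp_all
  then show ?thesis by simp
qed

text \<open>
  A word trivial in the amalgam acts trivially modulo 3, hence is a translation by a multiple of 3, and such
  translations are already trivial in the facet group.
\<close>

lemma facet_subgroup_iff:
  assumes "u \<in> lists {..<5}" "v \<in> lists {..<5}"
  shows "pres_eq 6 amalgam_relators u v \<longleftrightarrow> pres_eq 5 facet_relators u v"
proof
  assume "pres_eq 5 facet_relators u v"
  then show "pres_eq 6 amalgam_relators u v"
  proof (rule pres_eq_mono)
    fix w :: "nat list" assume "w \<in> facet_relators" "w \<in> lists {..<5}"
    then have "w \<in> amalgam_relators" "w \<in> lists {..<6}"
      using coxeter_relators_amalgam(2) by (auto simp: facet_relators_def amalgam_relators_def in_lists_conv_set)
    then show "pres_eq 6 amalgam_relators w []" by (rule pres_eq_relator)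
  qed simp
next
  assume *: "pres_eq 6 amalgam_relators u v"
  have lists: "u \<in> lists {..<6}" "v \<in> lists {..<6}" using assms by (auto simp: in_lists_conv_set)
  have "pres_eq 6 amalgam_relators (u @ rev v) []"
    using * lists by (simp add: pres_eq_cancel_iff)
  from act_mod_3(1)[OF this] obtain k where "translates (u @ rev v) (\<lambda>j. 3 * k j)"
    using act_mod_3_translates[of "u @ rev v"] assms by auto
  then show "pres_eq 5 facet_relators u v"
    using facet_trivial[of "u @ rev v" k] assms by (simp add: pres_eq_cancel_iff)
qed

lemma affine_dual_amalgam:
  assumes "pres_eq 5 (coxeter_relators [3, 3, 4, 3]) u v"
  shows "pres_eq 6 amalgam_relators (map ((-) 5) u) (map ((-) 5) v)"
  using assms
proof (rule pres_eq_map)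
  fix w assume "w \<in> coxeter_relators [3, 3, 4, 3]"
  then have "w \<in> coxeter_relators [3, 3, 4, 3, 3]"
    using coxeter_relators_butlast[of "[3, 3, 4, 3]" 3] by auto
  then show "pres_eq 6 amalgam_relators (map ((-) 5) w) []"
    using coxeter_relator_dual coxeter_relators_amalgam(1) by blast
qed simp

text \<open>
  Reads the parity of one exponent off the orbit of a vector that is moved, with period 2, by one of the four maps
  only.
\<close>

lemma even_exponent_of_separating_vector:
  fixes f :: "nat \<Rightarrow> 'a \<Rightarrow> 'a"
  assumes prod: "(f 1 ^^ m 1) ((f 2 ^^ m 2) ((f 3 ^^ m 3) ((f 4 ^^ m 4) v))) = v"
    and j: "j \<in> {1..4}" "f j v = v'" "f j v' = v" "v' \<noteq> v"
    and other: "\<And>i. i = Suc 0 \<or> i = 2 \<or> i = 3 \<or> i = 4 \<Longrightarrow> i \<noteq> j \<Longrightarrow> f i v = v \<and> f i v' = v'"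
  shows "even (m j)"
proof -
  have fix_pow: "(g ^^ k) x = x" if "g x = x" for g :: "'a \<Rightarrow> 'a" and k x
    using that by (induction k) simp_all
  have other_pow: "(f i ^^ k) v = v" "(f i ^^ k) v' = v'" if "i \<in> {1..4}" "i \<noteq> j" for i k
    using other[OF one_to_four_cases[OF that(1)] that(2)] fix_pow by auto
  have own_pow: "(f j ^^ k) v = (if even k then v else v')" for k
    using j by (induction k) auto
  have "(f 1 ^^ m 1) ((f 2 ^^ m 2) ((f 3 ^^ m 3) ((f 4 ^^ m 4) v))) = (f j ^^ m j) v"
    using own_pow other_pow[of 1] other_pow[of 2] other_pow[of 3] other_pow[of 4] one_to_four_cases[OF j(1)]
    by (elim disjE) simp_all
  then show ?thesis using prod own_pow[of "m j"] j(4) by metis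
qed

lemma foldr_word_pow: "foldr f (word_pow w m) X = (foldr f w ^^ m) X"
  by (induction m) simp_all

text \<open>
  The images of the translations form a group of order 64, of type \<open>4\<^sup>2 \<times> 2\<^sup>2\<close> in
  the chosen basis. Each exponent is tested on a separate triple of octonions. For the two elements of order 4 the
  test is first applied to the translations and then to their squares.
\<close>

lemma triality_translation_orders:
  assumes "foldr triality (map ((-) 5) (translation_product (\<lambda>j. word_pow (basis_translation j) (m j)))) = id"
  shows "4 dvd m 1" "4 dvd m 2" "even (m 3)" "even (m 4)"
proof -
  let ?O = "Oct 0 0 0 0 0 0 0 0"
  define F where "F j = foldr triality (map ((-) 5) (basis_translation j))" for j
  have prod: "(F 1 ^^ m 1) ((F 2 ^^ m 2) ((F 3 ^^ m 3) ((F 4 ^^ m 4) v))) = v" for v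
    using fun_cong[OF assms, of v] by (simp add: translation_product_def map_word_pow foldr_word_pow F_def)
  note F_eval = F_def word_defs triality_simps
  have even1: "even (m 1)"
    by (rule even_exponent_of_separating_vector[OF prod[of "(Oct 0 0 0 0 1 0 1 0, ?O, ?O)"],
          where v' = "(Oct 1 0 0 0 1 0 1 0, ?O, ?O)"])
      (simp | elim disjE; simp add: F_eval | simp add: F_eval)+
  have even2: "even (m 2)"
    by (rule even_exponent_of_separating_vector[OF prod[of "(Oct 0 0 0 0 1 0 0 0, ?O, ?O)"],
          where v' = "(Oct 1 0 0 0 1 0 0 0, ?O, ?O)"])
      (simp | elim disjE; simp add: F_eval | simp add: F_eval)+
  show even3: "even (m 3)"
    by (rule even_exponent_of_separating_vector[OF prod[of "(Oct 0 1 1 0 0 0 0 0, ?O, ?O)"],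
          where v' = "(Oct 1 1 1 0 0 0 0 0, ?O, ?O)"])
      (simp | elim disjE; simp add: F_eval | simp add: F_eval)+
  show even4: "even (m 4)"
    by (rule even_exponent_of_separating_vector[OF prod[of "(?O, Oct 1 0 0 1 0 0 0 0, ?O)"],
          where v' = "(?O, Oct 1 0 1 1 0 0 0 0, ?O)"])
      (simp | elim disjE; simp add: F_eval | simp add: F_eval)+
  \<comment> \<open>All exponents being even, only the squares matter, and the squares of the last two are trivial.\<close>
  define S where "S j = F j \<circ> F j" for j
  have "F j ^^ m j = S j ^^ (m j div 2)" if "even (m j)" for j
  proof -
    have "S j = F j ^^ 2" by (simp add: S_def numeral_2_eq_2)
    then show ?thesis using that by (simp add: funpow_mult)
  qed
  then have prod2: "(S 1 ^^ (m 1 div 2)) ((S 2 ^^ (m 2 div 2)) ((S 3 ^^ (m 3 div 2)) ((S 4 ^^ (m 4 div 2)) v))) = v" for v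
    using prod even1 even2 even3 even4 by simp
  note S_eval = S_def F_eval
  have "even (m 1 div 2)"
    by (rule even_exponent_of_separating_vector[where m = "\<lambda>j. m j div 2",
          OF prod2[of "(Oct 0 0 0 0 0 1 0 1, ?O, ?O)"],
          where v' = "(Oct 1 0 0 0 0 1 0 1, ?O, ?O)"])
      (simp | elim disjE; simp add: S_eval | simp add: S_eval)+
  then show "4 dvd m 1" using even1 by presburger
  have "even (m 2 div 2)"
    by (rule even_exponent_of_separating_vector[where m = "\<lambda>j. m j div 2",
          OF prod2[of "(Oct 0 0 0 0 0 1 0 0, ?O, ?O)"],
          where v' = "(Oct 1 0 0 0 0 1 0 0, ?O, ?O)"])
      (simp | elim disjE; simp add: S_eval | simp add: S_eval)+
  then show "4 dvd m 2" using even2 by presburger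
qed

lemma vertex_figure_subgroup_hom:
  assumes "pres_eq 5 vertex_figure_relators u v"
  shows "pres_eq 6 amalgam_relators (map ((-) 5) u) (map ((-) 5) v)"
  using assms
proof (rule pres_eq_map)
  fix w :: "nat list" assume "w \<in> vertex_figure_relators" "w \<in> lists {..<5}"
  then consider "w \<in> coxeter_relators [3, 3, 4, 3]" | "w = word_pow diagonal_word 6"
    unfolding vertex_figure_relators_def by blast
  then show "pres_eq 6 amalgam_relators (map ((-) 5) w) []"
  proof cases
    case 1
    then have "w \<in> coxeter_relators [3, 3, 4, 3, 3]"
      using coxeter_relators_butlast[of "[3, 3, 4, 3]" 3] by auto
    then show ?thesis using coxeter_relator_dual coxeter_relators_amalgam(1) by blast
  next
    case 2
    then have "map ((-) 5) w \<in> amalgam_relators" unfolding amalgam_relators_def by blast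
    then show ?thesis using dual_lists by (rule pres_eq_relator)
  qed
qed simp

text \<open>
  A word trivial in the amalgam is a translation with all entries divisible by 3, so in normal form its exponents
  are 0, 3, 6 or 9. Triality forces the first two to be divisible by 4, hence zero, and the other two to be even,
  hence 0 or 6, where the corresponding power is trivial.
\<close>

lemma vertex_figure_subgroup_iff:
  assumes "u \<in> lists {..<5}" "v \<in> lists {..<5}"
  shows "pres_eq 6 amalgam_relators (map ((-) 5) u) (map ((-) 5) v) \<longleftrightarrow> pres_eq 5 vertex_figure_relators u v"
proof
  assume *: "pres_eq 6 amalgam_relators (map ((-) 5) u) (map ((-) 5) v)"
  define w where "w = u @ rev v"
  have w: "w \<in> lists {..<5}" "w \<in> lists {..<6}" using assms by (auto simp: w_def in_lists_conv_set)
  have dual_w: "pres_eq 6 amalgam_relators (map ((-) 5) w) []"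
    using * pres_eq_cancel_iff[OF dual_lists dual_lists, of amalgam_relators u v]
    by (simp add: w_def rev_map)
  have "[foldr reflect w x i = x i] (mod 3)" for x i
    using act_mod_3(2)[OF dual_w, of x i] dual_dual[OF w(2)] by (simp del: map_map)
  then obtain k where k: "translates w (\<lambda>j. 3 * k j)"
    using act_mod_3_translates[of w] w(1) by auto
  define m where "m j = nat (- (3 * k j) mod int 12)" for j
  define z where "z = translation_product (\<lambda>j. word_pow (basis_translation j) (m j))"
  have nf: "pres_eq 5 vertex_figure_relators w z"
    unfolding z_def m_def using k
    by (intro translation_normal_form vertex_figure_translation_order_12) (auto simp: vertex_figure_relators_def)
  have "pres_eq 6 amalgam_relators (map ((-) 5) z) []"
    using vertex_figure_subgroup_hom[OF nf] dual_w by (blast intro: pres_eq.sym pres_eq.trans)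
  then have "foldr triality (map ((-) 5) z) = id"
    using triality_act by fastforce
  from triality_translation_orders[OF this[unfolded z_def]]
  have div: "4 dvd m 1" "4 dvd m 2" "even (m 3)" "even (m 4)" .
  have m: "m j < 12 \<and> 3 dvd m j" for j
  proof -
    have "int (m j) = - (3 * k j) mod 12" by (simp add: m_def)
    then show ?thesis by presburger
  qed
  have "pres_eq 5 vertex_figure_relators z []"
    unfolding z_def
  proof (rule pres_eq_translation_product)
    fix j :: nat assume j: "j \<in> {1..4}"
    let ?e = "if j \<le> 2 then 12 else 6"
    have "?e dvd m j"
      using one_to_four_cases[OF j] div m[of j] by (elim disjE) (simp_all, presburger+)
    then obtain q where "m j = ?e * q" by blast
    then have "pres_eq 5 vertex_figure_relators (word_pow (basis_translation j) (m j)) (word_pow [] q)"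
      using pres_eq_word_pow[OF vertex_figure_translation_order[OF j], of q] by (simp add: word_pow_mult)
    moreover have "word_pow [] q = []" by (induction q) simp_all
    ultimately show "pres_eq 5 vertex_figure_relators (word_pow (basis_translation j) (m j)) []" by simp
  qed
  with nf have "pres_eq 5 vertex_figure_relators (u @ rev v) []"
    unfolding w_def by (rule pres_eq.trans)
  then show "pres_eq 5 vertex_figure_relators u v"
    using assms by (simp add: pres_eq_cancel_iff)
qed (rule vertex_figure_subgroup_hom)

section \<open>The intersection property from intervals\<close>

text \<open>
  The intersection of the subgroups generated by \<open>I\<close> and \<open>J\<close> is generated by
  \<open>I \<inter> J\<close>, expressed on words.
\<close>

definition words_meet :: "nat \<Rightarrow> nat list set \<Rightarrow> nat set \<Rightarrow> nat set \<Rightarrow> bool" where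
  "words_meet n R I J \<longleftrightarrow> (\<forall>u\<in>lists I. \<forall>v\<in>lists J. pres_eq n R u v \<longrightarrow>
    (\<exists>w\<in>lists (I \<inter> J). pres_eq n R u w))"

lemma words_meetD:
  assumes "words_meet n R I J" "u \<in> lists I" "v \<in> lists J" "pres_eq n R u v"
  obtains w where "w \<in> lists (I \<inter> J)" "pres_eq n R u w"
  using assms unfolding words_meet_def by blast

lemma words_meet_sym: "words_meet n R I J \<Longrightarrow> words_meet n R J I"
  unfolding words_meet_def by (metis Int_commute pres_eq.sym pres_eq.trans)

lemma lists_widen: "u \<in> lists A \<Longrightarrow> A \<subseteq> B \<Longrightarrow> u \<in> lists B"
  using lists_mono by blast

text \<open>
  If the letter \<open>k\<close> is missing, the letters below it commute with those above it.
\<close>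

lemma split_word_at_gap:
  assumes commute: "\<And>i j. i + 2 \<le> j \<Longrightarrow> j < n \<Longrightarrow> pres_eq n R [i, j] [j, i]"
    and "I \<subseteq> {..<n}" "k \<notin> I" "u \<in> lists I"
  obtains x y where "x \<in> lists (I \<inter> {..<k})" "y \<in> lists (I \<inter> {k<..})" "pres_eq n R u (x @ y)"
proof -
  have n: "w \<in> lists {..<n}" if "w \<in> lists (I \<inter> A)" for w A
    using that assms(2) by (auto simp: in_lists_conv_set)
  have move: "pres_eq n R (i # x) (x @ [i])" if "i \<in> I" "i > k" "x \<in> lists (I \<inter> {..<k})" for i x
    using that(3)
  proof (induction x)
    case Nil
    then show ?case using that assms(2) by (auto intro!: pres_eq.refl)
  next
    case (Cons j x)
    have "i < n" using that(1) assms(2) by auto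
    have "pres_eq n R ([i, j] @ x) ([j, i] @ x)"
      using Cons that \<open>i < n\<close> n[OF Cons.hyps(2)]
      by (intro pres_eq_append pres_eq.refl pres_eq.sym[OF commute]) auto
    moreover have "pres_eq n R ([j] @ (i # x)) ([j] @ (x @ [i]))"
      using Cons assms(2) by (intro pres_eq_append pres_eq.refl) auto
    ultimately show ?case using pres_eq.trans by fastforce
  qed
  have "\<exists>x\<in>lists (I \<inter> {..<k}). \<exists>y\<in>lists (I \<inter> {k<..}). pres_eq n R u (x @ y)"
    using assms(4)
  proof (induction u)
    case Nil
    then show ?case by (intro bexI[of _ "[]"]) (auto intro: pres_eq.refl)
  next
    case (Cons i u)
    then obtain x y where xy: "x \<in> lists (I \<inter> {..<k})" "y \<in> lists (I \<inter> {k<..})" "pres_eq n R u (x @ y)"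
      by blast
    have i: "i \<in> I" "i \<noteq> k" "i < n" using Cons.hyps assms(2,3) by auto
    have iu: "pres_eq n R ([i] @ u) ([i] @ x @ y)"
      using i xy(3) by (intro pres_eq_append pres_eq.refl) auto
    show ?case
    proof (cases "i < k")
      case True
      then show ?thesis using iu xy i by (intro bexI[of _ "i # x"] bexI[of _ y]) auto
    next
      case False
      then have "pres_eq n R ((i # x) @ y) ((x @ [i]) @ y)"
        using i xy n[OF xy(2)] by (intro pres_eq_append move pres_eq.refl) auto
      then have "pres_eq n R (i # u) (x @ (i # y))"
        using iu pres_eq.trans by fastforce
      then show ?thesis using xy i False by (intro bexI[of _ x] bexI[of _ "i # y"]) auto
    qed
  qed
  then show thesis using that by blast
qed

text \<open>
  The inductive step for string diagrams. Let \<open>i\<close> and \<open>j\<close> be letters missing in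
  \<open>I\<close> and in \<open>J\<close>. An element of both subgroups factors as
  \<open>u\<^sub>1u\<^sub>2 = xy\<close>, with \<open>u\<^sub>1\<close>, \<open>u\<^sub>2\<close> below and above
  \<open>i\<close>, and \<open>x\<close>, \<open>y\<close> below and above \<open>j\<close>. Then
  \<open>x\<^sup>-\<^sup>1u\<^sub>1 = yu\<^sub>2\<^sup>-\<^sup>1\<close> lies in the subgroups of both end
  intervals, hence in that of their common part, and the hypotheses for the two end intervals confine it step by
  step to the subgroup generated by the letters of \<open>I \<inter> J\<close> strictly between \<open>i\<close>
  and \<open>j\<close>. Once this is known, \<open>x\<close> and \<open>y\<close> themselves lie in the subgroup
  generated by \<open>I \<inter> J\<close>, again by the hypotheses for the two end intervals.
\<close>

lemma words_meet_extend:
  assumes commute: "\<And>i j. i + 2 \<le> j \<Longrightarrow> j < n \<Longrightarrow> pres_eq n R [i, j] [j, i]"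
    and b: "b < n"
    and low: "\<And>I J. I \<subseteq> {a..<b} \<Longrightarrow> J \<subseteq> {a..<b} \<Longrightarrow> words_meet n R I J"
    and high: "\<And>I J. I \<subseteq> {Suc a..b} \<Longrightarrow> J \<subseteq> {Suc a..b} \<Longrightarrow> words_meet n R I J"
    and ends: "words_meet n R {a..<b} {Suc a..b}"
    and I: "I \<subseteq> {a..b}" "i \<in> {a..b} - I" and J: "J \<subseteq> {a..b}" "j \<in> {a..b} - J" and "i \<le> j"
  shows "words_meet n R I J"
  unfolding words_meet_def
proof (intro ballI impI)
  fix u v assume u: "u \<in> lists I" and v: "v \<in> lists J" and uv: "pres_eq n R u v"
  have In: "I \<subseteq> {..<n}" and Jn: "J \<subseteq> {..<n}" using I J b by auto
  obtain u1 u2 where u12: "u1 \<in> lists (I \<inter> {..<i})" "u2 \<in> lists (I \<inter> {i<..})" "pres_eq n R u (u1 @ u2)"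
    using split_word_at_gap[OF commute In _ u, of i] I(2) by blast
  obtain x y where xy: "x \<in> lists (J \<inter> {..<j})" "y \<in> lists (J \<inter> {j<..})" "pres_eq n R v (x @ y)"
    using split_word_at_gap[OF commute Jn _ v, of j] J(2) by blast
  have n: "w \<in> lists {..<n}" if "w \<in> lists A" "A \<subseteq> {a..b}" for w A
    using that b by (auto simp: in_lists_conv_set)
  have lists_n: "u1 \<in> lists {..<n}" "u2 \<in> lists {..<n}" "x \<in> lists {..<n}" "y \<in> lists {..<n}"
    using u12(1,2) xy(1,2) In Jn by (auto simp: in_lists_conv_set)
  have eq: "pres_eq n R (u1 @ u2) (x @ y)"
    using u12(3) xy(3) uv by (blast intro: pres_eq.sym pres_eq.trans)
  let ?p = "rev x @ u1" and ?q = "y @ rev u2"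
  have p_q: "pres_eq n R ?p ?q"
  proof -
    have "pres_eq n R (rev x @ (u1 @ u2) @ rev u2) (rev x @ (x @ y) @ rev u2)"
      using eq lists_n by (intro pres_eq_context) simp_all
    moreover have "pres_eq n R ((rev x @ u1) @ (u2 @ rev u2)) ((rev x @ u1) @ [])"
      using lists_n by (intro pres_eq_append pres_eq.refl pres_eq_append_rev) simp_all
    moreover have "pres_eq n R ((rev x @ x) @ (y @ rev u2)) (y @ rev u2)"
      using lists_n by (intro pres_eq_Nil_left pres_eq_rev_append pres_eq.refl) simp_all
    ultimately show ?thesis by simp (meson pres_eq.sym pres_eq.trans)
  qed
  have p: "?p \<in> lists ((I \<inter> {..<i}) \<union> (J \<inter> {..<j}))" and q: "?q \<in> lists ((J \<inter> {j<..}) \<union> (I \<inter> {i<..}))"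
    using u12 xy by (auto simp: in_lists_conv_set)
  have p_low: "?p \<in> lists {a..<j}"
    by (rule lists_widen[OF p]) (use I J \<open>i \<le> j\<close> in auto)
  have q_high: "?q \<in> lists {Suc i..b}"
    by (rule lists_widen[OF q]) (use I J \<open>i \<le> j\<close> in auto)
  have ab: "a \<le> i" "j \<le> b" using I J by auto
  \<comment> \<open>The common value lies between the gaps.\<close>
  obtain z0 where z0: "z0 \<in> lists ({a..<b} \<inter> {Suc a..b})" "pres_eq n R ?p z0"
    by (rule words_meetD[OF ends _ _ p_q])
      (use p_low q_high ab in \<open>auto intro: lists_widen\<close>)
  obtain z1 where z1: "z1 \<in> lists ({a..<j} \<inter> {Suc a..<b})" "pres_eq n R ?p z1"
    by (rule words_meetD[OF low[of "{a..<j}" "{Suc a..<b}"] p_low _ z0(2)])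
      (use z0(1) ab in \<open>auto intro: lists_widen\<close>)
  have q_z1: "pres_eq n R ?q z1" using p_q z1(2) by (blast intro: pres_eq.sym pres_eq.trans)
  obtain z2 where z2: "z2 \<in> lists ({Suc i..b} \<inter> {Suc a..<j})" "pres_eq n R ?q z2"
    by (rule words_meetD[OF high[of "{Suc i..b}" "{Suc a..<j}"] q_high _ q_z1])
      (use z1(1) ab in \<open>auto intro: lists_widen\<close>)
  have p_z2: "pres_eq n R ?p z2" using p_q z2(2) by (rule pres_eq.trans)
  let ?M = "{Suc i..<j}"
  have z2M: "z2 \<in> lists ?M" by (rule lists_widen[OF z2(1)]) auto
  obtain z3 where z3: "z3 \<in> lists (((I \<inter> {..<i}) \<union> (J \<inter> {..<j})) \<inter> ?M)" "pres_eq n R ?p z3"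
    by (rule words_meetD[OF low[of "(I \<inter> {..<i}) \<union> (J \<inter> {..<j})" ?M] p z2M p_z2])
      (use I J ab \<open>i \<le> j\<close> in auto)
  have z3J: "z3 \<in> lists (J \<inter> ?M)" by (rule lists_widen[OF z3(1)]) auto
  have q_z3: "pres_eq n R ?q z3" using p_q z3(2) by (blast intro: pres_eq.sym pres_eq.trans)
  obtain z where z: "z \<in> lists (((J \<inter> {j<..}) \<union> (I \<inter> {i<..})) \<inter> (J \<inter> ?M))" "pres_eq n R ?q z"
    by (rule words_meetD[OF high[of "(J \<inter> {j<..}) \<union> (I \<inter> {i<..})" "J \<inter> ?M"] q z3J q_z3])
      (use I J ab \<open>i \<le> j\<close> in auto)
  have zIJ: "z \<in> lists (I \<inter> J \<inter> ?M)" by (rule lists_widen[OF z(1)]) auto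
  have zn: "z \<in> lists {..<n}" by (rule n[OF zIJ]) (use I in auto)
  have p_z: "pres_eq n R ?p z" using p_q z(2) by (rule pres_eq.trans)
  \<comment> \<open>Hence both factors of \<open>v\<close> can be rewritten.\<close>
  have x_eq: "pres_eq n R x (u1 @ rev z)"
  proof -
    have "pres_eq n R (u1 @ rev z) (u1 @ rev ?p)"
      using p_z lists_n by (intro pres_eq_append pres_eq.refl pres_eq_rev pres_eq.sym[OF p_z])
    moreover have "pres_eq n R ((u1 @ rev u1) @ x) x"
      using lists_n by (intro pres_eq_Nil_left pres_eq_append_rev pres_eq.refl)
    ultimately show ?thesis by simp (meson pres_eq.sym pres_eq.trans)
  qed
  have y_eq: "pres_eq n R y (z @ u2)"
  proof -
    have "pres_eq n R (z @ u2) (?q @ u2)"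
      using lists_n by (intro pres_eq_append pres_eq.refl pres_eq.sym[OF z(2)])
    moreover have "pres_eq n R (y @ (rev u2 @ u2)) (y @ [])"
      using lists_n by (intro pres_eq_append pres_eq_rev_append pres_eq.refl)
    ultimately show ?thesis by simp (meson pres_eq.sym pres_eq.trans)
  qed
  obtain x' where x': "x' \<in> lists ((J \<inter> {..<j}) \<inter> ((I \<inter> {..<i}) \<union> (I \<inter> J \<inter> ?M)))" "pres_eq n R x x'"
  proof (rule words_meetD[OF low[of "J \<inter> {..<j}" "(I \<inter> {..<i}) \<union> (I \<inter> J \<inter> ?M)"] xy(1) _ x_eq])
    show "u1 @ rev z \<in> lists ((I \<inter> {..<i}) \<union> (I \<inter> J \<inter> ?M))"
      using u12(1) zIJ by (auto simp: in_lists_conv_set)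
  qed (use I J ab \<open>i \<le> j\<close> in auto)
  obtain y' where y': "y' \<in> lists ((J \<inter> {j<..}) \<inter> ((I \<inter> {i<..}) \<union> (I \<inter> J \<inter> ?M)))" "pres_eq n R y y'"
  proof (rule words_meetD[OF high[of "J \<inter> {j<..}" "(I \<inter> {i<..}) \<union> (I \<inter> J \<inter> ?M)"] xy(2) _ y_eq])
    show "z @ u2 \<in> lists ((I \<inter> {i<..}) \<union> (I \<inter> J \<inter> ?M))"
      using u12(2) zIJ by (auto simp: in_lists_conv_set)
  qed (use I J ab \<open>i \<le> j\<close> in auto)
  have "pres_eq n R (x @ y) (x' @ y')" using x'(2) y'(2) by (rule pres_eq_append)
  then have "pres_eq n R u (x' @ y')"
    using uv xy(3) by (blast intro: pres_eq.trans)
  moreover have "x' @ y' \<in> lists (I \<inter> J)"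
    using x'(1) y'(1) by (auto simp: in_lists_conv_set)
  ultimately show "\<exists>w\<in>lists (I \<inter> J). pres_eq n R u w" by blast
qed

theorem words_meet_of_intervals:
  assumes commute: "\<And>i j. i + 2 \<le> j \<Longrightarrow> j < n \<Longrightarrow> pres_eq n R [i, j] [j, i]"
    and ends: "\<And>a b. a < b \<Longrightarrow> b < n \<Longrightarrow> words_meet n R {a..<b} {Suc a..b}"
    and "I \<subseteq> {..<n}" "J \<subseteq> {..<n}"
  shows "words_meet n R I J"
proof -
  have n: "w \<in> lists I \<Longrightarrow> I \<subseteq> {..<n} \<Longrightarrow> w \<in> lists {..<n}" for w I
    by (auto simp: in_lists_conv_set)
  have full: "words_meet n R I J" if "I \<subseteq> J" "J \<subseteq> {..<n}" for I J
    unfolding words_meet_def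
  proof (intro ballI impI)
    fix u assume "u \<in> lists I"
    moreover have "I \<inter> J = I" using that by blast
    ultimately show "\<exists>w\<in>lists (I \<inter> J). pres_eq n R u w"
      using n[of u I] that by (intro bexI[of _ u] pres_eq.refl) auto
  qed
  have "words_meet n R I J" if "I \<subseteq> {a..<a + d}" "J \<subseteq> {a..<a + d}" "a + d \<le> n" for a d I J
    using that
  proof (induction d arbitrary: a I J)
    case 0
    then show ?case by (intro full) auto
  next
    case (Suc d)
    let ?b = "a + d"
    have range: "{a..<a + Suc d} = {a..?b}" by auto
    have low: "words_meet n R I J" if "I \<subseteq> {a..<?b}" "J \<subseteq> {a..<?b}" for I J
      using that Suc.prems(3) by (intro Suc.IH[of _ a]) auto
    have high: "words_meet n R I J" if "I \<subseteq> {Suc a..?b}" "J \<subseteq> {Suc a..?b}" for I J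
      using that Suc.prems(3) by (intro Suc.IH[of _ "Suc a"]) auto
    have ends': "words_meet n R {a..<?b} {Suc a..?b}"
    proof (cases "d = 0")
      case True
      then show ?thesis by (intro full) auto
    next
      case False
      then show ?thesis using Suc.prems(3) by (intro ends) auto
    qed
    note extend = words_meet_extend[OF commute _ low high ends']
    consider (I) "I = {a..?b}" | (J) "J = {a..?b}"
      | (gap) i j where "i \<in> {a..?b} - I" "j \<in> {a..?b} - J"
      using Suc.prems unfolding range by blast
    then show ?case
    proof cases
      case I
      then show ?thesis using Suc.prems unfolding range by (intro words_meet_sym[OF full]) auto
    next
      case J
      then show ?thesis using Suc.prems unfolding range by (intro full) auto
    next
      case (gap i j)
      show ?thesis
      proof (cases "i \<le> j")
        case True
        then show ?thesis using gap Suc.prems unfolding range by (intro extend[of I i J j]) auto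
      next
        case False
        then show ?thesis
          using gap Suc.prems unfolding range by (intro words_meet_sym[OF extend[of J j I i]]) auto
      qed
    qed
  qed
  from this[of I 0 n J] show ?thesis using assms(3,4) by (simp add: atLeast0LessThan)
qed

lemma intersection_property_presented_group:
  assumes "\<And>I J. I \<subseteq> {..<n} \<Longrightarrow> J \<subseteq> {..<n} \<Longrightarrow> words_meet n R I J"
  shows "intersection_property (presented_group n R) (map (\<lambda>i. word_class n R [i]) [0..<n])"
  unfolding intersection_property_def
proof (intro allI impI)
  fix I J assume "I \<subseteq> {..<length (map (\<lambda>i. word_class n R [i]) [0..<n])}"
    "J \<subseteq> {..<length (map (\<lambda>i. word_class n R [i]) [0..<n])}"
  then have IJ: "I \<subseteq> {..<n}" "J \<subseteq> {..<n}" by simp_all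
  have gen: "generate (presented_group n R) ((!) (map (\<lambda>i. word_class n R [i]) [0..<n]) ` K) =
      word_class n R ` lists K" if "K \<subseteq> {..<n}" for K
  proof -
    have "(!) (map (\<lambda>i. word_class n R [i]) [0..<n]) ` K = (\<lambda>i. word_class n R [i]) ` K"
      using that by (intro image_cong) auto
    then show ?thesis using generate_word_class[OF that] by simp
  qed
  have "word_class n R ` lists I \<inter> word_class n R ` lists J = word_class n R ` lists (I \<inter> J)"
  proof
    show "word_class n R ` lists (I \<inter> J) \<subseteq> word_class n R ` lists I \<inter> word_class n R ` lists J"
      by auto
    show "word_class n R ` lists I \<inter> word_class n R ` lists J \<subseteq> word_class n R ` lists (I \<inter> J)"
    proof
      fix c assume "c \<in> word_class n R ` lists I \<inter> word_class n R ` lists J"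
      then obtain u v where u: "u \<in> lists I" "c = word_class n R u" and v: "v \<in> lists J" "c = word_class n R v"
        by blast
      have un: "u \<in> lists {..<n}" by (rule lists_widen[OF u(1) IJ(1)])
      have "pres_eq n R u v" using u v word_class_eq_iff[OF un] by metis
      then obtain w where "w \<in> lists (I \<inter> J)" "pres_eq n R u w"
        using words_meetD[OF assms[OF IJ] u(1) v(1)] by blast
      then show "c \<in> word_class n R ` lists (I \<inter> J)"
        using u(2) word_class_eq_iff[OF un] by blast
    qed
  qed
  then show "generate (presented_group n R) ((!) (map (\<lambda>i. word_class n R [i]) [0..<n]) ` I) \<inter>
      generate (presented_group n R) ((!) (map (\<lambda>i. word_class n R [i]) [0..<n]) ` J) =
      generate (presented_group n R) ((!) (map (\<lambda>i. word_class n R [i]) [0..<n]) ` (I \<inter> J))"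
    using IJ by (simp add: gen le_infI1)
qed

section \<open>The amalgam is a regular polytope\<close>

definition highest_root_word :: "nat list" where
  "highest_root_word = sigma_word @ tau_word @ sigma_word"

text \<open>
  Modulo translations, the affine reflection \<open>a\<close> is the reflection in the highest root of
  \<open>F\<^sub>4\<close>.
\<close>

definition linear_part :: "nat list \<Rightarrow> nat list" where
  "linear_part u = concat (map (\<lambda>i. if i = 0 then highest_root_word else [i]) u)"

lemma highest_root_word_lists: "highest_root_word \<in> lists {1..<5}"
  by (simp add: highest_root_word_def word_defs)

lemma linear_part_lists: "u \<in> lists {..<5} \<Longrightarrow> linear_part u \<in> lists {1..<5}"
  using highest_root_word_lists by (induction u) (auto simp: linear_part_def)

lemma act_support_5:
  assumes "u \<in> lists {..<5}" "\<forall>i\<ge>5. x i = 0"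
  shows "\<forall>i\<ge>5. foldr reflect u x i = 0"
  using assms affine.act_coordinate[OF assms(1), of _ x] by auto

lemma reflect_add_delta: "i < 5 \<Longrightarrow> reflect i (\<lambda>k. x k + c * delta k) = (\<lambda>k. reflect i x k + c * delta k)"
  using affine.reflection_linear[of i 1 x c delta] reflect_delta[of i] by simp

lemma act_linear_part:
  assumes "u \<in> lists {..<5}" "\<forall>i\<ge>5. x i = 0"
  shows "\<exists>m. foldr reflect u x = (\<lambda>k. foldr reflect (linear_part u) x k + m * delta k)"
  using assms
proof (induction u)
  case Nil
  show ?case by (intro exI[of _ 0]) (simp add: linear_part_def)
next
  case (Cons i u)
  let ?h = "linear_part u"
  let ?y = "foldr reflect ?h x"
  have i: "i < 5" "u \<in> lists {..<5}" using Cons.hyps by auto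
  obtain m where m: "foldr reflect u x = (\<lambda>k. ?y k + m * delta k)"
    using Cons by blast
  have step: "foldr reflect (i # u) x = (\<lambda>k. reflect i ?y k + m * delta k)"
    using i(1) m by (simp add: reflect_add_delta)
  show ?case
  proof (cases "i = 0")
    case False
    then have "linear_part (i # u) = [i] @ ?h" by (simp add: linear_part_def)
    then show ?thesis using step by auto
  next
    case True
    let ?z = "foldr reflect highest_root_word ?y"
    have "?h \<in> lists {..<5}"
      by (rule lists_widen[OF linear_part_lists[OF i(2)]]) auto
    then have "\<forall>i\<ge>5. ?y i = 0" using Cons.prems by (intro act_support_5)
    then have "foldr reflect translation_word ?y =
        (\<lambda>k. ?y k + (\<Sum>j<5. [2, - 1, 0, 0, 0] ! j * ?y j) * delta k)"
      by (intro translatesD[OF translates_translation_word]) simp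
    then obtain c where c: "foldr reflect translation_word ?y = (\<lambda>k. ?y k + c * delta k)"
      by blast
    have "translation_word = 0 # highest_root_word"
      by (simp add: translation_word_def highest_root_word_def)
    from c[unfolded this] have "reflect 0 ?z = (\<lambda>k. ?y k + c * delta k)" by simp
    then have "reflect 0 (reflect 0 ?z) = (\<lambda>k. reflect 0 ?y k + c * delta k)"
      using reflect_add_delta[of 0 ?y c] by simp
    then have "?z = (\<lambda>k. reflect 0 ?y k + c * delta k)"
      using affine.reflection_involution[of 0 ?z] by simp
    then have "foldr reflect (i # u) x = (\<lambda>k. ?z k + (m - c) * delta k)"
      using step True by (auto simp: algebra_simps)
    moreover have "linear_part (i # u) = highest_root_word @ ?h"
      using True by (simp add: linear_part_def)
    ultimately show ?thesis by auto
  qed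
qed

text \<open>
  Write \<open>u\<close> as a translation times its linear part \<open>h\<close>, which preserves the coordinate
  0. The translation changes that coordinate of a vector by its functional, so the functional vanishes modulo 3,
  and in the facet group such a translation is trivial.
\<close>

lemma facet_stabilizer:
  assumes u: "u \<in> lists {..<5}"
    and cong: "\<And>x. [foldr reflect u x 0 = x 0] (mod 3)"
  shows "\<exists>h\<in>lists {1..<5}. pres_eq 5 facet_relators u h"
proof -
  define h where "h = linear_part u"
  have h: "h \<in> lists {1..<5}" using linear_part_lists[OF u] by (simp add: h_def)
  have "h \<in> lists {..<5}" by (rule lists_widen[OF h]) auto
  then have h5: "rev h \<in> lists {..<5}" "h \<in> lists {..<5}" by simp_all
  have "\<exists>c. foldr reflect (u @ rev h) (simple_root s) = (\<lambda>k. simple_root s k + 3 * c * delta k)"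
    if s: "s < 5" for s
  proof -
    let ?y = "foldr reflect (rev h) (simple_root s)"
    have "\<forall>i\<ge>5. ?y i = 0"
      using s by (intro act_support_5[OF h5(1)]) (simp add: simple_root_def)
    then obtain m where "foldr reflect u ?y = (\<lambda>k. foldr reflect h ?y k + m * delta k)"
      using act_linear_part[OF u] unfolding h_def by blast
    then have m: "foldr reflect u ?y = (\<lambda>k. simple_root s k + m * delta k)"
      using affine.act_rev_cancel[OF h5(2), of "simple_root s"] by simp
    have "?y 0 = simple_root s 0"
      using h by (intro affine.act_coordinate[of _ "{1..<5}"]) simp_all
    then have "3 dvd m"
      using cong[of ?y] m by (simp add: cong_iff_dvd_diff)
    then obtain c where "m = 3 * c" by blast
    then show ?thesis using m by auto
  qed
  then obtain c where "\<And>s. s < 5 \<Longrightarrow>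
      foldr reflect (u @ rev h) (simple_root s) = (\<lambda>k. simple_root s k + 3 * c s * delta k)"
    by metis
  then have "translates (u @ rev h) (\<lambda>s. 3 * c s)"
    using u h5 by (intro translatesI_roots) auto
  then have "pres_eq 5 facet_relators (u @ rev h) []" by (rule facet_trivial)
  then have "pres_eq 5 facet_relators u h" using u h5 by (simp add: pres_eq_cancel_iff)
  then show ?thesis using h by blast
qed

lemma dual_in_lists: "u \<in> lists A \<Longrightarrow> map ((-) 5) u \<in> lists ((-) 5 ` A)" for u :: "nat list"
  by (induction u) auto

text \<open>
  If the interval avoids the last letter, the first coordinate is stabilized inside the lower part. If it avoids
  the letter 0, the same argument applies after reversal of the diagram. The remaining case is that of the whole
  diagram, settled in the facet group.
\<close>

lemma amalgam_ends_meet: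
  assumes ab: "a < b" "b < 6"
  shows "words_meet 6 amalgam_relators {a..<b} {Suc a..b}"
  unfolding words_meet_def
proof (intro ballI impI)
  fix u v assume u: "u \<in> lists {a..<b}" and v: "v \<in> lists {Suc a..b}"
    and eq: "pres_eq 6 amalgam_relators u v"
  have inter: "{a..<b} \<inter> {Suc a..b} = {Suc a..<b}" by auto
  have coord: "[foldr reflect u x a = x a] (mod 3)" for x
    using act_mod_3(1)[OF eq, of x a] affine.act_coordinate[OF v, of a x] by simp
  consider (low) "b \<le> 4" | (high) "b = 5" "a > 0" | (whole) "a = 0" "b = 5"
    using ab by linarith
  then have "\<exists>w\<in>lists {Suc a..<b}. pres_eq 6 amalgam_relators u w"
  proof cases
    case low
    then obtain w where w: "w \<in> lists {Suc a..<b}" "pres_eq 5 (coxeter_relators [3, 3, 4, 3]) u w"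
      using end_coordinate_stabilizer[OF ab(1) _ u] coord by blast
    from w(2) have "pres_eq 6 amalgam_relators u w"
      by (rule pres_eq_mono) (use coxeter_relators_amalgam(2) in \<open>auto intro!: pres_eq_relator simp: in_lists_conv_set\<close>)
    then show ?thesis using w(1) by blast
  next
    \<comment> \<open>Reversal turns the upper end of the interval into the letter 0.\<close>
    case high
    let ?u = "map ((-) 5) u" and ?v = "map ((-) 5) v"
    have "?v \<in> lists {0..<5 - a}" "?u \<in> lists {1..5 - a}"
      by (rule lists_widen[OF dual_in_lists[OF v]]; use high in auto)
        (rule lists_widen[OF dual_in_lists[OF u]]; use high in auto)
    note dual = this
    have "[foldr reflect ?v x 0 = x 0] (mod 3)" for x
      using act_mod_3(2)[OF eq, of x 0] affine.act_coordinate[OF dual(2), of 0 x]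
      by (simp add: cong_sym)
    then have "\<exists>w\<in>lists {Suc 0..<5 - a}. pres_eq 5 (coxeter_relators [3, 3, 4, 3]) ?v w"
      using dual(1) high ab by (intro end_coordinate_stabilizer) simp_all
    then obtain w where w: "w \<in> lists {Suc 0..<5 - a}" "pres_eq 5 (coxeter_relators [3, 3, 4, 3]) ?v w"
      by blast
    have "v \<in> lists {..<6}" by (rule lists_widen[OF v]) (use ab in auto)
    then have "pres_eq 6 amalgam_relators v (map ((-) 5) w)"
      using affine_dual_amalgam[OF w(2)] dual_dual by (simp del: map_map)
    then have "pres_eq 6 amalgam_relators u (map ((-) 5) w)" using eq by (blast intro: pres_eq.trans)
    moreover have "map ((-) 5) w \<in> lists {Suc a..<b}"
      by (rule lists_widen[OF dual_in_lists[OF w(1)]]) (use high in auto)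
    ultimately show ?thesis by blast
  next
    case whole
    have u5: "u \<in> lists {..<5}" by (rule lists_widen[OF u]) (use whole in auto)
    then obtain h where h: "h \<in> lists {1..<5}" "pres_eq 5 facet_relators u h"
      using facet_stabilizer[of u] coord whole by auto
    have "h \<in> lists {..<5}" by (rule lists_widen[OF h(1)]) auto
    then have "pres_eq 6 amalgam_relators u h" using facet_subgroup_iff[OF u5] h(2) by blast
    then show ?thesis using h(1) whole by auto
  qed
  then show "\<exists>w\<in>lists ({a..<b} \<inter> {Suc a..b}). pres_eq 6 amalgam_relators u w"
    unfolding inter .
qed

lemma amalgam_intersection_property:
  "intersection_property (presented_group 6 amalgam_relators)
    (map (\<lambda>i. word_class 6 amalgam_relators [i]) [0..<6])"
proof (rule intersection_property_presented_group)
  show "words_meet 6 amalgam_relators I J" if "I \<subseteq> {..<6}" "J \<subseteq> {..<6}" for I J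
  proof (rule words_meet_of_intervals[OF _ amalgam_ends_meet that])
    show "pres_eq 6 amalgam_relators [i, j] [j, i]" if "i + 2 \<le> j" "j < 6" for i j
      using that coxeter_relators_amalgam(1)
      by (intro pres_eq_commute coxeter_relator_far[of i j "[3, 3, 4, 3, 3]"]) auto
  qed
qed

lemma (in group) ord_eq_prime:
  assumes "x \<in> carrier G" "prime p" "x [^] p = \<one>" "x \<noteq> \<one>"
  shows "ord x = p"
  using assms pow_eq_id[of x p] ord_eq_1[of x] by (auto simp: prime_nat_iff)

lemma amalgam_word_ord_prime:
  assumes "w \<in> lists {..<6}" "prime p" "pres_eq 6 amalgam_relators (word_pow w p) []"
    and "\<not> pres_eq 6 amalgam_relators w []"
  shows "group.ord (presented_group 6 amalgam_relators) (word_class 6 amalgam_relators w) = p"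
  using assms group.ord_eq_prime[OF group_presented_group, of "word_class 6 amalgam_relators w"]
  by (simp add: word_class_pow one_presented_group word_class_eq_iff)

text \<open>
  Exact orders are certified by a diagonal matrix entry.
\<close>

lemma amalgam_nontrivial:
  assumes "\<not> [foldr reflect w (simple_root i) i = 1] (mod 3)"
  shows "\<not> pres_eq 6 amalgam_relators w []"
  using act_mod_3(1)[of w "[]" "simple_root i" i] assms by (auto simp: simple_root_def)

lemma reflect_simple_root_last:
  "j < 6 \<Longrightarrow> reflect j (simple_root j) j = - 1"
  by (drule less_6_cases, elim disjE; hypsubst; simp add: reflect_simps simple_root_def)

lemma amalgam_ord_generator:
  assumes "i < 6"
  shows "group.ord (presented_group 6 amalgam_relators) (word_class 6 amalgam_relators [i]) = 2"
proof (rule amalgam_word_ord_prime)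
  show "pres_eq 6 amalgam_relators (word_pow [i] 2) []"
    using pres_eq.involution[of "[]" 6 "[]" i amalgam_relators] assms by (simp add: numeral_2_eq_2)
  show "\<not> pres_eq 6 amalgam_relators [i] []"
    by (rule amalgam_nontrivial[of _ i]) (simp add: reflect_simple_root_last[OF assms] cong_def)
qed (use assms in simp_all)

lemma amalgam_pair_nontrivial:
  assumes "i < j" "j < 6"
  shows "\<not> pres_eq 6 amalgam_relators [i, j] []"
proof (rule amalgam_nontrivial[of _ j])
  have "foldr reflect [i, j] (simple_root j) j = - 1"
    using reflect_simple_root_last[OF assms(2)] assms(1) by (simp add: reflection_def[of _ _ i])
  then show "\<not> [foldr reflect [i, j] (simple_root j) j = 1] (mod 3)" by (simp add: cong_def)
qed

lemma amalgam_ord_adjacent: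
  assumes "i < 5"
  shows "group.ord (presented_group 6 amalgam_relators) (word_class 6 amalgam_relators [i, Suc i]) =
    [3, 3, 4, 3, 3] ! i"
proof (cases "i = 2")
  case False
  then have p: "[3, 3, 4, 3, 3] ! i = (3 :: nat)" using less_5_cases[OF assms] by auto
  show ?thesis
    unfolding p
  proof (rule amalgam_word_ord_prime)
    show "pres_eq 6 amalgam_relators (word_pow [i, Suc i] 3) []"
      using coxeter_relator_adjacent[of i "[3, 3, 4, 3, 3]" 6 amalgam_relators] assms coxeter_relators_amalgam(1)
      by (simp add: p del: word_pow_numeral)
  qed (use assms amalgam_pair_nontrivial in simp_all)
next
  case True
  let ?G = "presented_group 6 amalgam_relators" and ?x = "word_class 6 amalgam_relators [2, 3]"
  interpret G: group ?G by (rule group_presented_group)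
  have pow: "?x [^]\<^bsub>?G\<^esub> k = \<one>\<^bsub>?G\<^esub> \<longleftrightarrow> pres_eq 6 amalgam_relators (word_pow [2, 3] k) []" for k :: nat
    by (simp add: word_class_pow one_presented_group word_class_eq_iff del: word_pow_numeral)
  have "pres_eq 6 amalgam_relators (word_pow [2, 3] 4) []"
    using coxeter_relator_adjacent[of 2 "[3, 3, 4, 3, 3]" 6 amalgam_relators] coxeter_relators_amalgam(1)
    by (simp del: word_pow_numeral)
  then have dvd_4: "G.ord ?x dvd 4" using pow[of 4] G.pow_eq_id[of ?x 4] by simp
  have "\<not> pres_eq 6 amalgam_relators (word_pow [2, 3] 2) []"
    by (rule amalgam_nontrivial[of _ 3]) (simp add: reflect_simps simple_root_def cong_def)
  then have "\<not> G.ord ?x dvd 2" using pow[of 2] G.pow_eq_id[of ?x 2] by simp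
  moreover have "G.ord ?x \<le> 4" using dvd_4 by (rule dvd_imp_le) simp
  moreover have "G.ord ?x \<noteq> 0" using dvd_4 by (metis dvd_0_left_iff zero_neq_numeral)
  moreover have "G.ord ?x \<noteq> 3" using dvd_4 by auto
  ultimately have "G.ord ?x = 4"
    by (cases "G.ord ?x = 1 \<or> G.ord ?x = 2") auto
  then show ?thesis using True by simp
qed

lemma amalgam_ord_far:
  assumes "i + 2 \<le> j" "j < 6"
  shows "group.ord (presented_group 6 amalgam_relators) (word_class 6 amalgam_relators [i, j]) = 2"
proof (rule amalgam_word_ord_prime)
  show "pres_eq 6 amalgam_relators (word_pow [i, j] 2) []"
    using assms coxeter_relators_amalgam(1) by (intro coxeter_relator_far[of i j "[3, 3, 4, 3, 3]"]) auto
qed (use assms amalgam_pair_nontrivial in simp_all)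

definition amalgam_polytope :: "nat list set polytope" where
  "amalgam_polytope = (presented_group 6 amalgam_relators,
    map (\<lambda>i. word_class 6 amalgam_relators [i]) [0..<6])"

lemma regular_amalgam_polytope: "regular_polytope 6 amalgam_polytope"
proof -
  let ?G = "presented_group 6 amalgam_relators"
  let ?gs = "map (\<lambda>i. word_class 6 amalgam_relators [i]) [0..<6]"
  have nth: "?gs ! i = word_class 6 amalgam_relators [i]" if "i < 6" for i
    using that by (simp add: nth_map_upt)
  have mult: "?gs ! i \<otimes>\<^bsub>?G\<^esub> ?gs ! j = word_class 6 amalgam_relators [i, j]" if "i < 6" "j < 6" for i j
    using that word_class_mult[of "[i]" 6 "[j]" amalgam_relators] by (simp add: nth)
  have "regular_polytope_of_type [3, 3, 4, 3, 3] (?G, ?gs)"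
    unfolding regular_polytope_of_type.simps
  proof (intro conjI allI impI)
    show "group ?G" by (rule group_presented_group)
    show "set ?gs \<subseteq> carrier ?G" by auto
    have "set ?gs = (\<lambda>i. word_class 6 amalgam_relators [i]) ` {..<6}" by auto
    then show "generate ?G (set ?gs) = carrier ?G"
      using generate_word_class[of "{..<6}" 6 amalgam_relators] by (simp only: carrier_presented_group)
    show "group.ord ?G (?gs ! i) = 2" if "i < length ?gs" for i
      using that amalgam_ord_generator nth by simp
    show "group.ord ?G (?gs ! i \<otimes>\<^bsub>?G\<^esub> ?gs ! Suc i) = [3, 3, 4, 3, 3] ! i"
      if "i < length [3, 3, 4, 3, 3 :: nat]" for i
      using that amalgam_ord_adjacent[of i] mult[of i "Suc i"] by simp
    show "group.ord ?G (?gs ! i \<otimes>\<^bsub>?G\<^esub> ?gs ! j) = 2" if "i + 2 \<le> j" "j < length ?gs" for i j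
      using that amalgam_ord_far[of i j] mult[of i j] by simp
    show "intersection_property ?G ?gs" by (rule amalgam_intersection_property)
  qed simp
  then show ?thesis unfolding regular_polytope_def amalgam_polytope_def
    by (intro exI[of _ "[3, 3, 4, 3, 3]"]) simp
qed

section \<open>The amalgam is universal\<close>

lemma coxeter_quotient_3343:
  "coxeter_quotient [3, 3, 4, 3] R = (presented_group 5 (coxeter_relators [3, 3, 4, 3] \<union> R),
    map (\<lambda>i. word_class 5 (coxeter_relators [3, 3, 4, 3] \<union> R) [i]) [0..<5])"
proof -
  have "length [3, 3, 4, 3 :: nat] + 1 = 5" by simp
  then show ?thesis by (simp only: coxeter_quotient_def Let_def)
qed

lemma polytope_3343_s000_3:
  "polytope_3343_s000 3 =
    (presented_group 5 facet_relators, map (\<lambda>i. word_class 5 facet_relators [i]) [0..<5])"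
  by (simp only: polytope_3343_s000_def coxeter_quotient_3343 facet_relators_def translation_word_def)

lemma polytope_3433_ss00_6:
  "polytope_3433_ss00 6 =
    (presented_group 5 vertex_figure_relators, rev (map (\<lambda>i. word_class 5 vertex_figure_relators [i]) [0..<5]))"
proof -
  have "word_pow ([0] @ sigma_word @ tau_word) (2 * 6) = word_pow diagonal_word 6"
    by (simp only: diagonal_word_def word_pow_mult)
  then show ?thesis
    by (simp only: polytope_3433_ss00_def polytope_3343_ss00_def coxeter_quotient_3343 dual.simps
      vertex_figure_relators_def)
qed

lemma facet_amalgam_polytope: "polytope_iso (facet amalgam_polytope) (polytope_3343_s000 3)"
proof -
  have "butlast (map (\<lambda>i. word_class 6 amalgam_relators [i]) [0..<6]) =
      map (\<lambda>i. word_class 6 amalgam_relators [i]) [0..<5]"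
    by (simp add: eval_nat_numeral upt_rec)
  then show ?thesis
    using polytope_iso_presented_subgroup[of 5 "\<lambda>i. i" 6 amalgam_relators facet_relators] facet_subgroup_iff
    by (simp add: amalgam_polytope_def polytope_3343_s000_3 del: polytope_iso.simps)
qed

lemma vertex_figure_amalgam_polytope: "polytope_iso (vertex_figure amalgam_polytope) (polytope_3433_ss00 6)"
proof -
  let ?gs = "map (\<lambda>i. word_class 6 amalgam_relators [5 - i]) [0..<5]"
  have tl: "tl (map (\<lambda>i. word_class 6 amalgam_relators [i]) [0..<6]) = rev ?gs"
    by (simp add: eval_nat_numeral upt_rec)
  have "polytope_iso (subgroup_generated (presented_group 6 amalgam_relators) (set ?gs), ?gs)
      (presented_group 5 vertex_figure_relators, map (\<lambda>i. word_class 5 vertex_figure_relators [i]) [0..<5])"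
    by (rule polytope_iso_presented_subgroup) (simp_all add: vertex_figure_subgroup_iff)
  from polytope_iso_rev[OF this] show ?thesis
    by (simp only: amalgam_polytope_def vertex_figure.simps tl set_rev polytope_3433_ss00_6)
qed

lemma amalgam_polytope_covers:
  assumes P: "P \<in> polytope_class 6 (polytope_3343_s000 3) (polytope_3433_ss00 6)"
  shows "covers amalgam_polytope P"
proof -
  obtain H hs where P_eq: "P = (H, hs)" by fastforce
  have reg: "regular_polytope 6 (H, hs)" and fac: "polytope_iso (facet (H, hs)) (polytope_3343_s000 3)"
    and ver: "polytope_iso (vertex_figure (H, hs)) (polytope_3433_ss00 6)"
    using P by (simp_all add: polytope_class_def P_eq)
  obtain ps where "length ps + 1 = 6" "regular_polytope_of_type ps (H, hs)"
    using reg by (auto simp: regular_polytope_def)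
  then have H: "group H" and len: "length hs = 6" and hs: "set hs \<subseteq> carrier H"
    and gen: "generate H (set hs) = carrier H"
    and ord_gen: "\<And>i. i < 6 \<Longrightarrow> group.ord H (hs ! i) = 2"
    and ord_far: "\<And>i j. i + 2 \<le> j \<Longrightarrow> j < 6 \<Longrightarrow> group.ord H (hs ! i \<otimes>\<^bsub>H\<^esub> hs ! j) = 2"
    by auto
  interpret H: group H by fact
  have hs_i: "hs ! i \<in> carrier H" if "i < 6" for i using that hs len by auto
  have square: "x \<otimes>\<^bsub>H\<^esub> x = \<one>\<^bsub>H\<^esub>" if "x \<in> carrier H" "H.ord x = 2" for x
    using H.pow_ord_eq_1[OF that(1)] that by (simp add: numeral_2_eq_2)
  \<comment> \<open>The words that hold in \<open>H\<close> serve as relators themselves; consequences of relations known in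
    \<open>H\<close> can then be drawn in the calculus of words.\<close>
  define K where "K = {w. eval_word H ((!) hs) w = \<one>\<^bsub>H\<^esub>}"
  have K: "eval_word H ((!) hs) w = \<one>\<^bsub>H\<^esub>" if "pres_eq 6 K w []" for w
    using H.pres_eq_eval_word[OF that, of "(!) hs"] hs_i square ord_gen by (simp add: K_def)
  have facet_K: "pres_eq 6 K w []" if "w \<in> facet_relators" "w \<in> lists {..<5}" for w
  proof -
    have "polytope_iso (subgroup_generated H (set (butlast hs)), butlast hs)
        (presented_group 5 facet_relators, map (\<lambda>i. word_class 5 facet_relators [i]) [0..<5])"
      using fac by (simp only: facet.simps polytope_3343_s000_3)
    moreover have "set (butlast hs) \<subseteq> carrier H"
      using hs by (auto dest: in_set_butlastD)
    ultimately have "eval_word H ((!) (butlast hs)) w = \<one>\<^bsub>H\<^esub>"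
      using that by (intro polytope_iso_eval_word[OF H] pres_eq_relator)
    moreover have "eval_word H ((!) (butlast hs)) w = eval_word H ((!) hs) w"
      using that(2) len by (induction w) (simp_all add: nth_butlast)
    ultimately have "w \<in> K" by (simp add: K_def)
    moreover have "w \<in> lists {..<6}" by (rule lists_widen[OF that(2)]) auto
    ultimately show ?thesis by (rule pres_eq_relator)
  qed
  have vertex_K: "pres_eq 6 K (map ((-) 5) w) []" if "w \<in> vertex_figure_relators" "w \<in> lists {..<5}" for w
  proof -
    have "polytope_iso (subgroup_generated H (set (tl hs)), tl hs)
        (presented_group 5 vertex_figure_relators, rev (map (\<lambda>i. word_class 5 vertex_figure_relators [i]) [0..<5]))"
      using ver by (simp only: vertex_figure.simps polytope_3433_ss00_6)
    from polytope_iso_rev[OF this]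
    have "polytope_iso (subgroup_generated H (set (rev (tl hs))), rev (tl hs))
        (presented_group 5 vertex_figure_relators, map (\<lambda>i. word_class 5 vertex_figure_relators [i]) [0..<5])"
      by (simp only: set_rev rev_rev_ident)
    moreover have "set (rev (tl hs)) \<subseteq> carrier H"
      using hs by (cases hs) auto
    ultimately have "eval_word H ((!) (rev (tl hs))) w = \<one>\<^bsub>H\<^esub>"
      using that by (intro polytope_iso_eval_word[OF H] pres_eq_relator)
    moreover have "eval_word H ((!) (rev (tl hs))) w = eval_word H ((!) hs) (map ((-) 5) w)"
      using that(2)
    proof (induction w)
      case (Cons i w)
      then have "rev (tl hs) ! i = hs ! (5 - i)"
        using len Suc_diff_le[of i 4] by (simp add: rev_nth nth_tl)
      then show ?case using Cons by simp
    qed simp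
    ultimately have "map ((-) 5) w \<in> K" by (simp add: K_def)
    then show ?thesis using dual_lists by (rule pres_eq_relator)
  qed
  have relators: "pres_eq 6 K w []" if w: "w \<in> amalgam_relators" for w
  proof -
    from w consider (cox) "w \<in> coxeter_relators [3, 3, 4, 3, 3]" | (tr) "w = word_pow translation_word 3"
      | (di) "w = map ((-) 5) (word_pow diagonal_word 6)"
      unfolding amalgam_relators_def by blast
    then show ?thesis
    proof cases
      case cox
      then show ?thesis
      proof (cases rule: coxeter_relators_cases)
        case (1 i)
        show ?thesis
        proof (cases "i = 4")
          case True
          have "pres_eq 6 K (map ((-) 5) (word_pow [0, Suc 0] 3)) []"
          proof (rule vertex_K)
            have "word_pow [0, Suc 0] ([3, 3, 4, 3] ! 0) \<in> coxeter_relators [3, 3, 4, 3]"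
              unfolding coxeter_relators_def by (intro UnI1 CollectI exI[of _ 0]) simp
            then show "word_pow [0, Suc 0] 3 \<in> vertex_figure_relators"
              unfolding vertex_figure_relators_def by (simp del: word_pow_numeral)
          qed simp
          from pres_eq_rev[OF this] have "pres_eq 6 K (word_pow [4, 5] 3) []"
            by (simp add: map_word_pow rev_word_pow del: word_pow_numeral)
          then show ?thesis using 1(2) True by (simp del: word_pow_numeral)
        next
          case False
          then have i: "i < 4" using 1(1) by simp
          then have "[3, 3, 4, 3, 3] ! i = ([3, 3, 4, 3] ! i :: nat)"
            using less_5_cases[of i] by auto
          then have "w \<in> coxeter_relators [3, 3, 4, 3]"
            using i 1(2) unfolding coxeter_relators_def
            by (intro UnI1 CollectI exI[of _ i]) simp
          then show ?thesis
            using i 1(2) by (intro facet_K) (simp_all add: facet_relators_def)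
        qed
      next
        case (2 i j)
        then have "i < 6" "j < 6" by simp_all
        then have "eval_word H ((!) hs) w = (hs ! i \<otimes>\<^bsub>H\<^esub> hs ! j) \<otimes>\<^bsub>H\<^esub> (hs ! i \<otimes>\<^bsub>H\<^esub> hs ! j)"
          using hs_i 2(3) by (simp add: numeral_2_eq_2 H.m_assoc)
        also have "\<dots> = \<one>\<^bsub>H\<^esub>"
          using ord_far[OF 2(1) \<open>j < 6\<close>] hs_i \<open>i < 6\<close> \<open>j < 6\<close> by (intro square) auto
        finally have "w \<in> K" by (simp add: K_def)
        then show ?thesis
          using \<open>i < 6\<close> \<open>j < 6\<close> 2(3) by (intro pres_eq_relator) simp_all
      qed
    next
      case tr
      have "word_pow translation_word 3 \<in> facet_relators" unfolding facet_relators_def by blast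
      then show ?thesis unfolding tr by (intro facet_K word_pow_lists translation_words_lists)
    next
      case di
      have "word_pow diagonal_word 6 \<in> vertex_figure_relators" unfolding vertex_figure_relators_def by blast
      then show ?thesis unfolding di by (intro vertex_K word_pow_lists translation_words_lists)
    qed
  qed
  let ?U = "presented_group 6 amalgam_relators"
  obtain h where h: "h \<in> hom ?U H"
    and h_word: "\<And>w. w \<in> lists {..<6} \<Longrightarrow> h (word_class 6 amalgam_relators w) = eval_word H ((!) hs) w"
    using H.presented_group_hom[of 6 "(!) hs" amalgam_relators] hs_i square ord_gen K relators by blast
  have h_gen: "h (word_class 6 amalgam_relators [i]) = hs ! i" if "i < 6" for i
    using h_word[of "[i]"] that hs_i by simp
  interpret h: group_hom ?U H h
    using h group_presented_group by (intro group_hom.intro group_hom_axioms.intro H) auto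
  have "set hs \<subseteq> h ` carrier ?U"
  proof
    fix x assume "x \<in> set hs"
    then obtain i where "i < 6" "x = hs ! i" using len by (auto simp: in_set_conv_nth)
    then show "x \<in> h ` carrier ?U" using h_gen by (intro image_eqI[of _ _ "word_class 6 amalgam_relators [i]"]) auto
  qed
  then have "carrier H \<subseteq> h ` carrier ?U"
    using H.generate_subgroup_incl[OF _ h.img_is_subgroup] gen by blast
  then have "h ` carrier ?U = carrier H" using h by (auto simp: hom_def)
  moreover have "map h (map (\<lambda>i. word_class 6 amalgam_relators [i]) [0..<6]) = hs"
    using len h_gen by (intro nth_equalityI) auto
  ultimately show ?thesis
    using h unfolding P_eq amalgam_polytope_def covers.simps epi_def by blast
qed

theorem lemma13:
  shows "\<exists>U :: nat list set polytope.
    universal_polytope TYPE('b) 6 (polytope_3343_s000 3) (polytope_3433_ss00 6) U"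
proof (intro exI)
  show "universal_polytope TYPE('b) 6 (polytope_3343_s000 3) (polytope_3433_ss00 6) amalgam_polytope"
    unfolding universal_polytope_def
  proof (intro conjI ballI)
    show "amalgam_polytope \<in> polytope_class 6 (polytope_3343_s000 3) (polytope_3433_ss00 6)"
      unfolding polytope_class_def
      by (intro CollectI conjI regular_amalgam_polytope facet_amalgam_polytope
        vertex_figure_amalgam_polytope)
  qed (rule amalgam_polytope_covers)
qed

end
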